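(* Let $\sigma_1(x),\sigma_2(x),\gamma(x),\gamma_*(x)$, $x\in\mathrm I$, be vessel parameters on a finite dimensional Hilbert space $\mathcal E$, and let $S(\lambda,x)\in\boldsymbol{\mathcal I_r}(\sigma_1(x),\sigma_2(x),\gamma(x),\gamma_*(x),\mathrm I)$. Then there exist an interval $\mathrm I_0\subseteq\mathrm I$ (possibly smaller than $\mathrm I$), a Hilbert space $\mathcal H$ and a regular vessel $$\mathfrak{K_V}=(A,B(x),\mathbb X(x);\sigma_1(x),\sigma_2(x),\gamma(x),\gamma_*(x);\mathcal H,\mathcal E;\mathrm I_0)$$ whose transfer function coincides with $S(\lambda,x)$ for $x\in\mathrm I_0$.
   Context: Vessel parameters on a finite dimensional Hilbert space $\mathcal E$: an interval $\mathrm I=[a,b]$ and functions $\sigma_1,\sigma_2,\gamma,\gamma_*$ on $\mathrm I$ with values in operators $\mathcal E\to\mathcal E$, locally integrable, with $\sigma_1$ differentiable and invertible on $\mathrm I$, and $\sigma_1(x)=\sigma_1^*(x)$, $\sigma_2(x)=\sigma_2^*(x)$, $\gamma(x)+\gamma(x)^*=\gamma_*(x)+\gamma_*(x)^*=-\frac{d}{dx}\sigma_1(x)$ for $x\in\mathrm I$. Vessel: a collection $\mathfrak{K_V}=(A,B(x),\mathbb X(x);\sigma_1(x),\sigma_2(x),\gamma(x),\gamma_*(x);\mathcal H,\mathcal E;\mathrm I)$, where $\sigma_1,\sigma_2,\gamma,\gamma_*,\mathrm I$ are vessel parameters on $\mathcal E$, $\mathcal H$ is a Hilbert space, $A,\mathbb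 X(x):\mathcal H\to\mathcal H$ ($A$ possibly unbounded with domain $D(A)$) and $B(x):\mathcal E\to\mathcal H$ are operators ($x\in\mathrm I$). Regularity assumptions: there is $x_0\in\mathrm I$ such that $B(x_0)\mathcal E\subseteq D(A^n)$ and $\|A^nB(x_0)\|\le (C\sqrt n)^n$ for all $n\ge1$, with some $C>0$; and $\mathbb X(x)$ is self-adjoint and invertible for all $x\in\mathrm I$. Vessel conditions: $$0=\tfrac{d}{dx}(B(x)\sigma_1(x))+AB(x)\sigma_2(x)+B(x)\gamma(x),$$ $$A\mathbb X(x)+\mathbb X(x)A^*+B(x)\sigma_1(x)B^*(x)=0,\qquad \tfrac{d}{dx}\mathbb X(x)=B(x)\sigma_2(x)B^*(x),$$ $$\gamma_*(x)=\gamma(x)+\sigma_2(x)B^*(x)\mathbb X^{-1}(x)B(x)\sigma_1(x)-\sigma_1(x)B^*(x)\mathbb X^{-1}(x)B(x)\sigma_2(x).$$ The vessel is regular if $A,B(x),\mathbb X(x)$ are bounded operators for all $x$. Its transfer function is $S(\lambda,x)=I-B^*(x)\mathbb X^{-1}(x)(\lambda I-A)^{-1}B(x)\sigma_1(x)$. The class $\boldsymbol{\mathcal I_r}(\sigma_1,\sigma_2,\gamma,\gamma_*,\mathrm I)$ consists of the functions $S(\lambda,x)$ ($\lambda$ complex, $x\in\mathrm I$, values operators on $\mathcal E$) such that: (1) for all $x$, $S(\lambda,x)$ is analytic in $\lambda$ in a neighborhood of $\infty$ and $S(\infty,x)=I$; (2) for all $\lambda$ in the domain of analyticity, $S(\lambda,x)$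 is differentiable in $x$; (3) $S^*(-\bar\lambda,x)\sigma_1(x)S(\lambda,x)=\sigma_1(x)$ for $\lambda$ in the domain of analyticity; (4) multiplication by $S(\lambda,x)$ maps solutions $u(\lambda,x)$ of the input equation $-\sigma_1(x)\frac{\partial}{\partial x}u+(\sigma_2(x)\lambda+\gamma(x))u=0$ to solutions $y=S(\lambda,x)u$ of the output equation $-\sigma_1(x)\frac{\partial}{\partial x}y+(\sigma_2(x)\lambda+\gamma_*(x))y=0$ with the same $\lambda$. *)

theory Defs
  imports "HOL-Complex_Analysis.Complex_Analysis"
begin

section \<open>Complex Hilbert spaces\<close>

text \<open>The inner product is linear in its first argument. The underlying real Hilbert space has the
  inner product \<open>Re \<langle>x, y\<rangle>\<close>, which induces the same norm.\<close>

class complex_hilbert = real_inner + banach +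
  fixes scaleC :: "complex \<Rightarrow> 'a \<Rightarrow> 'a"  (infixr \<open>*\<^sub>C\<close> 75)
    and cinner :: "'a \<Rightarrow> 'a \<Rightarrow> complex"
  assumes scaleC_add_right: "c *\<^sub>C (x + y) = c *\<^sub>C x + c *\<^sub>C y"
    and scaleC_add_left: "(c + d) *\<^sub>C x = c *\<^sub>C x + d *\<^sub>C x"
    and scaleC_scaleC: "c *\<^sub>C d *\<^sub>C x = (c * d) *\<^sub>C x"
    and scaleC_of_real: "complex_of_real r *\<^sub>C x = r *\<^sub>R x"
    and cinner_commute: "cinner x y = cnj (cinner y x)"
    and cinner_add_left: "cinner (x + y) z = cinner x z + cinner y z"
    and cinner_scaleC_left: "cinner (c *\<^sub>C x) y = c * cinner x y"
    and inner_eq_Re_cinner: "inner x y = Re (cinner x y)"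

instantiation complex :: complex_hilbert
begin

definition scaleC_complex :: "complex \<Rightarrow> complex \<Rightarrow> complex"
  where "scaleC_complex c x = c * x"

definition cinner_complex :: "complex \<Rightarrow> complex \<Rightarrow> complex"
  where "cinner_complex x y = x * cnj y"

instance
  by standard
    (auto simp: scaleC_complex_def cinner_complex_def algebra_simps scaleR_conv_of_real inner_complex_def)

end

instantiation vec :: (complex_hilbert, finite) complex_hilbert
begin

definition scaleC_vec :: "complex \<Rightarrow> 'a ^ 'b \<Rightarrow> 'a ^ 'b"
  where "scaleC_vec c x = (\<chi> i. c *\<^sub>C x $ i)"

definition cinner_vec :: "'a ^ 'b \<Rightarrow> 'a ^ 'b \<Rightarrow> complex"
  where "cinner_vec x y = (\<Sum>i\<in>UNIV. cinner (x $ i) (y $ i))"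

instance
proof
  fix x y :: "'a ^ 'b"
  have "cinner (x $ i) (y $ i) = cnj (cinner (y $ i) (x $ i))" for i
    by (rule cinner_commute)
  then show "cinner x y = cnj (cinner y x)"
    by (simp add: cinner_vec_def)
qed (auto simp: vec_eq_iff scaleC_vec_def cinner_vec_def inner_vec_def scaleC_add_right
    scaleC_add_left scaleC_scaleC scaleC_of_real cinner_add_left cinner_scaleC_left
    inner_eq_Re_cinner sum.distrib sum_distrib_left)

end


subsection \<open>The space of square-summable sequences\<close>

text \<open>Types cannot be quantified existentially, so a Hilbert space whose existence is asserted has to be
  exhibited as a concrete type. The state space of a regular vessel can always be taken to be this one:
  the closed subspace generated from the (separable) ranges of the \<open>B(x)\<close> by \<open>A\<close>, \<open>A*\<close> and the \<open>X(x)\<close> is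
  separable, and the direct sum with a vessel \<open>(0, 0, I)\<close> leaves the transfer function unchanged near
  infinity.\<close>

typedef ell2 = "{f :: nat \<Rightarrow> complex. summable (\<lambda>n. (cmod (f n))\<^sup>2)}"
  morphisms coord Abs_ell2
  by (rule exI [of _ "\<lambda>_. 0"]) simp

setup_lifting type_definition_ell2

lemma summable_cmod_sq_add:
  assumes "summable (\<lambda>n. (cmod (f n))\<^sup>2)" "summable (\<lambda>n. (cmod (g n))\<^sup>2)"
  shows "summable (\<lambda>n. (cmod (f n + g n))\<^sup>2)"
proof (rule summable_comparison_test')
  show "summable (\<lambda>n. 2 * (cmod (f n))\<^sup>2 + 2 * (cmod (g n))\<^sup>2)"
    using assms by (intro summable_add summable_mult)
  fix n :: nat
  have "(cmod (f n + g n))\<^sup>2 \<le> (cmod (f n) + cmod (g n))\<^sup>2"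
    by (intro power_mono norm_triangle_ineq norm_ge_zero)
  also have "\<dots> \<le> 2 * (cmod (f n))\<^sup>2 + 2 * (cmod (g n))\<^sup>2"
    using sum_squares_bound [of "cmod (f n)" "cmod (g n)"] by (simp add: power2_sum)
  finally show "norm ((cmod (f n + g n))\<^sup>2) \<le> 2 * (cmod (f n))\<^sup>2 + 2 * (cmod (g n))\<^sup>2"
    by simp
qed

lemma summable_cmod_sq_scale:
  assumes "summable (\<lambda>n. (cmod (f n))\<^sup>2)"
  shows "summable (\<lambda>n. (cmod (c * f n))\<^sup>2)"
  using assms by (simp add: norm_mult power_mult_distrib summable_mult)

lemma summable_mult_cnj:
  assumes "summable (\<lambda>n. (cmod (f n))\<^sup>2)" "summable (\<lambda>n. (cmod (g n))\<^sup>2)"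
  shows "summable (\<lambda>n. f n * cnj (g n))"
proof (rule summable_comparison_test')
  show "summable (\<lambda>n. (cmod (f n))\<^sup>2 + (cmod (g n))\<^sup>2)"
    using assms by (intro summable_add)
  fix n :: nat
  have "2 * cmod (f n) * cmod (g n) \<le> (cmod (f n))\<^sup>2 + (cmod (g n))\<^sup>2"
    by (rule sum_squares_bound)
  moreover have "0 \<le> cmod (f n) * cmod (g n)"
    by simp
  ultimately show "norm (f n * cnj (g n)) \<le> (cmod (f n))\<^sup>2 + (cmod (g n))\<^sup>2"
    unfolding norm_mult complex_mod_cnj by linarith
qed

lift_definition scale_ell2 :: "complex \<Rightarrow> ell2 \<Rightarrow> ell2" is "\<lambda>c f n. c * f n"
  by (rule summable_cmod_sq_scale)

lift_definition ip_ell2 :: "ell2 \<Rightarrow> ell2 \<Rightarrow> complex" is "\<lambda>f g. \<Sum>n. f n * cnj (g n)" .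

lemma summable_coord: "summable (\<lambda>n. (cmod (coord x n))\<^sup>2)"
  using coord [of x] by simp

lemma summable_coord_cinner: "summable (\<lambda>n. coord x n * cnj (coord y n))"
  by (intro summable_mult_cnj summable_coord)

lemma ip_ell2_scale_left: "ip_ell2 (scale_ell2 c x) y = c * ip_ell2 x y" for x y :: ell2
  by (simp add: ip_ell2.rep_eq scale_ell2.rep_eq mult.assoc suminf_mult summable_coord_cinner)

lemma ip_ell2_commute: "ip_ell2 x y = cnj (ip_ell2 y x)" for x y :: ell2
proof -
  have "(\<lambda>n. cnj (coord y n * cnj (coord x n))) sums cnj (\<Sum>n. coord y n * cnj (coord x n))"
    by (subst sums_cnj) (rule summable_sums [OF summable_coord_cinner])
  then show ?thesis
    by (simp add: ip_ell2.rep_eq sums_iff mult.commute)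
qed

instantiation ell2 :: real_inner
begin

lift_definition zero_ell2 :: ell2 is "\<lambda>_. 0" by simp

lift_definition plus_ell2 :: "ell2 \<Rightarrow> ell2 \<Rightarrow> ell2" is "\<lambda>f g n. f n + g n"
  by (rule summable_cmod_sq_add)

lift_definition uminus_ell2 :: "ell2 \<Rightarrow> ell2" is "\<lambda>f n. - f n" by simp

lift_definition minus_ell2 :: "ell2 \<Rightarrow> ell2 \<Rightarrow> ell2" is "\<lambda>f g n. f n - g n"
  using summable_cmod_sq_add [of _ "\<lambda>n. - _ n"] by simp

lift_definition scaleR_ell2 :: "real \<Rightarrow> ell2 \<Rightarrow> ell2" is "\<lambda>r f n. complex_of_real r * f n"
  by (rule summable_cmod_sq_scale)

definition inner_ell2 :: "ell2 \<Rightarrow> ell2 \<Rightarrow> real"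
  where "inner_ell2 x y = Re (ip_ell2 x y)"

definition norm_ell2 :: "ell2 \<Rightarrow> real"
  where "norm_ell2 x = sqrt (inner x x)"

definition sgn_ell2 :: "ell2 \<Rightarrow> ell2"
  where "sgn_ell2 x = inverse (norm x) *\<^sub>R x"

definition dist_ell2 :: "ell2 \<Rightarrow> ell2 \<Rightarrow> real"
  where "dist_ell2 x y = norm (x - y)"

definition uniformity_ell2 :: "(ell2 \<times> ell2) filter"
  where "uniformity_ell2 = (INF e\<in>{0 <..}. principal {(x, y). dist x y < e})"

definition open_ell2 :: "ell2 set \<Rightarrow> bool"
  where "open_ell2 U \<longleftrightarrow> (\<forall>x\<in>U. eventually (\<lambda>(x', y). x' = x \<longrightarrow> y \<in> U) uniformity)"

lemma ip_ell2_add_left: "ip_ell2 (x + y) z = ip_ell2 x z + ip_ell2 y z" for x y z :: ell2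
  by (simp add: ip_ell2.rep_eq plus_ell2.rep_eq distrib_right suminf_add summable_coord_cinner)

lemma inner_ell2_self: "inner x x = (\<Sum>n. (cmod (coord x n))\<^sup>2)" for x :: ell2
proof -
  have "inner x x = Re (\<Sum>n. complex_of_real ((cmod (coord x n))\<^sup>2))"
    by (simp only: inner_ell2_def ip_ell2.rep_eq complex_norm_square)
  also have "\<dots> = (\<Sum>n. (cmod (coord x n))\<^sup>2)"
    using suminf_of_real [OF summable_coord [of x], where 'a = complex] by (metis Re_complex_of_real)
  finally show ?thesis .
qed

lemma norm_ell2_sq: "(norm x)\<^sup>2 = (\<Sum>n. (cmod (coord x n))\<^sup>2)" for x :: ell2
  by (simp add: norm_ell2_def inner_ell2_self suminf_nonneg summable_coord)

lemma sum_coord_le: "(\<Sum>k<N. (cmod (coord x k))\<^sup>2) \<le> (norm x)\<^sup>2" for x :: ell2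
  by (simp add: norm_ell2_sq sum_le_suminf summable_coord)

lemma cmod_coord_le: "cmod (coord x k) \<le> norm x" for x :: ell2
proof (rule power2_le_imp_le)
  have "(cmod (coord x k))\<^sup>2 \<le> (\<Sum>j<Suc k. (cmod (coord x j))\<^sup>2)"
    by (rule member_le_sum) auto
  also have "\<dots> \<le> (norm x)\<^sup>2" by (rule sum_coord_le)
  finally show "(cmod (coord x k))\<^sup>2 \<le> (norm x)\<^sup>2" .
  show "0 \<le> norm x"
    by (simp add: norm_ell2_def inner_ell2_self suminf_nonneg summable_coord)
qed

instance
proof
  fix x y z :: ell2 and r s :: real
  show "x + y + z = x + (y + z)" "x + y = y + x" "0 + x = x" "- x + x = 0" "x - y = x + - y"
    "r *\<^sub>R (x + y) = r *\<^sub>R x + r *\<^sub>R y" "(r + s) *\<^sub>R x = r *\<^sub>R x + s *\<^sub>R x"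
    "r *\<^sub>R s *\<^sub>R x = (r * s) *\<^sub>R x" "1 *\<^sub>R x = x"
    by (transfer; simp add: algebra_simps)+
  show "dist x y = norm (x - y)" "sgn x = inverse (norm x) *\<^sub>R x" "norm x = sqrt (inner x x)"
    by (simp_all add: dist_ell2_def sgn_ell2_def norm_ell2_def)
  show "uniformity = (INF e\<in>{0 <..}. principal {(x, y :: ell2). dist x y < e})"
    by (rule uniformity_ell2_def)
  show "open U \<longleftrightarrow> (\<forall>x\<in>U. eventually (\<lambda>(x', y). x' = x \<longrightarrow> y \<in> U) uniformity)" for U :: "ell2 set"
    by (rule open_ell2_def)
  show "inner x y = inner y x"
    unfolding inner_ell2_def by (subst ip_ell2_commute) simp
  show "inner (x + y) z = inner x z + inner y z"
    by (simp add: inner_ell2_def ip_ell2_add_left)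
  have "r *\<^sub>R x = scale_ell2 (complex_of_real r) x"
    by transfer simp
  then show "inner (r *\<^sub>R x) y = r * inner x y"
    by (simp add: inner_ell2_def ip_ell2_scale_left)
  show "0 \<le> inner x x"
    by (simp add: inner_ell2_self suminf_nonneg summable_coord)
  show "inner x x = 0 \<longleftrightarrow> x = 0"
    by (simp add: inner_ell2_self suminf_eq_zero_iff summable_coord)
      (auto simp: coord_inject [symmetric] zero_ell2.rep_eq)
qed

end

lemma ell2_limit:
  fixes X :: "nat \<Rightarrow> ell2"
  assumes "Cauchy X"
  shows "\<exists>L. X \<longlonglongrightarrow> L"
proof -
  have "Cauchy (\<lambda>n. coord (X n) k)" for k
  proof (rule metric_CauchyI)
    fix e :: real assume "0 < e"
    then obtain M where M: "\<And>m n. M \<le> m \<Longrightarrow> M \<le> n \<Longrightarrow> dist (X m) (X n) < e"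
      using metric_CauchyD [OF assms] by meson
    have "dist (coord (X m) k) (coord (X n) k) < e" if "M \<le> m" "M \<le> n" for m n
      using cmod_coord_le [of "X m - X n" k] M [OF that]
      by (simp add: dist_norm minus_ell2.rep_eq)
    then show "\<exists>M. \<forall>m\<ge>M. \<forall>n\<ge>M. dist (coord (X m) k) (coord (X n) k) < e"
      by blast
  qed
  then have "\<exists>l. (\<lambda>n. coord (X n) k) \<longlonglongrightarrow> l" for k
    by (simp add: Cauchy_convergent_iff convergent_def)
  then obtain l where l: "\<And>k. (\<lambda>n. coord (X n) k) \<longlonglongrightarrow> l k"
    by metis
  have tail: "\<exists>M. \<forall>m\<ge>M. \<forall>N. (\<Sum>k<N. (cmod (coord (X m) k - l k))\<^sup>2) \<le> e\<^sup>2" if "0 < e" for e :: real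
  proof -
    obtain M where M: "\<And>m n. M \<le> m \<Longrightarrow> M \<le> n \<Longrightarrow> dist (X m) (X n) < e"
      using metric_CauchyD [OF assms \<open>0 < e\<close>] by meson
    have "(\<Sum>k<N. (cmod (coord (X m) k - l k))\<^sup>2) \<le> e\<^sup>2" if "M \<le> m" for m N
    proof (rule LIMSEQ_le_const2)
      show "(\<lambda>n. \<Sum>k<N. (cmod (coord (X m) k - coord (X n) k))\<^sup>2)
          \<longlonglongrightarrow> (\<Sum>k<N. (cmod (coord (X m) k - l k))\<^sup>2)"
        by (intro tendsto_intros l)
      have "(\<Sum>k<N. (cmod (coord (X m) k - coord (X n) k))\<^sup>2) \<le> e\<^sup>2" if "M \<le> n" for n
      proof -
        have "(\<Sum>k<N. (cmod (coord (X m) k - coord (X n) k))\<^sup>2) \<le> (norm (X m - X n))\<^sup>2"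
          using sum_coord_le [where x = "X m - X n"] by (simp add: minus_ell2.rep_eq)
        also have "\<dots> \<le> e\<^sup>2"
          using M [OF \<open>M \<le> m\<close> \<open>M \<le> n\<close>] by (intro power_mono) (auto simp: dist_norm)
        finally show ?thesis .
      qed
      then show "\<exists>M. \<forall>n\<ge>M. (\<Sum>k<N. (cmod (coord (X m) k - coord (X n) k))\<^sup>2) \<le> e\<^sup>2"
        by blast
    qed
    then show ?thesis by blast
  qed
  have summ: "summable (\<lambda>k. (cmod (coord (X m) k - l k))\<^sup>2)"
    if "\<forall>N. (\<Sum>k<N. (cmod (coord (X m) k - l k))\<^sup>2) \<le> C" for m C
    using that by (intro summableI_nonneg_bounded [where x = C]) auto
  obtain M where "\<forall>N. (\<Sum>k<N. (cmod (coord (X M) k - l k))\<^sup>2) \<le> 1\<^sup>2"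
    using tail [of 1] by auto
  from summable_cmod_sq_add [OF summ [OF this] summable_cmod_sq_scale [OF summable_coord [of "X M"], of "-1"]]
  have "summable (\<lambda>k. (cmod (l k))\<^sup>2)"
    by (simp add: norm_minus_commute)
  then have coord_l: "coord (Abs_ell2 l) = l"
    by (simp add: Abs_ell2_inverse)
  have "X \<longlonglongrightarrow> Abs_ell2 l"
  proof (rule metric_LIMSEQ_I)
    fix e :: real assume "0 < e"
    then obtain M where M: "\<forall>m\<ge>M. \<forall>N. (\<Sum>k<N. (cmod (coord (X m) k - l k))\<^sup>2) \<le> (e/2)\<^sup>2"
      using tail [of "e/2"] by auto
    have "dist (X m) (Abs_ell2 l) < e" if "M \<le> m" for m
    proof -
      have "(norm (X m - Abs_ell2 l))\<^sup>2 = (\<Sum>k. (cmod (coord (X m) k - l k))\<^sup>2)"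
        by (simp add: norm_ell2_sq minus_ell2.rep_eq coord_l)
      also have "\<dots> \<le> (e/2)\<^sup>2"
        using M that by (intro suminf_le_const summ) auto
      finally have "norm (X m - Abs_ell2 l) \<le> e/2"
        by (rule power2_le_imp_le) (use \<open>0 < e\<close> in simp)
      then show ?thesis using \<open>0 < e\<close> by (simp add: dist_norm)
    qed
    then show "\<exists>M. \<forall>m\<ge>M. dist (X m) (Abs_ell2 l) < e" by blast
  qed
  then show ?thesis ..
qed

instance ell2 :: banach
proof
  show "convergent X" if "Cauchy X" for X :: "nat \<Rightarrow> ell2"
    using ell2_limit [OF that] by (simp add: convergent_def)
qed

instantiation ell2 :: complex_hilbert
begin

definition scaleC_ell2 :: "complex \<Rightarrow> ell2 \<Rightarrow> ell2"
  where "scaleC_ell2 = scale_ell2"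

definition cinner_ell2 :: "ell2 \<Rightarrow> ell2 \<Rightarrow> complex"
  where "cinner_ell2 = ip_ell2"

instance
proof
  fix x y z :: ell2 and c d :: complex and r :: real
  show "c *\<^sub>C (x + y) = c *\<^sub>C x + c *\<^sub>C y" "(c + d) *\<^sub>C x = c *\<^sub>C x + d *\<^sub>C x"
    "c *\<^sub>C d *\<^sub>C x = (c * d) *\<^sub>C x" "complex_of_real r *\<^sub>C x = r *\<^sub>R x"
    unfolding scaleC_ell2_def by (transfer; simp add: algebra_simps)+
  show "cinner x y = cnj (cinner y x)" "cinner (x + y) z = cinner x z + cinner y z"
    "cinner (c *\<^sub>C x) y = c * cinner x y" "inner x y = Re (cinner x y)"
    unfolding scaleC_ell2_def cinner_ell2_def
    by (fact ip_ell2_commute ip_ell2_add_left ip_ell2_scale_left inner_ell2_def)+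
qed

end


section \<open>Bounded operators\<close>

text \<open>The library's type of bounded operators is real-linear; \<open>complex_linear\<close> selects the operators
  between complex Hilbert spaces.\<close>

definition complex_linear :: "'a::complex_hilbert \<Rightarrow>\<^sub>L 'b::complex_hilbert \<Rightarrow> bool"
  where "complex_linear T \<longleftrightarrow> (\<forall>c u. T (c *\<^sub>C u) = c *\<^sub>C T u)"

definition adj :: "'a::complex_hilbert \<Rightarrow>\<^sub>L 'b::complex_hilbert \<Rightarrow> 'b \<Rightarrow>\<^sub>L 'a"
  where "adj T = (THE T' :: 'b \<Rightarrow>\<^sub>L 'a. \<forall>u v. cinner (T u) v = cinner u (T' v))"

definition self_adjoint :: "'a::complex_hilbert \<Rightarrow>\<^sub>L 'a \<Rightarrow> bool"
  where "self_adjoint T \<longleftrightarrow> adj T = T"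

definition op_invertible :: "'a::complex_hilbert \<Rightarrow>\<^sub>L 'a \<Rightarrow> bool"
  where "op_invertible T \<longleftrightarrow> (\<exists>T'. T' o\<^sub>L T = id_blinfun \<and> T o\<^sub>L T' = id_blinfun)"

definition op_inverse :: "'a::complex_hilbert \<Rightarrow>\<^sub>L 'a \<Rightarrow> 'a \<Rightarrow>\<^sub>L 'a"
  where "op_inverse T = (THE T'. T' o\<^sub>L T = id_blinfun \<and> T o\<^sub>L T' = id_blinfun)"

text \<open>\<open>scalar_op c\<close> is the operator \<open>c I\<close>.\<close>

definition scalar_op :: "complex \<Rightarrow> 'a::complex_hilbert \<Rightarrow>\<^sub>L 'a"
  where "scalar_op c = Blinfun (\<lambda>u. c *\<^sub>C u)"

definition resolvent_set :: "'a::complex_hilbert \<Rightarrow>\<^sub>L 'a \<Rightarrow> complex set"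
  where "resolvent_set A = {l. op_invertible (scalar_op l - A)}"


section \<open>Differential equations with integrable coefficients\<close>

definition absolutely_continuous_on :: "real set \<Rightarrow> (real \<Rightarrow> 'a::metric_space) \<Rightarrow> bool"
  where "absolutely_continuous_on I F \<longleftrightarrow>
    (\<forall>e>0. \<exists>d>0. \<forall>(n::nat) s t.
      (\<forall>i<n. s i \<in> I \<and> t i \<in> I \<and> s i \<le> t i) \<longrightarrow>
      (\<forall>i<n. \<forall>j<n. i \<noteq> j \<longrightarrow> {s i<..<t i} \<inter> {s j<..<t j} = {}) \<longrightarrow>
      (\<Sum>i<n. t i - s i) < d \<longrightarrow> (\<Sum>i<n. dist (F (s i)) (F (t i))) < e)"

text \<open>As the coefficients are only locally integrable, differential equations are understood in the
  sense of Caratheodory: \<open>d/dx F = f\<close> means that \<open>F\<close> is absolutely continuous and has derivative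
  \<open>f x\<close> at almost every \<open>x\<close>. For operator-valued functions the norm is the operator norm.\<close>

definition has_ae_derivative_on ::
    "(real \<Rightarrow> 'a::real_normed_vector) \<Rightarrow> (real \<Rightarrow> 'a) \<Rightarrow> real set \<Rightarrow> bool"
  where "has_ae_derivative_on F f I \<longleftrightarrow> absolutely_continuous_on I F \<and>
    (AE x in lebesgue. x \<in> I \<longrightarrow> (F has_vector_derivative f x) (at x within I))"


section \<open>Vessel parameters\<close>

text \<open>On the compact interval \<open>{a..b}\<close> locally integrable means integrable. As the space \<open>'e\<close> is
  finite dimensional, an operator-valued function is integrable iff its value at each vector is.\<close>

definition locally_integrable_on ::
    "(real \<Rightarrow> ('e::{complex_hilbert, euclidean_space}) \<Rightarrow>\<^sub>L 'e) \<Rightarrow> real \<Rightarrow> real \<Rightarrow> bool"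
  where "locally_integrable_on F a b \<longleftrightarrow> (\<forall>u. (\<lambda>x. F x u) absolutely_integrable_on {a..b})"

definition vessel_parameters ::
    "(real \<Rightarrow> ('e::{complex_hilbert, euclidean_space}) \<Rightarrow>\<^sub>L 'e) \<Rightarrow> (real \<Rightarrow> 'e \<Rightarrow>\<^sub>L 'e) \<Rightarrow>
     (real \<Rightarrow> 'e \<Rightarrow>\<^sub>L 'e) \<Rightarrow> (real \<Rightarrow> 'e \<Rightarrow>\<^sub>L 'e) \<Rightarrow> real \<Rightarrow> real \<Rightarrow> bool"
  where "vessel_parameters \<sigma>1 \<sigma>2 \<gamma> \<gamma>s a b \<longleftrightarrow>
    a < b \<and>
    (\<forall>F\<in>{\<sigma>1, \<sigma>2, \<gamma>, \<gamma>s}. locally_integrable_on F a b \<and> (\<forall>x\<in>{a..b}. complex_linear (F x))) \<and>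
    (\<forall>x\<in>{a..b}. op_invertible (\<sigma>1 x) \<and> self_adjoint (\<sigma>1 x) \<and> self_adjoint (\<sigma>2 x) \<and>
      (\<sigma>1 has_vector_derivative - (\<gamma> x + adj (\<gamma> x))) (at x within {a..b}) \<and>
      \<gamma>s x + adj (\<gamma>s x) = \<gamma> x + adj (\<gamma> x))"


section \<open>Regular vessels and their transfer functions\<close>

text \<open>In a regular vessel \<open>A\<close> is bounded with \<open>D(A) = H\<close>, so the domain condition
  \<open>B(x0) E \<subseteq> D(A^n)\<close> holds automatically. The coefficients are determined only up to null sets by the
  differential equations, so the relation between \<open>\<gamma>\<close> and \<open>\<gamma>s\<close> is required almost everywhere.\<close>

definition regular_vessel ::
    "('h::complex_hilbert \<Rightarrow>\<^sub>L 'h) \<Rightarrow> (real \<Rightarrow> 'e \<Rightarrow>\<^sub>L 'h) \<Rightarrow> (real \<Rightarrow> 'h \<Rightarrow>\<^sub>L 'h) \<Rightarrow>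
     (real \<Rightarrow> ('e::{complex_hilbert, euclidean_space}) \<Rightarrow>\<^sub>L 'e) \<Rightarrow> (real \<Rightarrow> 'e \<Rightarrow>\<^sub>L 'e) \<Rightarrow>
     (real \<Rightarrow> 'e \<Rightarrow>\<^sub>L 'e) \<Rightarrow> (real \<Rightarrow> 'e \<Rightarrow>\<^sub>L 'e) \<Rightarrow> real \<Rightarrow> real \<Rightarrow> bool"
  where "regular_vessel A B X \<sigma>1 \<sigma>2 \<gamma> \<gamma>s a b \<longleftrightarrow>
    vessel_parameters \<sigma>1 \<sigma>2 \<gamma> \<gamma>s a b \<and>
    complex_linear A \<and>
    (\<forall>x\<in>{a..b}. complex_linear (B x) \<and> complex_linear (X x)) \<and>
    (\<exists>x0\<in>{a..b}. \<exists>C>0. \<forall>n\<ge>1. norm (((\<lambda>T. A o\<^sub>L T) ^^ n) (B x0)) \<le> (C * sqrt (real n)) ^ n) \<and>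
    (\<forall>x\<in>{a..b}. self_adjoint (X x) \<and> op_invertible (X x)) \<and>
    has_ae_derivative_on (\<lambda>x. B x o\<^sub>L \<sigma>1 x) (\<lambda>x. - ((A o\<^sub>L B x o\<^sub>L \<sigma>2 x) + (B x o\<^sub>L \<gamma> x))) {a..b} \<and>
    (\<forall>x\<in>{a..b}. (A o\<^sub>L X x) + (X x o\<^sub>L adj A) + (B x o\<^sub>L \<sigma>1 x o\<^sub>L adj (B x)) = 0) \<and>
    has_ae_derivative_on X (\<lambda>x. B x o\<^sub>L \<sigma>2 x o\<^sub>L adj (B x)) {a..b} \<and>
    (AE x in lebesgue. x \<in> {a..b} \<longrightarrow>
      \<gamma>s x = \<gamma> x + (\<sigma>2 x o\<^sub>L adj (B x) o\<^sub>L op_inverse (X x) o\<^sub>L B x o\<^sub>L \<sigma>1 x)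
                - (\<sigma>1 x o\<^sub>L adj (B x) o\<^sub>L op_inverse (X x) o\<^sub>L B x o\<^sub>L \<sigma>2 x))"

definition transfer_function ::
    "('h::complex_hilbert \<Rightarrow>\<^sub>L 'h) \<Rightarrow> (real \<Rightarrow> 'e::complex_hilbert \<Rightarrow>\<^sub>L 'h) \<Rightarrow> (real \<Rightarrow> 'h \<Rightarrow>\<^sub>L 'h) \<Rightarrow>
     (real \<Rightarrow> 'e \<Rightarrow>\<^sub>L 'e) \<Rightarrow> complex \<Rightarrow> real \<Rightarrow> 'e \<Rightarrow>\<^sub>L 'e"
  where "transfer_function A B X \<sigma>1 l x =
    id_blinfun - (adj (B x) o\<^sub>L op_inverse (X x) o\<^sub>L op_inverse (scalar_op l - A) o\<^sub>L B x o\<^sub>L \<sigma>1 x)"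


section \<open>The class of functions to be realized\<close>

text \<open>\<open>u\<close> solves \<open>- \<sigma>1(x) u'(x) + (\<sigma>2(x) l + \<gamma>(x)) u(x) = 0\<close>.\<close>

definition solves_lde ::
    "(real \<Rightarrow> ('e::{complex_hilbert, euclidean_space}) \<Rightarrow>\<^sub>L 'e) \<Rightarrow> (real \<Rightarrow> 'e \<Rightarrow>\<^sub>L 'e) \<Rightarrow>
     (real \<Rightarrow> 'e \<Rightarrow>\<^sub>L 'e) \<Rightarrow> complex \<Rightarrow> real \<Rightarrow> real \<Rightarrow> (real \<Rightarrow> 'e) \<Rightarrow> bool"
  where "solves_lde \<sigma>1 \<sigma>2 \<gamma> l a b u \<longleftrightarrow>
    (\<exists>u'. has_ae_derivative_on u u' {a..b} \<and>
      (AE x in lebesgue. x \<in> {a..b} \<longrightarrow>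
        - \<sigma>1 x (u' x) + (\<sigma>2 x (l *\<^sub>C u x) + \<gamma> x (u x)) = 0))"

text \<open>\<open>\<Omega>\<close> is the domain of analyticity of \<open>S\<close>, a common neighbourhood of infinity for all \<open>x\<close>; the
  values \<open>S l x\<close> for \<open>l \<notin> \<Omega>\<close> are irrelevant. As \<open>'e\<close> is finite dimensional, analyticity can be
  tested on the functions \<open>\<langle>S l x u, v\<rangle>\<close>. Differentiability in \<open>x\<close> is meant in the same sense as in the
  differential equations; given the last condition, it is implied by differentiability at every \<open>x\<close>.\<close>

definition class_Ir ::
    "(real \<Rightarrow> ('e::{complex_hilbert, euclidean_space}) \<Rightarrow>\<^sub>L 'e) \<Rightarrow> (real \<Rightarrow> 'e \<Rightarrow>\<^sub>L 'e) \<Rightarrow>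
     (real \<Rightarrow> 'e \<Rightarrow>\<^sub>L 'e) \<Rightarrow> (real \<Rightarrow> 'e \<Rightarrow>\<^sub>L 'e) \<Rightarrow> real \<Rightarrow> real \<Rightarrow>
     complex set \<Rightarrow> (complex \<Rightarrow> real \<Rightarrow> 'e \<Rightarrow>\<^sub>L 'e) \<Rightarrow> bool"
  where "class_Ir \<sigma>1 \<sigma>2 \<gamma> \<gamma>s a b \<Omega> S \<longleftrightarrow>
    open \<Omega> \<and> (\<exists>R. {l. R < norm l} \<subseteq> \<Omega>) \<and>
    (\<forall>l\<in>\<Omega>. \<forall>x\<in>{a..b}. complex_linear (S l x)) \<and>
    (\<forall>x\<in>{a..b}. (\<forall>u v. (\<lambda>l. cinner (S l x u) v) holomorphic_on \<Omega>) \<and>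
      ((\<lambda>l. S l x) \<longlongrightarrow> id_blinfun) at_infinity) \<and>
    (\<forall>l\<in>\<Omega>. \<exists>S'. has_ae_derivative_on (S l) S' {a..b}) \<and>
    (\<forall>l\<in>\<Omega>. - cnj l \<in> \<Omega> \<longrightarrow>
      (\<forall>x\<in>{a..b}. adj (S (- cnj l) x) o\<^sub>L \<sigma>1 x o\<^sub>L S l x = \<sigma>1 x)) \<and>
    (\<forall>l\<in>\<Omega>. \<forall>u. solves_lde \<sigma>1 \<sigma>2 \<gamma> l a b u \<longrightarrow>
      solves_lde \<sigma>1 \<sigma>2 \<gamma>s l a b (\<lambda>x. S l x (u x)))"

end

theory Submission
  imports Defs
begin

text \<open>
  A function that is analytic at infinity and symmetric with respect to \<open>J = \<sigma>1(x0)\<close> is realized by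
  passing to its Cayley transform \<open>N = 2 (I + S)\<^sup>-\<^sup>1 - I\<close>: the symmetry says that \<open>F = N J\<^sup>-\<^sup>1\<close> satisfies
  \<open>F(\<lambda>) = - F(- cnj \<lambda>)*\<close>, so \<open>F(\<lambda>) = G(\<lambda>) - G(- cnj \<lambda>)*\<close> for \<open>G = F / 2\<close>, and an arbitrary
  realization \<open>(T, C, D)\<close> of \<open>G\<close> (a weighted shift on the Taylor coefficients) yields a lossless one with
  state operator \<open>T \<oplus> (- T*)\<close> and the indefinite metric that exchanges the two summands. Undoing the
  Cayley transform is a state feedback. A further summand of the same shape, with \<open>T\<close> a large multiple
  of the unilateral shift, fills a disc with spectrum, so that nothing has to be known about \<open>S\<close> on
  other components of its domain of analyticity.

  From this realization at \<open>x0 = a\<close> the vessel equations are solved as linear differential equations,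
  and the metric \<open>X\<close> stays invertible on a small interval. Let \<open>D = S - S\<^sub>V\<close> be the difference to the
  transfer function of the vessel. Comparing the leading terms at \<open>\<lambda> = \<infinity>\<close> in the differential
  equations of both functions expresses \<open>\<gamma>s - \<gamma>s\<^sub>V\<close> through the residue \<open>lim \<lambda> D(\<lambda>, x)\<close>, which by the
  maximum principle is bounded by the values of \<open>D\<close> on a circle. Hence \<open>D\<close> satisfies on this circle a
  homogeneous linear integral inequality and vanishes, and so does the residue.
\<close>

section \<open>Integrable functions with values in Banach spaces\<close>

text \<open>The condition on \<open>S\<close> is quadratic; the Cayley transform makes it additive,
  and an additive symmetry can be split between an arbitrary realization and its adjoint. The price
  is the indefinite metric: \<open>X\<close> is invertible but not positive, and its invertibility
  is secured only near \<open>a\<close>. The obstacle is that \<open>\<gamma>s\<close> is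
  prescribed. The constructed vessel has an output coefficient of its own, so its transfer function
  and \<open>S\<close> a priori solve different equations. Uniqueness at a fixed \<lambda> cannot
  close this gap: the residue that expresses the difference of the coefficients depends on all
  \<lambda> at once, and the factor \<lambda> in the equations is unbounded near infinity. On a
  circle this factor is bounded, and the circle already controls the residue; the inequality is
  therefore run for the whole circle simultaneously. The differential equations hold almost
  everywhere, with exceptional sets that may depend on \<lambda>; limits in \<lambda> are therefore
  taken in integrated form.\<close>

lemma integrable_weighted_limit:
  fixes f :: "real \<Rightarrow> 'b::banach" and k :: "real \<Rightarrow> real"
  assumes k: "k integrable_on {a..b}" 
    and approx: "\<And>e. e > 0 \<Longrightarrow> \<exists>g. (\<forall>x\<in>{a..b}. norm (f x - g x) \<le> e * k x) \<and> g integrable_on {a..b}"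
  shows "f integrable_on {a..b}"
proof -
  define I where "I = integral {a..b} k"
  have I: "(k has_integral I) (cbox a b)"
    using k by (simp add: I_def integrable_integral)
  have "\<exists>\<gamma>. gauge \<gamma> \<and> (\<forall>\<D>1 \<D>2. \<D>1 tagged_division_of (cbox a b) \<and> \<gamma> fine \<D>1 \<and>
            \<D>2 tagged_division_of (cbox a b) \<and> \<gamma> fine \<D>2 \<longrightarrow>
            norm ((\<Sum>(x,K)\<in>\<D>1. measure lborel K *\<^sub>R f x) - (\<Sum>(x,K)\<in>\<D>2. measure lborel K *\<^sub>R f x)) < e)"
    if "e > 0" for e
  proof -
    \<comment> \<open>The errors are e/4, e/4 and e/2. \<open>\<gamma>1\<close> keeps the Riemann
      sums of the weight within 1 of \<open>I\<close>, so replacing \<open>f\<close> by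
      \<open>g\<close> costs at most \<epsilon> (|I| + 1) = e/4 on every fine division, and the
      Cauchy criterion passes from \<open>g\<close> to \<open>f\<close>.\<close>
    define \<epsilon> where "\<epsilon> = e / (4 * (\<bar>I\<bar> + 1))"
    have "\<epsilon> > 0" using that by (simp add: \<epsilon>_def add_pos_nonneg)
    then obtain g where g: "\<forall>x\<in>{a..b}. norm (f x - g x) \<le> \<epsilon> * k x" "g integrable_on cbox a b"
      using approx by (metis box_real(2))
    obtain \<gamma>1 where \<gamma>1: "gauge \<gamma>1" "\<And>\<D>. \<D> tagged_division_of cbox a b \<Longrightarrow> \<gamma>1 fine \<D> \<Longrightarrow>
        norm ((\<Sum>(x,K)\<in>\<D>. measure lborel K *\<^sub>R k x) - I) < 1"
      using I unfolding has_integral by (meson zero_less_one)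
    have "e/2 > 0" using that by simp
    then obtain \<gamma>2 where \<gamma>2: "gauge \<gamma>2 \<and> (\<forall>\<D>1 \<D>2. \<D>1 tagged_division_of (cbox a b) \<and> \<gamma>2 fine \<D>1 \<and>
            \<D>2 tagged_division_of (cbox a b) \<and> \<gamma>2 fine \<D>2 \<longrightarrow>
            norm ((\<Sum>(x,K)\<in>\<D>1. measure lborel K *\<^sub>R g x) - (\<Sum>(x,K)\<in>\<D>2. measure lborel K *\<^sub>R g x)) < e/2)"
      using g(2) [unfolded integrable_Cauchy, THEN spec, THEN mp] by (elim exE [rotated])
    have close: "norm ((\<Sum>(x,K)\<in>\<D>. measure lborel K *\<^sub>R f x) - (\<Sum>(x,K)\<in>\<D>. measure lborel K *\<^sub>R g x)) \<le> e/4"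
      if \<D>: "\<D> tagged_division_of cbox a b" "\<gamma>1 fine \<D>" for \<D>
    proof -
      have "norm ((\<Sum>(x,K)\<in>\<D>. measure lborel K *\<^sub>R f x) - (\<Sum>(x,K)\<in>\<D>. measure lborel K *\<^sub>R g x))
        = norm (\<Sum>(x,K)\<in>\<D>. measure lborel K *\<^sub>R (f x - g x))"
        by (simp add: sum_subtractf [symmetric] scaleR_diff_right split_def)
      also have "\<dots> \<le> (\<Sum>(x,K)\<in>\<D>. \<epsilon> * (measure lborel K *\<^sub>R k x))"
      proof (rule sum_norm_le, clarify)
        fix x K assume "(x, K) \<in> \<D>"
        then have "x \<in> {a..b}" using tag_in_interval [OF \<D>(1)] by simp
        then have "measure lborel K * norm (f x - g x) \<le> measure lborel K * (\<epsilon> * k x)"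
          using g(1) by (intro mult_left_mono) auto
        then show "norm (measure lborel K *\<^sub>R (f x - g x)) \<le> \<epsilon> * (measure lborel K *\<^sub>R k x)"
          by (simp add: mult_ac)
      qed
      also have "\<dots> = \<epsilon> * (\<Sum>(x,K)\<in>\<D>. measure lborel K *\<^sub>R k x)"
        by (simp add: sum_distrib_left split_def)
      also have "\<dots> \<le> \<epsilon> * (\<bar>I\<bar> + 1)"
        using \<gamma>1(2) [OF \<D>] \<open>\<epsilon> > 0\<close> by (intro mult_left_mono) (auto simp: abs_if split: if_splits)
      also have "\<dots> = e/4" by (simp add: \<epsilon>_def add_nonneg_eq_0_iff divide_simps)
      finally show ?thesis .
    qed
    show ?thesis
    proof (intro exI [of _ "\<lambda>x. \<gamma>1 x \<inter> \<gamma>2 x"] conjI allI impI gauge_Int \<gamma>1 conjunct1 [OF \<gamma>2])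
      fix \<D>1 \<D>2
      assume D: "\<D>1 tagged_division_of cbox a b \<and> (\<lambda>x. \<gamma>1 x \<inter> \<gamma>2 x) fine \<D>1 \<and>
            \<D>2 tagged_division_of (cbox a b) \<and> (\<lambda>x. \<gamma>1 x \<inter> \<gamma>2 x) fine \<D>2"
      have t: "norm (x - y) < e" if "norm (x - x') \<le> e/4" "norm (y - y') \<le> e/4" "norm (x' - y') < e/2" 
        for x y x' y' :: 'b
        using that by norm
      show "norm ((\<Sum>(x,K)\<in>\<D>1. measure lborel K *\<^sub>R f x) - (\<Sum>(x,K)\<in>\<D>2. measure lborel K *\<^sub>R f x)) < e"
        using D by (intro t [OF close close conjunct2 [OF \<gamma>2, rule_format]]) (auto simp: fine_Int)
    qed
  qed
  then show ?thesis
    using integrable_Cauchy [of f a b] by simp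
qed

text \<open>A step function uniformly \<epsilon>-close to \<open>Y\<close> is, after multiplication
  by \<open>k\<close>, within \<epsilon> |k| of \<open>k Y\<close>, and \<open>k\<close> times a
  step function is integrable; so the weighted limit applies with weight |k|.\<close>

lemma scaleR_continuous_integrable:
  fixes Y :: "real \<Rightarrow> 'b::banach" and k :: "real \<Rightarrow> real"
  assumes k: "k absolutely_integrable_on {a..b}" and Y: "continuous_on {a..b} Y"
  shows "(\<lambda>x. k x *\<^sub>R Y x) integrable_on {a..b}"
proof (cases "a \<le> b")
  case True
  show ?thesis
  proof (rule integrable_weighted_limit [where k = "\<lambda>x. \<bar>k x\<bar>"])
    show "(\<lambda>x. \<bar>k x\<bar>) integrable_on {a..b}"
      using k by (simp add: absolutely_integrable_on_def)
    have kint: "k integrable_on {u..v}" if "{u..v} \<subseteq> {a..b}" for u v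
      using that k integrable_on_subinterval set_lebesgue_integral_eq_integral(1) by blast
    fix e :: real assume "e > 0"
    \<comment> \<open>The step function is glued together by bisection. The trivial inequalities are
      the premise of the predicate at the whole interval; it confines the bisection to subintervals
      of \<open>{a..b}\<close>.\<close>
    have "a \<le> a \<and> b \<le> b \<longrightarrow> (\<exists>g. (\<forall>x\<in>{a..b}. norm (Y x - g x) \<le> e) \<and> (\<lambda>x. k x *\<^sub>R g x) integrable_on {a..b})"
      using \<open>a \<le> b\<close>
    proof (induct rule: Bolzano [where P = "\<lambda>u v. a \<le> u \<and> v \<le> b \<longrightarrow>
        (\<exists>g. (\<forall>x\<in>{u..v}. norm (Y x - g x) \<le> e) \<and> (\<lambda>x. k x *\<^sub>R g x) integrable_on {u..v})"])
      case (trans u v w)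
      show ?case
      proof
        assume "a \<le> u \<and> w \<le> b"
        then obtain g1 g2 where g1: "\<forall>x\<in>{u..v}. norm (Y x - g1 x) \<le> e" "(\<lambda>x. k x *\<^sub>R g1 x) integrable_on {u..v}"
          and g2: "\<forall>x\<in>{v..w}. norm (Y x - g2 x) \<le> e" "(\<lambda>x. k x *\<^sub>R g2 x) integrable_on {v..w}"
          using trans by auto
        let ?g = "\<lambda>x. if x \<le> v then g1 x else g2 x"
        have "(\<lambda>x. k x *\<^sub>R ?g x) integrable_on {u..v}"
          by (rule integrable_eq [OF g1(2)]) auto
        \<comment> \<open>At \<open>v\<close> the glued function takes the value of
          \<open>g1\<close>; this one point is the spike.\<close>
        moreover have "(\<lambda>x. k x *\<^sub>R ?g x) integrable_on {v..w}"
          by (rule integrable_spike_finite [OF _ _ g2(2), of "{v}"]) auto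
        ultimately have "(\<lambda>x. k x *\<^sub>R ?g x) integrable_on {u..w}"
          using trans Henstock_Kurzweil_Integration.integrable_combine by blast
        moreover have "\<forall>x\<in>{u..w}. norm (Y x - ?g x) \<le> e"
          using g1(1) g2(1) by auto
        ultimately show "\<exists>g. (\<forall>x\<in>{u..w}. norm (Y x - g x) \<le> e) \<and> (\<lambda>x. k x *\<^sub>R g x) integrable_on {u..w}"
          by (intro exI [of _ ?g] conjI)
      qed
    next
      case (local x)
      then obtain d where d: "d > 0" "\<And>y. y \<in> {a..b} \<Longrightarrow> dist y x < d \<Longrightarrow> dist (Y y) (Y x) < e"
        using Y \<open>e > 0\<close> unfolding continuous_on_iff by (metis atLeastAtMost_iff)
      show ?case
      proof (intro exI conjI allI impI)
        fix u v assume uv: "u \<le> x \<and> x \<le> v \<and> v - u < d" "a \<le> u \<and> v \<le> b"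
        show "(\<lambda>y. k y *\<^sub>R Y x) integrable_on {u..v}"
          using uv by (intro integrable_on_scaleR_left kint) auto
        show "\<forall>y\<in>{u..v}. norm (Y y - Y x) \<le> e"
        proof
          fix y assume "y \<in> {u..v}"
          then have "\<bar>y - x\<bar> < d" using uv unfolding abs_less_iff by auto
          then show "norm (Y y - Y x) \<le> e"
            using d(2) [of y] uv \<open>y \<in> {u..v}\<close> by (auto simp: dist_norm)
        qed
      qed (use d in auto)
    qed
    then obtain g where g: "\<forall>x\<in>{a..b}. norm (Y x - g x) \<le> e" "(\<lambda>x. k x *\<^sub>R g x) integrable_on {a..b}"
      by auto
    have "norm (k x *\<^sub>R Y x - k x *\<^sub>R g x) \<le> e * \<bar>k x\<bar>" if "x \<in> {a..b}" for x
    proof -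
      have "norm (k x *\<^sub>R (Y x - g x)) \<le> \<bar>k x\<bar> * e"
        unfolding norm_scaleR using g(1) that by (intro mult_left_mono) auto
      then show ?thesis by (simp add: scaleR_diff_right mult.commute)
    qed
    then show "\<exists>g. (\<forall>x\<in>{a..b}. norm (k x *\<^sub>R Y x - g x) \<le> e * \<bar>k x\<bar>) \<and> g integrable_on {a..b}"
      using g(2) by (intro exI [of _ "\<lambda>x. k x *\<^sub>R g x"]) auto
  qed
qed (simp add: integrable_on_empty)

text \<open>The Bochner integral of the library needs a separable target, which operator spaces over a Hilbert
  space are not. The functions that occur here are finite sums of scalar integrable functions times
  continuous ones; for them the Henstock-Kurzweil integral suffices.\<close>

inductive strong_L1 :: "real \<Rightarrow> real \<Rightarrow> (real \<Rightarrow> 'b::banach) \<Rightarrow> bool" for a b where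
  scaleR: "k absolutely_integrable_on {a..b} \<Longrightarrow> continuous_on {a..b} Y \<Longrightarrow> strong_L1 a b (\<lambda>x. k x *\<^sub>R Y x)"
| add: "strong_L1 a b f \<Longrightarrow> strong_L1 a b g \<Longrightarrow> strong_L1 a b (\<lambda>x. f x + g x)"
| cong: "strong_L1 a b f \<Longrightarrow> (\<And>x. x \<in> {a..b} \<Longrightarrow> f x = g x) \<Longrightarrow> strong_L1 a b g"

lemma strong_L1_continuous:
  assumes "continuous_on {a..b} f" shows "strong_L1 a b f"
proof -
  have "(\<lambda>_. 1::real) absolutely_integrable_on {a..b}"
    using absolutely_integrable_on_const [of "{a..b}" "1::real"] by simp
  from strong_L1.scaleR [OF this assms] show ?thesis by simp
qed

lemma strong_L1_sum:
  assumes "finite J" "\<And>j. j \<in> J \<Longrightarrow> strong_L1 a b (f j)"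
  shows "strong_L1 a b (\<lambda>x. \<Sum>j\<in>J. f j x)"
  using assms by (induction J) (auto intro: strong_L1_continuous strong_L1.add)

text \<open>The continuous factor is absorbed into the continuous part of each summand, so the class
  is stable under multiplication by continuous operator functions. This is what the Picard iteration
  needs.\<close>

lemma strong_L1_bilinear:
  assumes p: "bounded_bilinear p" and f: "strong_L1 a b f" and g: "continuous_on {a..b} g"
  shows "strong_L1 a b (\<lambda>x. p (f x) (g x))"
  using f
proof induction
  case (scaleR k Y)
  have "strong_L1 a b (\<lambda>x. k x *\<^sub>R p (Y x) (g x))"
    by (intro strong_L1.scaleR scaleR bounded_bilinear.continuous_on [OF p] g)
  then show ?case by (simp add: bounded_bilinear.scaleR_left [OF p])
next
  case (add f1 f2)
  then show ?case by (simp add: bounded_bilinear.add_left [OF p] strong_L1.add)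
next
  case (cong f1 f2)
  then show ?case by (metis (no_types, lifting) strong_L1.cong)
qed

lemma strong_L1_bilinear':
  assumes p: "bounded_bilinear p" and f: "strong_L1 a b f" and g: "continuous_on {a..b} g"
  shows "strong_L1 a b (\<lambda>x. p (g x) (f x))"
  using strong_L1_bilinear [OF bounded_bilinear.flip [OF p] f g] .

lemma strong_L1_linear:
  assumes h: "bounded_linear h" and f: "strong_L1 a b f"
  shows "strong_L1 a b (\<lambda>x. h (f x))"
  using f
proof induction
  case (scaleR k Y)
  have "strong_L1 a b (\<lambda>x. k x *\<^sub>R h (Y x))"
    by (intro strong_L1.scaleR scaleR bounded_linear.continuous_on [OF h])
  then show ?case by (simp add: linear_simps(5) [OF h])
next
  case (add f1 f2)
  then show ?case by (simp add: linear_simps(1) [OF h] strong_L1.add)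
next
  case (cong f1 f2)
  then show ?case by (metis (no_types, lifting) strong_L1.cong)
qed

lemma strong_L1_minus: "strong_L1 a b f \<Longrightarrow> strong_L1 a b (\<lambda>x. - f x)"
  by (rule strong_L1_linear [OF bounded_linear_minus [OF bounded_linear_ident]])

lemma strong_L1_integrable: "strong_L1 a b f \<Longrightarrow> f integrable_on {a..b}"
proof (induction rule: strong_L1.induct)
  case (cong f g) then show ?case by (metis integrable_eq)
qed (auto intro: scaleR_continuous_integrable integrable_add)

text \<open>A scalar integrable majorant, nonnegative on the whole line, is the form in which a
  coefficient enters Lipschitz bounds, dominated convergence and Gronwall arguments.\<close>

lemma strong_L1_bound:
  assumes "strong_L1 a b f"
  shows "\<exists>m::real\<Rightarrow>real. m absolutely_integrable_on {a..b} \<and> (\<forall>x. 0 \<le> m x) \<and> (\<forall>x\<in>{a..b}. norm (f x) \<le> m x)"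
  using assms
proof induction
  case (scaleR k Y)
  obtain M where M: "\<And>x. x \<in> {a..b} \<Longrightarrow> norm (Y x) \<le> M" "M \<ge> 0"
  proof -
    have "bounded (Y ` {a..b})"
      by (intro compact_imp_bounded compact_continuous_image scaleR) simp
    then obtain M where "\<forall>x\<in>{a..b}. norm (Y x) \<le> M" by (auto simp: bounded_iff)
    then show ?thesis by (intro that [of "max M 0"]) (auto simp: le_max_iff_disj)
  qed
  show ?case
  proof (intro exI conjI ballI allI)
    show "(\<lambda>x. M *\<^sub>R \<bar>k x\<bar>) absolutely_integrable_on {a..b}"
      using scaleR(1) by (intro absolutely_integrable_scaleR_left set_integrable_abs)
      fix x assume "x \<in> {a..b}"
    then have "\<bar>k x\<bar> * norm (Y x) \<le> \<bar>k x\<bar> * M" using M by (intro mult_left_mono) auto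
    then show "norm (k x *\<^sub>R Y x) \<le> M *\<^sub>R \<bar>k x\<bar>" by (simp add: mult.commute)
  qed (use M in auto)
next
  case (add f g)
  then obtain m1 m2 where m: "m1 absolutely_integrable_on {a..b}" "\<forall>x. 0 \<le> m1 x" "\<forall>x\<in>{a..b}. norm (f x) \<le> m1 x"
    "m2 absolutely_integrable_on {a..b}" "\<forall>x. 0 \<le> m2 x" "\<forall>x\<in>{a..b}. norm (g x) \<le> m2 x" by auto
  show ?case
  proof (intro exI conjI)
    show "(\<lambda>x. m1 x + m2 x) absolutely_integrable_on {a..b}"
      using m by (intro set_integral_add)
  qed (use m in \<open>auto intro!: norm_triangle_mono\<close>)
next
  case (cong f g)
  then show ?case by metis
qed

section \<open>Absolute continuity and almost everywhere differentiation of indefinite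
  integrals\<close>

lemma sum_integrals_le_integral:
  fixes h :: "real \<Rightarrow> real"
  assumes h: "h integrable_on {a..b}" "\<And>x. 0 \<le> h x"
    and st: "\<And>i. i < n \<Longrightarrow> s i \<in> {a..b} \<and> t i \<in> {a..b} \<and> s i \<le> t i"
    and disj: "\<And>i j. i < n \<Longrightarrow> j < n \<Longrightarrow> i \<noteq> j \<Longrightarrow> {s i<..<t i} \<inter> {s j<..<t j} = {}"
  shows "(\<Sum>i<n::nat. integral {s i..t i} h) \<le> integral {a..b} h"
proof -
  \<comment> \<open>Open intervals, because the given ones may share endpoints: at each point at
    most one of these truncations is nonzero.\<close>
  let ?h = "\<lambda>i x. if x \<in> {s i<..<t i} then h x else 0"
  have sub: "{s i<..<t i} \<inter> {a..b} = {s i<..<t i}" if "i < n" for i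
    using st [OF that] by auto
  have int: "h integrable_on {s i<..<t i}" "h integrable_on {s i..t i}" if "i < n" for i
    using h(1) st [OF that] integrable_on_open_interval_real integrable_on_subinterval
    by (metis atLeastAtMost_iff atLeastatMost_subset_iff)+
  have eq: "integral {s i..t i} h = integral {a..b} (?h i)" if "i < n" for i
    using sub [OF that] by (simp only: integral_restrict_Int integral_open_interval_real)
  have inth: "?h i integrable_on {a..b}" if "i < n" for i
    using int(1) [OF that] sub [OF that] integrable_restrict_Int [of "{s i<..<t i}" h "{a..b}"] by simp
  have "(\<Sum>i<n. integral {s i..t i} h) = integral {a..b} (\<lambda>x. \<Sum>i<n. ?h i x)"
    using inth by (subst integral_sum) (simp_all add: eq)
  also have "\<dots> \<le> integral {a..b} h"
  proof (rule integral_le)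
    show "(\<lambda>x. \<Sum>i<n. ?h i x) integrable_on {a..b}"
      using inth by (intro integrable_sum) auto
    fix x assume "x \<in> {a..b}"
    show "(\<Sum>i<n. ?h i x) \<le> h x"
    proof (cases "\<exists>i<n. x \<in> {s i<..<t i}")
      case True
      then obtain i where i: "i < n" "x \<in> {s i<..<t i}" by auto
      then have "(\<Sum>j<n. ?h j x) = (\<Sum>j<n. if j = i then h x else 0)"
        using disj by (intro sum.cong) (blast, force)
      then show ?thesis using i h(2) by simp
    next
      case False
      then have "(\<Sum>i<n. ?h i x) = 0" by (intro sum.neutral) auto
      then show ?thesis using h(2) by simp
    qed
  qed (use h in auto)
  finally show ?thesis .
qed

text \<open>Cut \<open>m\<close> at height \<open>N\<close>: the part below contributes at most
  \<open>N\<close> times the total length, and the integral of the excess \<open>h N\<close> over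
  all of \<open>{a..b}\<close> tends to 0 by dominated convergence, whatever the small intervals
  are.\<close>

lemma absolutely_continuous_on_dominated:
  fixes m :: "real \<Rightarrow> real" and F :: "real \<Rightarrow> 'b::metric_space"
  assumes m: "m absolutely_integrable_on {a..b}" "\<And>x. 0 \<le> m x"
    and F: "\<And>s t. s \<in> {a..b} \<Longrightarrow> t \<in> {a..b} \<Longrightarrow> s \<le> t \<Longrightarrow> dist (F s) (F t) \<le> integral {s..t} m"
  shows "absolutely_continuous_on {a..b} F"
  unfolding absolutely_continuous_on_def
proof (intro allI impI)
  fix e :: real assume "e > 0"
  define h where "h N x = max (m x - real N) 0" for N x
  have mi: "m integrable_on {a..b}" using m set_lebesgue_integral_eq_integral(1) by blast
  have hab: "h N absolutely_integrable_on {a..b}" for N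
    unfolding h_def 
    using m by (intro absolutely_integrable_max_1 set_integral_diff) (auto simp: absolutely_integrable_on_const)
  have hi: "h N integrable_on {a..b}" for N
    using hab set_lebesgue_integral_eq_integral(1) by blast
  have "(\<lambda>N. integral {a..b} (h N)) \<longlonglongrightarrow> integral {a..b} (\<lambda>x. 0::real)"
  proof (rule dominated_convergence [where h = m])
    fix x
    obtain N0 :: nat where "m x \<le> real N0" using real_arch_simple by blast
    then have "eventually (\<lambda>N. h N x = 0) sequentially"
      by (intro eventually_sequentiallyI [of N0]) (auto simp: h_def)
    then show "(\<lambda>N. h N x) \<longlonglongrightarrow> 0" by (rule tendsto_eventually)
  qed (use hi mi m(2) in \<open>auto simp: h_def\<close>)
  then have "eventually (\<lambda>N. integral {a..b} (h N) < e/2) sequentially"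
    using \<open>e > 0\<close> by (intro order_tendstoD) auto
  then obtain N where N: "integral {a..b} (h N) < e/2"
    by (auto simp: eventually_sequentially)
  show "\<exists>d>0. \<forall>(n::nat) s t.
      (\<forall>i<n. s i \<in> {a..b} \<and> t i \<in> {a..b} \<and> s i \<le> t i) \<longrightarrow>
      (\<forall>i<n. \<forall>j<n. i \<noteq> j \<longrightarrow> {s i<..<t i} \<inter> {s j<..<t j} = {}) \<longrightarrow>
      (\<Sum>i<n. t i - s i) < d \<longrightarrow> (\<Sum>i<n. dist (F (s i)) (F (t i))) < e"
  proof (intro exI conjI allI impI)
    \<comment> \<open>\<open>N\<close> was chosen to make the excess smaller than e/2; this length
      bound makes \<open>N\<close> times the length at most e/2. The summand 1 covers
      \<open>N = 0\<close>.\<close>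
    show "e / (2 * (real N + 1)) > 0" using \<open>e > 0\<close> by simp
    fix n :: nat and s t
    assume st: "\<forall>i<n. s i \<in> {a..b} \<and> t i \<in> {a..b} \<and> s i \<le> t i"
      and disj: "\<forall>i<n. \<forall>j<n. i \<noteq> j \<longrightarrow> {s i<..<t i} \<inter> {s j<..<t j} = {}"
      and small: "(\<Sum>i<n. t i - s i) < e / (2 * (real N + 1))"
    have "dist (F (s i)) (F (t i)) \<le> real N * (t i - s i) + integral {s i..t i} (h N)" if "i < n" for i
    proof -
      have sub: "{s i..t i} \<subseteq> {a..b}" using st that by auto
      have hsi: "h N integrable_on {s i..t i}" using hi sub integrable_on_subinterval by blast
      have "dist (F (s i)) (F (t i)) \<le> integral {s i..t i} m" using F st that by auto
      also have "\<dots> \<le> integral {s i..t i} (\<lambda>x. real N + h N x)"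
        using mi sub hsi 
        by (intro integral_le integrable_add integrable_on_subinterval [OF mi]) (auto simp flip: h_def intro: integrable_add, simp add: h_def)
      also have "\<dots> = real N * (t i - s i) + integral {s i..t i} (h N)"
        using st that hsi by (subst integral_add) auto
      finally show ?thesis .
    qed
    then have "(\<Sum>i<n. dist (F (s i)) (F (t i))) \<le> (\<Sum>i<n. real N * (t i - s i) + integral {s i..t i} (h N))"
      by (intro sum_mono) auto
    also have "\<dots> = real N * (\<Sum>i<n. t i - s i) + (\<Sum>i<n. integral {s i..t i} (h N))"
      by (simp add: sum.distrib sum_distrib_left)
    also have "(\<Sum>i<n. integral {s i..t i} (h N)) \<le> integral {a..b} (h N)"
      using st disj by (intro sum_integrals_le_integral hi) (auto simp: h_def)
    also have "real N * (\<Sum>i<n. t i - s i) \<le> real N * (e / (2 * (real N + 1)))"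
      using small by (intro mult_left_mono) auto
    also have "\<dots> \<le> e/2" using \<open>e > 0\<close> by (simp add: field_simps)
    finally show "(\<Sum>i<n. dist (F (s i)) (F (t i))) < e" using N by linarith
  qed
qed

text \<open>\<open>integrable_ccontinuous_explicit\<close> averages over cubes with lower corner
  \<open>x\<close>, which on the line is a derivative from the right. The left half is later
  obtained from the same statement for \<open>k (- x)\<close>.\<close>

lemma AE_integral_has_right_derivative:
  fixes k :: "real \<Rightarrow> real"
  assumes k: "k absolutely_integrable_on UNIV"
  shows "AE x in lebesgue. \<forall>e>0. \<exists>d>0. \<forall>h. 0 < h \<and> h < d \<longrightarrow> \<bar>integral {x..x+h} k - h * k x\<bar> \<le> e * h"
proof -
  have "k integrable_on cbox u v" for u v
    using k set_lebesgue_integral_eq_integral(1) integrable_on_subcbox by blast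
  then obtain N where N: "negligible N" "\<And>x e. \<lbrakk>x \<notin> N; 0 < e\<rbrakk> \<Longrightarrow>
      \<exists>d>0. \<forall>h. 0 < h \<and> h < d \<longrightarrow> norm (integral (cbox x (x + h *\<^sub>R One)) k /\<^sub>R h ^ DIM(real) - k x) < e"
    using integrable_ccontinuous_explicit [of k] by metis
  show ?thesis
  proof (rule AE_I')
    show "N \<in> null_sets lebesgue" using N(1) by (simp add: negligible_iff_null_sets)
    show "{x \<in> space lebesgue. \<not> (\<forall>e>0. \<exists>d>0. \<forall>h. 0 < h \<and> h < d \<longrightarrow> \<bar>integral {x..x+h} k - h * k x\<bar> \<le> e * h)} \<subseteq> N"
    proof (clarsimp, rule ccontr)
      fix x e :: real assume "0 < e" "x \<notin> N"
        and *: "\<forall>d>0. \<exists>h>0. h < d \<and> \<not> \<bar>integral {x..x + h} k - h * k x\<bar> \<le> e * h"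
      from N(2) [OF \<open>x \<notin> N\<close> \<open>0 < e\<close>] obtain d where d: "d > 0"
        "\<And>h. 0 < h \<Longrightarrow> h < d \<Longrightarrow> \<bar>integral {x..x + h} k / h - k x\<bar> < e"
        by (auto simp: divide_inverse_commute)
      from * d(1) obtain h where h: "h > 0" "h < d" "\<not> \<bar>integral {x..x + h} k - h * k x\<bar> \<le> e * h" by blast
      have "integral {x..x + h} k - h * k x = h * (integral {x..x + h} k / h - k x)"
        using h by (simp add: field_simps)
      then have "\<bar>integral {x..x + h} k - h * k x\<bar> = h * \<bar>integral {x..x + h} k / h - k x\<bar>"
        using h by (simp add: abs_mult)
      also have "\<dots> \<le> h * e" using d(2) [OF h(1,2)] h by (intro mult_left_mono) auto
      finally show False using h by (simp add: mult.commute)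
    qed
  qed
qed

lemma AE_lebesgue_reflect:
  assumes "AE x in lebesgue. P (x::real)"
  shows "AE x in lebesgue. P (- x)"
proof -
  from assms obtain N where N: "N \<in> null_sets lebesgue" "{x. \<not> P x} \<subseteq> N"
    by (auto elim!: AE_E2 simp: AE_iff_null_sets eventually_ae_filter)
  have "uminus ` N \<in> null_sets lebesgue"
    using N(1) negligible_differentiable_image_negligible [of N uminus]
    by (simp add: negligible_iff_null_sets differentiable_on_minus)
  moreover have "{x. \<not> P (- x)} \<subseteq> uminus ` N"
    using N(2) by (force simp: image_iff intro: bexI [of _ "- _"])
  ultimately show ?thesis by (intro AE_I' [of "uminus ` N"]) auto
qed

lemma AE_indefinite_integral_real:
  fixes k :: "real \<Rightarrow> real"
  assumes k: "k absolutely_integrable_on {a..b}"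
  shows "AE x in lebesgue. x \<in> {a..b} \<longrightarrow> ((\<lambda>t. integral {a..t} k) has_vector_derivative k x) (at x within {a..b})"
proof -
  \<comment> \<open>Extended by zero, so that both one-sided statements, the second one for the
    reflected function, are available on the whole line.\<close>
  define k0 where "k0 x = (if x \<in> {a..b} then k x else 0)" for x
  have k0: "k0 absolutely_integrable_on UNIV"
    unfolding k0_def using k absolutely_integrable_restrict_UNIV [of "{a..b}" k] by simp
  have k0': "(\<lambda>x. k0 (- x)) absolutely_integrable_on UNIV"
  proof -
    have "(\<lambda>x. k (- x)) absolutely_integrable_on {-b..-a}" using k by simp
    then have "(\<lambda>x. if x \<in> {-b..-a} then k (- x) else 0) absolutely_integrable_on UNIV"
      using absolutely_integrable_restrict_UNIV [of "{-b..-a}" "\<lambda>x. k (- x)"] by simp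
    moreover have "(\<lambda>x. if x \<in> {-b..-a} then k (- x) else 0) = (\<lambda>x. k0 (- x))"
      by (auto simp: k0_def fun_eq_iff)
    ultimately show ?thesis by simp
  qed
  have i: "k0 integrable_on {u..v}" for u v 
    using k0 set_lebesgue_integral_eq_integral(1) integrable_on_subinterval by blast
  have kk0: "integral {u..v} k = integral {u..v} k0" if "u \<in> {a..b}" "v \<in> {a..b}" for u v
    using that by (intro integral_cong) (auto simp: k0_def)
  have "integral {- x..- x + h} (\<lambda>x. k0 (- x)) = integral {x-h..x} k0" for x h
    using Henstock_Kurzweil_Integration.integral_reflect_real [where a = "x - h" and b = x and f = k0]
    by (simp only: minus_diff_eq uminus_add_conv_diff)
  with AE_lebesgue_reflect [OF AE_integral_has_right_derivative [OF k0']]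
  have "AE x in lebesgue. \<forall>e>0. \<exists>d>0. \<forall>h. 0 < h \<and> h < d \<longrightarrow> \<bar>integral {x-h..x} k0 - h * k0 x\<bar> \<le> e * h"
    by (simp only: minus_minus)
  with AE_integral_has_right_derivative [OF k0] show ?thesis
  proof eventually_elim
    case (elim x)
    show ?case
    proof
      assume x: "x \<in> {a..b}"
      show "((\<lambda>t. integral {a..t} k) has_vector_derivative k x) (at x within {a..b})"
        unfolding has_vector_derivative_def has_derivative_within_alt
      proof (intro conjI allI impI)
        show "bounded_linear (\<lambda>y. y *\<^sub>R k x)" by (rule bounded_linear_scaleR_left)
        fix e :: real assume "e > 0"
        obtain d1 where d1: "d1 > 0" "\<forall>h. 0 < h \<and> h < d1 \<longrightarrow> \<bar>integral {x..x+h} k0 - h * k0 x\<bar> \<le> e * h"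
          using elim(1) \<open>e > 0\<close> by blast
        obtain d2 where d2: "d2 > 0" "\<forall>h. 0 < h \<and> h < d2 \<longrightarrow> \<bar>integral {x-h..x} k0 - h * k0 x\<bar> \<le> e * h"
          using elim(2) \<open>e > 0\<close> by blast
        show "\<exists>d>0. \<forall>y\<in>{a..b}. norm (y - x) < d \<longrightarrow>
          norm (integral {a..y} k - integral {a..x} k - (y - x) *\<^sub>R k x) \<le> e * norm (y - x)"
        proof (intro exI [of _ "min d1 d2"] conjI ballI impI)
          fix y assume y: "y \<in> {a..b}" "norm (y - x) < min d1 d2"
          have kx: "k x = k0 x" using x by (simp add: k0_def)
          have eq: "integral {a..y} k = integral {a..y} k0" "integral {a..x} k = integral {a..x} k0"
            using x y by (auto intro!: kk0)
          consider "y = x" | "y > x" | "y < x" by linarith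
          then show "norm (integral {a..y} k - integral {a..x} k - (y - x) *\<^sub>R k x) \<le> e * norm (y - x)"
          proof cases
            case 2
            have "integral {a..y} k0 = integral {a..x} k0 + integral {x..y} k0"
              using 2 x i by (intro Henstock_Kurzweil_Integration.integral_combine [symmetric]) auto
            then show ?thesis using d1(2) [rule_format, of "y - x"] 2 y unfolding eq kx by simp
          next
            case 3
            have "integral {a..x} k0 = integral {a..y} k0 + integral {y..x} k0"
              using 3 y i by (intro Henstock_Kurzweil_Integration.integral_combine [symmetric]) auto
            then have "integral {a..y} k0 - integral {a..x} k0 - (y - x) * k0 x = - (integral {y..x} k0 - (x - y) * k0 x)"
              by (simp add: algebra_simps)
            then show ?thesis using d2(2) [rule_format, of "x - y"] 3 y unfolding eq kx by (simp only: real_scaleR_def real_norm_def abs_minus_cancel) simp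
          qed auto
        qed (use d1 d2 in auto)
      qed
    qed
  qed
qed

lemma integral_increment:
  fixes f :: "real \<Rightarrow> 'b::banach"
  assumes "f integrable_on {a..b}" "s \<in> {a..b}" "t \<in> {a..b}" "s \<le> t"
  shows "integral {a..t} f - integral {a..s} f = integral {s..t} f"
proof -
  have "f integrable_on {a..t}" by (rule integrable_on_subinterval [OF assms(1)]) (use assms in auto)
  from Henstock_Kurzweil_Integration.integral_combine [OF _ _ this, of s] show ?thesis using assms by (auto simp: algebra_simps)
qed

text \<open>For a product of a scalar \<open>k\<close> and a continuous \<open>Y\<close>, the
  increment of the integral from x to y is (\<kappa> y - \<kappa> x) Y x up to \<epsilon> times the
  increment of the integral of |k|, where \<kappa> is the integral of \<open>k\<close>. Both scalar
  integrals are differentiable almost everywhere, and the null set does not depend on the vector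
  values.\<close>

lemma has_ae_derivative_on_indefinite_integral:
  assumes "strong_L1 a b f"
  shows "has_ae_derivative_on (\<lambda>t. integral {a..t} f) f {a..b}"
  unfolding has_ae_derivative_on_def
proof
  obtain m :: "real \<Rightarrow> real" where m: "m absolutely_integrable_on {a..b}" "\<And>x. 0 \<le> m x" "\<And>x. x \<in> {a..b} \<Longrightarrow> norm (f x) \<le> m x"
    using strong_L1_bound [OF assms] by blast
  have fi: "f integrable_on {a..b}" by (rule strong_L1_integrable [OF assms])
  show "absolutely_continuous_on {a..b} (\<lambda>t. integral {a..t} f)"
  proof (rule absolutely_continuous_on_dominated [OF m(1,2)])
    fix s t assume st: "s \<in> {a..b}" "t \<in> {a..b}" "s \<le> t"
    have "norm (integral {s..t} f) \<le> integral {s..t} m"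
    proof (rule Henstock_Kurzweil_Integration.integral_norm_bound_integral)
      show "f integrable_on {s..t}" by (rule integrable_on_subinterval [OF fi]) (use st in auto)
      show "m integrable_on {s..t}"
        by (rule integrable_on_subinterval [OF set_lebesgue_integral_eq_integral(1) [OF m(1)]]) (use st in auto)
    qed (use m st in auto)
    then show "dist (integral {a..s} f) (integral {a..t} f) \<le> integral {s..t} m"
      using integral_increment [OF fi st] by (subst dist_commute) (simp add: dist_norm)
  qed
  show "AE x in lebesgue. x \<in> {a..b} \<longrightarrow> ((\<lambda>t. integral {a..t} f) has_vector_derivative f x) (at x within {a..b})"
    using assms
  proof induction
    case (scaleR k Y)
    let ?F = "\<lambda>t. integral {a..t} (\<lambda>x. k x *\<^sub>R Y x)"
    let ?\<kappa> = "\<lambda>t. integral {a..t} k" and ?\<mu> = "\<lambda>t. integral {a..t} (\<lambda>x. \<bar>k x\<bar>)"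
    have kab: "(\<lambda>x. \<bar>k x\<bar>) absolutely_integrable_on {a..b}" by (intro set_integrable_abs scaleR)
    note ki = set_lebesgue_integral_eq_integral(1) [OF scaleR(1)] and kai = set_lebesgue_integral_eq_integral(1) [OF kab]
      and kYi = scaleR_continuous_integrable [OF scaleR]
    have est: "norm (?F t - ?F s - (?\<kappa> t - ?\<kappa> s) *\<^sub>R v) \<le> \<epsilon> * \<bar>?\<mu> t - ?\<mu> s\<bar>" 
      if st: "s \<in> {a..b}" "t \<in> {a..b}" "s \<le> t" and v: "\<And>x. s \<le> x \<Longrightarrow> x \<le> t \<Longrightarrow> norm (Y x - v) \<le> \<epsilon>" for s t v \<epsilon>
    proof -
      have sub: "{s..t} \<subseteq> {a..b}" using st by auto
      note i = integrable_on_subinterval [OF ki sub] integrable_on_subinterval [OF kai sub] integrable_on_subinterval [OF kYi sub]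
      have "integral {s..t} (\<lambda>x. k x *\<^sub>R Y x) - integral {s..t} k *\<^sub>R v = integral {s..t} (\<lambda>x. k x *\<^sub>R (Y x - v))"
        using i integral_linear [OF i(1) bounded_linear_scaleR_left [of v]]
        by (simp add: scaleR_diff_right Henstock_Kurzweil_Integration.integral_diff integrable_on_scaleR_left o_def)
      moreover have "norm (integral {s..t} (\<lambda>x. k x *\<^sub>R (Y x - v))) \<le> integral {s..t} (\<lambda>x. \<epsilon> * \<bar>k x\<bar>)"
      proof (rule Henstock_Kurzweil_Integration.integral_norm_bound_integral)
        show "(\<lambda>x. k x *\<^sub>R (Y x - v)) integrable_on {s..t}"
          using i by (simp add: scaleR_diff_right Henstock_Kurzweil_Integration.integrable_diff integrable_on_scaleR_left)
        show "(\<lambda>x. \<epsilon> * \<bar>k x\<bar>) integrable_on {s..t}" using i by (intro integrable_on_mult_right)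
      qed (use v in \<open>auto simp: mult.commute [of \<epsilon>] intro!: mult_left_mono\<close>)
      moreover have "integral {s..t} (\<lambda>x. \<epsilon> * \<bar>k x\<bar>) = \<epsilon> * (?\<mu> t - ?\<mu> s)"
        unfolding integral_increment [OF kai st] by simp
      moreover have "0 \<le> ?\<mu> t - ?\<mu> s"
        unfolding integral_increment [OF kai st] using i by (intro Henstock_Kurzweil_Integration.integral_nonneg) auto
      ultimately show ?thesis
        unfolding integral_increment [OF ki st] integral_increment [OF kYi st] by (simp only: abs_of_nonneg)
    qed
    show ?case
      using AE_indefinite_integral_real [OF scaleR(1)] AE_indefinite_integral_real [OF kab]
    proof eventually_elim
      case (elim x)
      show ?case
      proof
        assume x: "x \<in> {a..b}"
        with elim have \<kappa>: "(?\<kappa> has_vector_derivative k x) (at x within {a..b})"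
          and \<mu>: "(?\<mu> has_vector_derivative \<bar>k x\<bar>) (at x within {a..b})" by auto
        show "(?F has_vector_derivative k x *\<^sub>R Y x) (at x within {a..b})"
          unfolding has_vector_derivative_def has_derivative_within_alt
        proof (intro conjI allI impI)
          show "bounded_linear (\<lambda>y. y *\<^sub>R k x *\<^sub>R Y x)" by (rule bounded_linear_scaleR_left)
          fix e :: real assume e: "e > 0"
          \<comment> \<open>\<open>d3\<close> bounds the increment of \<open>?\<mu>\<close> by (|k
            x| + 1) |y - x|, so \<epsilon> costs e/2; \<delta> pays the other e/2, for replacing the
            increment of \<open>?\<kappa>\<close> by (y - x) k x. The summands 1 keep the
            denominators positive.\<close>
          define \<epsilon> where "\<epsilon> = e / (2 * (\<bar>k x\<bar> + 1))"
          define \<delta> where "\<delta> = e / (2 * (norm (Y x) + 1))"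
          have pos: "\<epsilon> > 0" "\<delta> > 0" using e by (auto simp: \<epsilon>_def \<delta>_def add_nonneg_pos)
          obtain d1 where d1: "d1 > 0" "\<And>y. y \<in> {a..b} \<Longrightarrow> \<bar>y - x\<bar> < d1 \<Longrightarrow> norm (Y y - Y x) \<le> \<epsilon>"
            using scaleR(2) x pos unfolding continuous_on_iff dist_norm real_norm_def by (meson less_imp_le)
          obtain d2 where d2: "d2 > 0" "\<And>y. y \<in> {a..b} \<Longrightarrow> \<bar>y - x\<bar> < d2 \<Longrightarrow> \<bar>?\<kappa> y - ?\<kappa> x - (y - x) * k x\<bar> \<le> \<delta> * \<bar>y - x\<bar>"
            using \<kappa> pos unfolding has_vector_derivative_def has_derivative_within_alt real_norm_def real_scaleR_def by meson
          obtain d3 where d3: "d3 > 0" "\<And>y. y \<in> {a..b} \<Longrightarrow> \<bar>y - x\<bar> < d3 \<Longrightarrow> \<bar>?\<mu> y - ?\<mu> x - (y - x) * \<bar>k x\<bar>\<bar> \<le> 1 * \<bar>y - x\<bar>"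
            using \<mu> zero_less_one unfolding has_vector_derivative_def has_derivative_within_alt real_norm_def real_scaleR_def by meson
          show "\<exists>d>0. \<forall>y\<in>{a..b}. norm (y - x) < d \<longrightarrow> norm (?F y - ?F x - (y - x) *\<^sub>R k x *\<^sub>R Y x) \<le> e * norm (y - x)"
          proof (intro exI [of _ "min d1 (min d2 d3)"] conjI ballI impI)
            fix y assume y: "y \<in> {a..b}" "norm (y - x) < min d1 (min d2 d3)"
            have "norm (?F y - ?F x - (?\<kappa> y - ?\<kappa> x) *\<^sub>R Y x) \<le> \<epsilon> * \<bar>?\<mu> y - ?\<mu> x\<bar>"
            proof (cases "x \<le> y")
              case True
              show ?thesis using x y True by (intro est d1(2)) (auto simp: abs_if split: if_splits)
            next
              case False
              then have "norm (?F x - ?F y - (?\<kappa> x - ?\<kappa> y) *\<^sub>R Y x) \<le> \<epsilon> * \<bar>?\<mu> x - ?\<mu> y\<bar>"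
                using x y by (intro est d1(2)) (auto simp: abs_if split: if_splits)
              moreover have "?F x - ?F y - (?\<kappa> x - ?\<kappa> y) *\<^sub>R Y x = - (?F y - ?F x - (?\<kappa> y - ?\<kappa> x) *\<^sub>R Y x)"
                by (simp add: algebra_simps)
              ultimately show ?thesis by (simp only: norm_minus_cancel abs_minus_commute)
            qed
            also have "\<bar>?\<mu> y - ?\<mu> x\<bar> \<le> (\<bar>k x\<bar> + 1) * \<bar>y - x\<bar>"
            proof -
              have "\<bar>?\<mu> y - ?\<mu> x\<bar> \<le> \<bar>?\<mu> y - ?\<mu> x - (y - x) * \<bar>k x\<bar>\<bar> + \<bar>(y - x) * \<bar>k x\<bar>\<bar>" by linarith
              also have "\<dots> \<le> 1 * \<bar>y - x\<bar> + \<bar>(y - x) * \<bar>k x\<bar>\<bar>" using d3(2) y by (intro add_right_mono) auto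
              also have "\<dots> = (\<bar>k x\<bar> + 1) * \<bar>y - x\<bar>" unfolding abs_mult abs_abs by (simp add: algebra_simps)
              finally show ?thesis .
            qed
            also have "\<epsilon> * ((\<bar>k x\<bar> + 1) * \<bar>y - x\<bar>) = e / 2 * \<bar>y - x\<bar>"
              using add_nonneg_pos [of "\<bar>k x\<bar>" 1] by (simp add: \<epsilon>_def divide_simps)
            finally have 1: "norm (?F y - ?F x - (?\<kappa> y - ?\<kappa> x) *\<^sub>R Y x) \<le> e / 2 * \<bar>y - x\<bar>" using pos by simp
            have "norm ((?\<kappa> y - ?\<kappa> x) *\<^sub>R Y x - ((y - x) * k x) *\<^sub>R Y x) \<le> \<delta> * \<bar>y - x\<bar> * (norm (Y x) + 1)"
              unfolding scaleR_diff_left [symmetric] norm_scaleR 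
              using d2(2) [of y] y pos by (intro mult_mono) auto
            also have "\<dots> = e / 2 * \<bar>y - x\<bar>"
              using add_nonneg_pos [of "norm (Y x)" 1] by (simp add: \<delta>_def divide_simps)
            finally have 2: "norm ((?\<kappa> y - ?\<kappa> x) *\<^sub>R Y x - ((y - x) * k x) *\<^sub>R Y x) \<le> e / 2 * \<bar>y - x\<bar>" .
            have "?F y - ?F x - (y - x) *\<^sub>R k x *\<^sub>R Y x = (?F y - ?F x - (?\<kappa> y - ?\<kappa> x) *\<^sub>R Y x) + ((?\<kappa> y - ?\<kappa> x) *\<^sub>R Y x - ((y - x) * k x) *\<^sub>R Y x)"
              by simp
            also have "norm \<dots> \<le> e / 2 * \<bar>y - x\<bar> + e / 2 * \<bar>y - x\<bar>"
              by (rule norm_triangle_mono [OF 1 2])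
            finally show "norm (?F y - ?F x - (y - x) *\<^sub>R k x *\<^sub>R Y x) \<le> e * norm (y - x)" by simp
          qed (use d1 d2 d3 in auto)
        qed
      qed
    qed
  next
    case (add f g)
    have eq: "integral {a..t} (\<lambda>x. f x + g x) = integral {a..t} f + integral {a..t} g" if "t \<in> {a..b}" for t
      using that by (intro Henstock_Kurzweil_Integration.integral_add integrable_on_subinterval [OF strong_L1_integrable [OF add(1)]]
        integrable_on_subinterval [OF strong_L1_integrable [OF add(2)]]) auto
    from add.IH show ?case
    proof eventually_elim
      case (elim x)
      then show ?case
        by (auto intro: has_vector_derivative_transform [OF _ eq] has_vector_derivative_add)
    qed
  next
    case (cong f g)
    have eq: "integral {a..t} g = integral {a..t} f" if "t \<in> {a..b}" for t
      using that cong(2) by (intro integral_cong) auto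
    from cong.IH show ?case
    proof eventually_elim
      case (elim x)
      then show ?case using cong(2)
        by (auto intro: has_vector_derivative_transform [OF _ eq])
    qed
  qed
qed

section \<open>The calculus of absolutely continuous functions\<close>

text \<open>The inner statement of \<open>absolutely_continuous_on\<close> at fixed tolerances,
  isolated so that one modulus can be restricted to subsets and transferred to families of intervals
  with other index sets.\<close>

definition ac_modulus :: "real set \<Rightarrow> (real \<Rightarrow> 'a::metric_space) \<Rightarrow> real \<Rightarrow> real \<Rightarrow> bool"
  where "ac_modulus I F e d \<longleftrightarrow> (\<forall>(n::nat) s t.
      (\<forall>i<n. s i \<in> I \<and> t i \<in> I \<and> s i \<le> t i) \<longrightarrow>
      (\<forall>i<n. \<forall>j<n. i \<noteq> j \<longrightarrow> {s i<..<t i} \<inter> {s j<..<t j} = {}) \<longrightarrow>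
      (\<Sum>i<n. t i - s i) < d \<longrightarrow> (\<Sum>i<n. dist (F (s i)) (F (t i))) < e)"

lemma absolutely_continuous_on_iff:
  "absolutely_continuous_on I F \<longleftrightarrow> (\<forall>e>0. \<exists>d>0. ac_modulus I F e d)"
  by (simp add: absolutely_continuous_on_def ac_modulus_def)

lemma ac_modulus_finite:
  assumes d: "ac_modulus I F e d" and J: "finite J"
    and st: "\<And>i. i \<in> J \<Longrightarrow> s i \<in> I \<and> t i \<in> I \<and> s i \<le> t i"
    and disj: "\<And>i j. i \<in> J \<Longrightarrow> j \<in> J \<Longrightarrow> i \<noteq> j \<Longrightarrow> {s i<..<t i} \<inter> {s j<..<t j} = {}"
    and small: "(\<Sum>i\<in>J. t i - s i) < d"
  shows "(\<Sum>i\<in>J. dist (F (s i)) (F (t i))) < e"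
proof -
    obtain h where h: "bij_betw h {..<card J} J"
      using ex_bij_betw_nat_finite [OF J] by (auto simp: atLeast0LessThan)
    have hJ: "h i \<in> J" if "i < card J" for i using h that by (auto simp: bij_betw_def)
    have hne: "h i \<noteq> h j" if "i < card J" "j < card J" "i \<noteq> j" for i j
      using h that by (auto simp: bij_betw_def inj_on_def)
    have "(\<Sum>i<card J. dist (F (s (h i))) (F (t (h i)))) < e"
    proof (rule d [unfolded ac_modulus_def, rule_format, of _ "\<lambda>i. s (h i)" "\<lambda>i. t (h i)"])
      show "(\<Sum>i<card J. t (h i) - s (h i)) < d"
        using small sum.reindex_bij_betw [OF h, of "\<lambda>i. t i - s i"] by simp
    qed (use st hJ disj hne in auto)
  then show ?thesis
    using sum.reindex_bij_betw [OF h, of "\<lambda>i. dist (F (s i)) (F (t i))"] by simp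
qed

lemma absolutely_continuous_on_imp_continuous_on:
  assumes "absolutely_continuous_on I F"
  shows "continuous_on I F"
  unfolding continuous_on_iff
proof (intro ballI allI impI)
  fix x and e :: real assume x: "x \<in> I" "e > 0"
  then obtain d where d: "d > 0" "ac_modulus I F e d"
    using assms unfolding absolutely_continuous_on_iff by blast
  have "dist (F y) (F x) < e" if "y \<in> I" "dist y x < d" for y
    using ac_modulus_finite [OF d(2), of "{0::nat}" "\<lambda>_. min x y" "\<lambda>_. max x y"] that x
    by (cases "x \<le> y") (auto simp: dist_real_def dist_commute)
  then show "\<exists>d>0. \<forall>x'\<in>I. dist x' x < d \<longrightarrow> dist (F x') (F x) < e"
    using d(1) by blast
qed

text \<open>Sums, products, linear images and inverses all reduce to this one comparison, with
  \<open>G = F\<close> where only one function is involved.\<close>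

lemma absolutely_continuous_on_compare:
  assumes F: "absolutely_continuous_on I F" and G: "absolutely_continuous_on I G"
    and H: "\<And>s t. s \<in> I \<Longrightarrow> t \<in> I \<Longrightarrow> dist (H s) (H t) \<le> C * (dist (F s) (F t) + dist (G s) (G t))"
  shows "absolutely_continuous_on I H"
  unfolding absolutely_continuous_on_iff
proof (intro allI impI)
  fix e :: real assume "e > 0"
  define \<epsilon> where "\<epsilon> = e / (2 * (\<bar>C\<bar> + 1))"
  have "\<epsilon> > 0" using \<open>e > 0\<close> by (simp add: \<epsilon>_def add_nonneg_pos)
  then obtain d1 d2 where d: "d1 > 0" "d2 > 0" and 1: "ac_modulus I F \<epsilon> d1" and 2: "ac_modulus I G \<epsilon> d2"
    using F G unfolding absolutely_continuous_on_iff by blast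
  show "\<exists>d>0. ac_modulus I H e d"
    unfolding ac_modulus_def
  proof (intro exI [of _ "min d1 d2"] conjI allI impI)
    fix n :: nat and s t
    assume *: "\<forall>i<n. s i \<in> I \<and> t i \<in> I \<and> s i \<le> t i" "\<forall>i<n. \<forall>j<n. i \<noteq> j \<longrightarrow> {s i<..<t i} \<inter> {s j<..<t j} = {}"
      "(\<Sum>i<n. t i - s i) < min d1 d2"
    have "(\<Sum>i<n. dist (H (s i)) (H (t i))) \<le> (\<Sum>i<n. (\<bar>C\<bar> + 1) * (dist (F (s i)) (F (t i)) + dist (G (s i)) (G (t i))))"
    proof (rule sum_mono)
      fix i assume "i \<in> {..<n}"
      then have "dist (H (s i)) (H (t i)) \<le> C * (dist (F (s i)) (F (t i)) + dist (G (s i)) (G (t i)))"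
        using * H by auto
      also have "\<dots> \<le> (\<bar>C\<bar> + 1) * (dist (F (s i)) (F (t i)) + dist (G (s i)) (G (t i)))"
        by (intro mult_right_mono) auto
      finally show "dist (H (s i)) (H (t i)) \<le> (\<bar>C\<bar> + 1) * (dist (F (s i)) (F (t i)) + dist (G (s i)) (G (t i)))" .
    qed
    also have "\<dots> = (\<bar>C\<bar> + 1) * ((\<Sum>i<n. dist (F (s i)) (F (t i))) + (\<Sum>i<n. dist (G (s i)) (G (t i))))"
      by (simp add: sum_distrib_left sum.distrib [symmetric])
    also have "\<dots> < (\<bar>C\<bar> + 1) * (\<epsilon> + \<epsilon>)"
      using * by (intro mult_strict_left_mono add_strict_mono 1 [unfolded ac_modulus_def, rule_format] 2 [unfolded ac_modulus_def, rule_format]) auto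
    also have "\<dots> = e" using add_nonneg_pos [of "\<bar>C\<bar>" 1] by (simp add: \<epsilon>_def divide_simps)
    finally show "(\<Sum>i<n. dist (H (s i)) (H (t i))) < e" .
  qed (use d in auto)
qed

text \<open>Henstock's straddle estimate. It provides the gauge for the fundamental theorem below,
  where \<open>x\<close> is a tag anywhere inside its subinterval.\<close>

lemma has_vector_derivative_straddle:
  fixes F :: "real \<Rightarrow> 'b::real_normed_vector"
  assumes "(F has_vector_derivative f) (at x within S)" "e > 0"
  shows "\<exists>d>0. \<forall>u\<in>S. \<forall>v\<in>S. u \<le> x \<longrightarrow> x \<le> v \<longrightarrow> x - u < d \<longrightarrow> v - x < d \<longrightarrow>
    norm ((v - u) *\<^sub>R f - (F v - F u)) \<le> e * (v - u)"
proof -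
  obtain d where d: "d > 0" "\<forall>y\<in>S. norm (y - x) < d \<longrightarrow> norm (F y - F x - (y - x) *\<^sub>R f) \<le> e * norm (y - x)"
    using assms unfolding has_vector_derivative_def has_derivative_within_alt by blast
  show ?thesis
  proof (intro exI [of _ d] conjI ballI impI d(1))
    fix u v assume *: "u \<in> S" "v \<in> S" "u \<le> x" "x \<le> v" "x - u < d" "v - x < d"
    have "norm ((v - u) *\<^sub>R f - (F v - F u)) = norm ((F u - F x - (u - x) *\<^sub>R f) - (F v - F x - (v - x) *\<^sub>R f))"
      by (rule arg_cong [of _ _ norm]) (simp add: algebra_simps)
    also have "\<dots> \<le> norm (F u - F x - (u - x) *\<^sub>R f) + norm (F v - F x - (v - x) *\<^sub>R f)"
      by (rule norm_triangle_ineq4)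
    also have "\<dots> \<le> e * norm (u - x) + e * norm (v - x)"
      using * by (intro add_mono d(2) [rule_format]) auto
    also have "\<dots> = e * (v - u)" using * by (simp add: algebra_simps)
    finally show "norm ((v - u) *\<^sub>R f - (F v - F u)) \<le> e * (v - u)" .
  qed
qed

text \<open>The fundamental theorem of calculus for absolutely continuous functions. Subintervals
  tagged outside the exceptional null set are handled by the straddle estimate; those tagged inside
  it have small total length, so absolute continuity bounds the increments of \<open>F\<close> over
  them.\<close>

lemma has_ae_derivative_on_has_integral:
  fixes F :: "real \<Rightarrow> 'b::banach"
  assumes F: "has_ae_derivative_on F f {a..b}" and "a \<le> b"
  shows "(f has_integral (F b - F a)) {a..b}"
proof -
  obtain N where N: "N \<in> null_sets lebesgue"
    and der: "\<And>x. x \<in> {a..b} \<Longrightarrow> x \<notin> N \<Longrightarrow> (F has_vector_derivative f x) (at x within {a..b})"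
    using F unfolding has_ae_derivative_on_def eventually_ae_filter by fastforce
  have neg: "negligible N" using N by (simp add: negligible_iff_null_sets)
  \<comment> \<open>Zero on the null set, so that its tags contribute nothing to the Riemann sums,
    whatever \<open>f\<close> is there.\<close>
  define g where "g x = (if x \<in> N then 0 else f x)" for x
  have "(g has_integral (F b - F a)) (cbox a b)"
    unfolding has_integral
  proof (intro allI impI)
    fix e :: real assume "e > 0"
    have AC: "absolutely_continuous_on {a..b} F" using F by (simp add: has_ae_derivative_on_def)
    then obtain \<delta> where \<delta>: "\<delta> > 0" "ac_modulus {a..b} F (e/2) \<delta>"
      using half_gt_zero [OF \<open>e > 0\<close>] unfolding absolutely_continuous_on_iff by blast
    define \<epsilon> where "\<epsilon> = e / (2 * (b - a + 1))"
    have "\<epsilon> > 0" using \<open>e > 0\<close> \<open>a \<le> b\<close> by (simp add: \<epsilon>_def)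
    have "\<exists>d>0. x \<in> {a..b} \<longrightarrow> x \<notin> N \<longrightarrow> (\<forall>u\<in>{a..b}. \<forall>v\<in>{a..b}. u \<le> x \<longrightarrow> x \<le> v \<longrightarrow> x - u < d \<longrightarrow> v - x < d \<longrightarrow>
      norm ((v - u) *\<^sub>R f x - (F v - F u)) \<le> \<epsilon> * (v - u))" for x
    proof (cases "x \<in> {a..b} \<and> x \<notin> N")
      case True
      then show ?thesis
        using has_vector_derivative_straddle [OF der \<open>\<epsilon> > 0\<close>] by simp
    qed (auto intro: exI [of _ 1])
    from choice [OF allI, OF this]
    obtain r where "\<forall>x. r x > 0 \<and> (x \<in> {a..b} \<longrightarrow> x \<notin> N \<longrightarrow> (\<forall>u\<in>{a..b}. \<forall>v\<in>{a..b}. u \<le> x \<longrightarrow> x \<le> v \<longrightarrow> x - u < r x \<longrightarrow> v - x < r x \<longrightarrow>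
      norm ((v - u) *\<^sub>R f x - (F v - F u)) \<le> \<epsilon> * (v - u)))" ..
    then have r: "\<And>x. r x > 0" "\<And>x u v. x \<in> {a..b} \<Longrightarrow> x \<notin> N \<Longrightarrow> u\<in>{a..b} \<Longrightarrow> v\<in>{a..b} \<Longrightarrow> u \<le> x \<Longrightarrow> x \<le> v \<Longrightarrow> x - u < r x \<Longrightarrow> v - x < r x \<Longrightarrow>
      norm ((v - u) *\<^sub>R f x - (F v - F u)) \<le> \<epsilon> * (v - u)"
      by auto
    \<comment> \<open>The Riemann sum of the indicator is the total length of the subintervals
      tagged in \<open>N\<close>; the gauge from this integral makes it smaller than
      \<delta>.\<close>
    have "((indicator N :: real \<Rightarrow> real) has_integral 0) (cbox a b)"
      using neg by (simp add: negligible_def)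
    from this [unfolded has_integral, THEN spec, THEN mp, OF \<delta>(1)]
    obtain \<gamma> where \<gamma>': "gauge \<gamma> \<and> (\<forall>\<D>. \<D> tagged_division_of cbox a b \<and> \<gamma> fine \<D> \<longrightarrow>
      norm ((\<Sum>(x,K)\<in>\<D>. measure lborel K *\<^sub>R (indicator N x :: real)) - 0) < \<delta>)" ..
    note \<gamma> = conjunct1 [OF \<gamma>'] conjunct2 [OF \<gamma>']
    show "\<exists>\<gamma>. gauge \<gamma> \<and> (\<forall>\<D>. \<D> tagged_division_of cbox a b \<and> \<gamma> fine \<D> \<longrightarrow>
      norm ((\<Sum>(x,K)\<in>\<D>. measure lborel K *\<^sub>R g x) - (F b - F a)) < e)"
    proof (intro exI [of _ "\<lambda>x. \<gamma> x \<inter> ball x (r x)"] conjI allI impI gauge_Int \<gamma>(1))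
      show "gauge (\<lambda>x. ball x (r x))" using r(1) by (simp add: gauge_def)
      fix \<D> assume "\<D> tagged_division_of cbox a b \<and> (\<lambda>x. \<gamma> x \<inter> ball x (r x)) fine \<D>"
      then have D: "\<D> tagged_division_of {a..b}" and fine: "\<gamma> fine \<D>" "(\<lambda>x. ball x (r x)) fine \<D>"
        by (auto simp: fine_Int)
      have fin: "finite \<D>" using D by blast
      have K: "\<exists>u v. K = {u..v} \<and> u \<le> x \<and> x \<le> v \<and> u \<in> {a..b} \<and> v \<in> {a..b} \<and> x - u < r x \<and> v - x < r x \<and> x \<in> {a..b}" 
        if xK: "(x, K) \<in> \<D>" for x K
      proof -
        obtain u v where uv: "K = cbox u v" using tagged_division_ofD(4) [OF D xK] by blast
        have x: "x \<in> K" "K \<subseteq> {a..b}" "K \<subseteq> ball x (r x)"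
          using tagged_division_ofD(2,3) [OF D xK] fine(2) xK by (auto simp: fine_def)
        then have uvK: "u \<in> K" "v \<in> K" using uv by auto
        then have "\<bar>x - u\<bar> < r x" "\<bar>x - v\<bar> < r x" using x(3) by (auto simp: dist_real_def)
        moreover have "u \<in> {a..b}" "v \<in> {a..b}" "x \<in> {a..b}" "u \<le> x" "x \<le> v" using uvK x uv by auto
        ultimately show ?thesis using uv by (intro exI [of _ u] exI [of _ v]) simp
      qed
      let ?\<Delta> = "\<lambda>(x::real,K). F (Sup K) - F (Inf K)"
      define J where "J = {i \<in> \<D>. fst i \<in> N}"
      have fJ: "finite J" and JD: "J \<subseteq> \<D>" using fin by (auto simp: J_def)
      have SupInf: "Inf K = u" "Sup K = v" if "K = {u..v}" "u \<le> v" for K and u v :: real using that by auto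
      have small: "(\<Sum>i\<in>J. dist (F (Inf (snd i))) (F (Sup (snd i)))) < e/2"
      proof (rule ac_modulus_finite [OF \<delta>(2) fJ, of "\<lambda>i. Inf (snd i)" "\<lambda>i. Sup (snd i)"])
        fix i assume "i \<in> J"
        then have "(fst i, snd i) \<in> \<D>" using JD by auto
        from K [OF this] show "Inf (snd i) \<in> {a..b} \<and> Sup (snd i) \<in> {a..b} \<and> Inf (snd i) \<le> Sup (snd i)"
          by auto
      next
        fix i j assume "i \<in> J" "j \<in> J" and ne: "i \<noteq> j"
        then have i: "(fst i, snd i) \<in> \<D>" and j: "(fst j, snd j) \<in> \<D>" using JD by auto
        have "interior (snd i) \<inter> interior (snd j) = {}"
          using ne by (intro tagged_division_ofD(5) [OF D i j]) (auto simp: prod_eq_iff)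
        then show "{Inf (snd i)<..<Sup (snd i)} \<inter> {Inf (snd j)<..<Sup (snd j)} = {}"
          using K [OF i] K [OF j] by (elim exE conjE) (simp del: Int_greaterThanLessThan)
      next
        have "(\<Sum>i\<in>J. Sup (snd i) - Inf (snd i)) = (\<Sum>(x,K)\<in>J. measure lborel K *\<^sub>R (indicator N x :: real))"
        proof (rule sum.cong [OF refl], clarify)
          fix x K assume xK: "(x, K) \<in> J"
          then have "(x, K) \<in> \<D>" "x \<in> N" by (auto simp: J_def)
          then show "Sup (snd (x, K)) - Inf (snd (x, K)) = measure lborel K *\<^sub>R (indicator N x :: real)"
            using K by fastforce
        qed
        also have "\<dots> \<le> (\<Sum>(x,K)\<in>\<D>. measure lborel K *\<^sub>R (indicator N x :: real))"
          using fin JD by (intro sum_mono2) auto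
        also have "\<dots> < \<delta>" using \<gamma>(2) [rule_format, of \<D>] D fine by simp
        finally show "(\<Sum>i\<in>J. Sup (snd i) - Inf (snd i)) < \<delta>" .
      qed
      have "(\<Sum>(x,K)\<in>\<D>. measure lborel K *\<^sub>R g x) - (F b - F a) = (\<Sum>(x,K)\<in>\<D>. measure lborel K *\<^sub>R g x - ?\<Delta> (x,K))"
        unfolding additive_tagged_division_1 [OF \<open>a \<le> b\<close> D, of F, symmetric]
        by (simp add: sum_subtractf split_def)
      also have "\<dots> = (\<Sum>(x,K)\<in>\<D> - J. measure lborel K *\<^sub>R g x - ?\<Delta> (x,K)) + (\<Sum>(x,K)\<in>J. measure lborel K *\<^sub>R g x - ?\<Delta> (x,K))"
        using fin JD by (simp add: sum.subset_diff)
      also have "norm \<dots> < e/2 + e/2"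
      proof (rule norm_triangle_lt, rule add_le_less_mono)
        have "norm (\<Sum>(x,K)\<in>\<D> - J. measure lborel K *\<^sub>R g x - ?\<Delta> (x,K)) \<le> (\<Sum>(x,K)\<in>\<D> - J. \<epsilon> * measure lborel K)"
        proof (rule sum_norm_le, clarify)
          fix x K assume xK: "(x, K) \<in> \<D>" "(x, K) \<notin> J"
          from K [OF xK(1)] obtain u v where uv: "K = {u..v}" "u \<le> x" "x \<le> v" "u \<in> {a..b}" "v \<in> {a..b}" "x - u < r x" "v - x < r x" "x \<in> {a..b}"
            by blast
          have "x \<notin> N" using xK by (simp add: J_def)
          then have "norm ((v - u) *\<^sub>R f x - (F v - F u)) \<le> \<epsilon> * (v - u)"
            using r(2) [of x u v] uv by simp
          then show "norm (measure lborel K *\<^sub>R g x - (F (Sup K) - F (Inf K))) \<le> \<epsilon> * measure lborel K"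
            using uv \<open>x \<notin> N\<close> by (simp add: g_def)
        qed
        also have "\<dots> \<le> (\<Sum>(x,K)\<in>\<D>. \<epsilon> * measure lborel K)"
          using fin \<open>\<epsilon> > 0\<close> by (intro sum_mono2) auto
        also have "\<dots> = \<epsilon> * (b - a)"
          using additive_content_tagged_division [of \<D> a b] D \<open>a \<le> b\<close> by (simp add: sum_distrib_left [symmetric] split_def)
        also have "\<dots> \<le> \<epsilon> * (b - a + 1)" using \<open>\<epsilon> > 0\<close> by simp
        also have "\<dots> = e/2" using \<open>a \<le> b\<close> by (simp add: \<epsilon>_def field_simps)
        finally show "norm (\<Sum>(x,K)\<in>\<D> - J. measure lborel K *\<^sub>R g x - ?\<Delta> (x,K)) \<le> e/2" .
        have "norm (\<Sum>(x,K)\<in>J. measure lborel K *\<^sub>R g x - ?\<Delta> (x,K)) \<le> (\<Sum>i\<in>J. dist (F (Inf (snd i))) (F (Sup (snd i))))"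
        proof (rule sum_norm_le, clarify)
          fix x K assume "(x, K) \<in> J"
          then have "g x = 0" by (simp add: J_def g_def)
          then show "norm (measure lborel K *\<^sub>R g x - (F (Sup K) - F (Inf K))) \<le> dist (F (Inf (snd (x, K)))) (F (Sup (snd (x, K))))"
            by (simp add: dist_norm)
        qed
        with small show "norm (\<Sum>(x,K)\<in>J. measure lborel K *\<^sub>R g x - ?\<Delta> (x,K)) < e/2" by linarith
      qed
      finally show "norm ((\<Sum>(x,K)\<in>\<D>. measure lborel K *\<^sub>R g x) - (F b - F a)) < e" by simp
    qed
  qed
  then show ?thesis
    using has_integral_spike [OF neg, of "{a..b}" f g] by (auto simp: g_def)
qed

section \<open>Rules for derivatives that exist almost everywhere\<close>

lemma has_ae_derivative_on_imp_continuous_on: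
  "has_ae_derivative_on F f I \<Longrightarrow> continuous_on I F"
  by (simp add: has_ae_derivative_on_def absolutely_continuous_on_imp_continuous_on)

lemma has_ae_derivative_on_subset:
  assumes "has_ae_derivative_on F f I" "J \<subseteq> I"
  shows "has_ae_derivative_on F f J"
proof -
  have "ac_modulus J F e d" if "ac_modulus I F e d" for e d
    unfolding ac_modulus_def
  proof (intro allI impI)
    fix n :: nat and s t
    assume "\<forall>i<n. s i \<in> J \<and> t i \<in> J \<and> s i \<le> t i" "\<forall>i<n. \<forall>j<n. i \<noteq> j \<longrightarrow> {s i<..<t i} \<inter> {s j<..<t j} = {}"
      "(\<Sum>i<n. t i - s i) < d"
    then show "(\<Sum>i<n. dist (F (s i)) (F (t i))) < e"
      using assms(2) by (intro that [unfolded ac_modulus_def, rule_format]) auto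
  qed
  then have "absolutely_continuous_on J F"
    using assms(1) unfolding has_ae_derivative_on_def absolutely_continuous_on_iff by blast
  moreover have "AE x in lebesgue. x \<in> J \<longrightarrow> (F has_vector_derivative f x) (at x within J)"
    using assms(1) unfolding has_ae_derivative_on_def
    by (elim conjE eventually_mono) (use assms(2) in \<open>auto intro: has_vector_derivative_within_subset\<close>)
  ultimately show ?thesis by (simp add: has_ae_derivative_on_def)
qed

lemma has_ae_derivative_on_eq_integral:
  fixes F :: "real \<Rightarrow> 'b::banach"
  assumes "has_ae_derivative_on F f {a..b}" "x \<in> {a..b}"
  shows "(f has_integral (F x - F a)) {a..x}" "F x = F a + integral {a..x} f"
proof -
  show "(f has_integral (F x - F a)) {a..x}"
    using assms by (intro has_ae_derivative_on_has_integral has_ae_derivative_on_subset [OF assms(1)]) auto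
  then show "F x = F a + integral {a..x} f" by (simp add: integral_unique)
qed

lemma has_ae_derivative_on_cong:
  assumes "has_ae_derivative_on F f I" "\<And>x. x \<in> I \<Longrightarrow> F x = G x"
    and "AE x in lebesgue. x \<in> I \<longrightarrow> f x = g x"
  shows "has_ae_derivative_on G g I"
proof -
  have "absolutely_continuous_on I F \<Longrightarrow> absolutely_continuous_on I G"
    by (rule absolutely_continuous_on_compare [where F = F and G = F and C = 1]) (auto simp: assms(2))
  moreover have "AE x in lebesgue. x \<in> I \<longrightarrow> (G has_vector_derivative g x) (at x within I)"
    using assms(1) [unfolded has_ae_derivative_on_def, THEN conjunct2] assms(3)
    by eventually_elim (metis assms(2) has_vector_derivative_transform)
  ultimately show ?thesis using assms(1) by (simp add: has_ae_derivative_on_def)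
qed

lemma has_ae_derivative_on_linear:
  assumes h: "bounded_linear h" and F: "has_ae_derivative_on F f I"
  shows "has_ae_derivative_on (\<lambda>x. h (F x)) (\<lambda>x. h (f x)) I"
proof -
  obtain C where C: "\<And>x. norm (h x) \<le> norm x * C" using bounded_linear.bounded [OF h] by auto
  have "absolutely_continuous_on I (\<lambda>x. h (F x))"
  proof (rule absolutely_continuous_on_compare)
    show "dist (h (F s)) (h (F t)) \<le> (C/2) * (dist (F s) (F t) + dist (F s) (F t))" for s t
      using C [of "F s - F t"] by (simp add: dist_norm linear_simps(2) [OF h] mult.commute)
  qed (use F in \<open>auto simp: has_ae_derivative_on_def\<close>)
  moreover have "AE x in lebesgue. x \<in> I \<longrightarrow> ((\<lambda>x. h (F x)) has_vector_derivative h (f x)) (at x within I)"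
    using F unfolding has_ae_derivative_on_def
    by (elim conjE eventually_mono) (auto intro: bounded_linear.has_vector_derivative [OF h])
  ultimately show ?thesis by (simp add: has_ae_derivative_on_def)
qed

lemma has_ae_derivative_on_add:
  assumes F: "has_ae_derivative_on F f I" and G: "has_ae_derivative_on G g I"
  shows "has_ae_derivative_on (\<lambda>x. F x + G x) (\<lambda>x. f x + g x) I"
proof -
  have "absolutely_continuous_on I (\<lambda>x. F x + G x)"
  proof (rule absolutely_continuous_on_compare)
    show "dist (F s + G s) (F t + G t) \<le> 1 * (dist (F s) (F t) + dist (G s) (G t))" for s t
      by (simp add: dist_triangle_add)
  qed (use F G in \<open>auto simp: has_ae_derivative_on_def\<close>)
  moreover have "AE x in lebesgue. x \<in> I \<longrightarrow> ((\<lambda>x. F x + G x) has_vector_derivative f x + g x) (at x within I)"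
    using F [unfolded has_ae_derivative_on_def, THEN conjunct2] G [unfolded has_ae_derivative_on_def, THEN conjunct2]
    by eventually_elim (auto intro: has_vector_derivative_add)
  ultimately show ?thesis by (simp add: has_ae_derivative_on_def)
qed

lemma has_ae_derivative_on_minus:
  "has_ae_derivative_on F f I \<Longrightarrow> has_ae_derivative_on (\<lambda>x. - F x) (\<lambda>x. - f x) I"
  by (rule has_ae_derivative_on_linear [OF bounded_linear_minus [OF bounded_linear_ident]])

lemma has_ae_derivative_on_diff:
  "has_ae_derivative_on F f I \<Longrightarrow> has_ae_derivative_on G g I \<Longrightarrow>
    has_ae_derivative_on (\<lambda>x. F x - G x) (\<lambda>x. f x - g x) I"
  using has_ae_derivative_on_add [OF _ has_ae_derivative_on_minus] by fastforce

lemma has_ae_derivative_on_const: "has_ae_derivative_on (\<lambda>_. c) (\<lambda>_. 0) I"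
  by (auto simp: has_ae_derivative_on_def absolutely_continuous_on_def)

lemma continuous_on_interval_bounded:
  fixes F :: "real \<Rightarrow> 'b::real_normed_vector"
  assumes "continuous_on {a..b} F"
  shows "\<exists>M\<ge>0. \<forall>x\<in>{a..b}. norm (F x) \<le> M"
proof -
  have "bounded (F ` {a..b})" by (intro compact_imp_bounded compact_continuous_image assms) simp
  then obtain M where "\<forall>x\<in>{a..b}. norm (F x) \<le> M" by (auto simp: bounded_iff)
  then show ?thesis by (intro exI [of _ "max M 0"]) (auto simp: le_max_iff_disj)
qed

lemma has_ae_derivative_on_bilinear:
  assumes p: "bounded_bilinear p" and F: "has_ae_derivative_on F f {a..b}" and G: "has_ae_derivative_on G g {a..b}"
  shows "has_ae_derivative_on (\<lambda>x. p (F x) (G x)) (\<lambda>x. p (F x) (g x) + p (f x) (G x)) {a..b}"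
proof -
  obtain C where C: "C \<ge> 0" "\<And>x y. norm (p x y) \<le> norm x * norm y * C" using bounded_bilinear.nonneg_bounded [OF p] by auto
  obtain M1 where M1: "M1 \<ge> 0" "\<And>x. x \<in> {a..b} \<Longrightarrow> norm (F x) \<le> M1"
    using continuous_on_interval_bounded [OF has_ae_derivative_on_imp_continuous_on [OF F]] by auto
  obtain M2 where M2: "M2 \<ge> 0" "\<And>x. x \<in> {a..b} \<Longrightarrow> norm (G x) \<le> M2"
    using continuous_on_interval_bounded [OF has_ae_derivative_on_imp_continuous_on [OF G]] by auto
  have "absolutely_continuous_on {a..b} (\<lambda>x. p (F x) (G x))"
  proof (rule absolutely_continuous_on_compare)
    fix s t assume st: "s \<in> {a..b}" "t \<in> {a..b}"
    have "p (F s) (G s) - p (F t) (G t) = p (F s - F t) (G s) + p (F t) (G s - G t)"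
      by (simp add: bounded_bilinear.diff_left [OF p] bounded_bilinear.diff_right [OF p])
    also have "norm \<dots> \<le> norm (F s - F t) * norm (G s) * C + norm (F t) * norm (G s - G t) * C"
      by (intro norm_triangle_mono C)
    also have "\<dots> \<le> norm (F s - F t) * (M1 + M2) * C + (M1 + M2) * norm (G s - G t) * C"
      using st M1 M2 C by (intro add_mono mult_mono) (auto intro: add_increasing add_increasing2)
    finally show "dist (p (F s) (G s)) (p (F t) (G t)) \<le> ((M1 + M2) * C) * (dist (F s) (F t) + dist (G s) (G t))"
      by (simp add: dist_norm algebra_simps)
  qed (use F G in \<open>auto simp: has_ae_derivative_on_def\<close>)
  moreover have "AE x in lebesgue. x \<in> {a..b} \<longrightarrow> ((\<lambda>x. p (F x) (G x)) has_vector_derivative p (F x) (g x) + p (f x) (G x)) (at x within {a..b})"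
    using F [unfolded has_ae_derivative_on_def, THEN conjunct2] G [unfolded has_ae_derivative_on_def, THEN conjunct2]
    by eventually_elim (auto intro: bounded_bilinear.has_vector_derivative [OF p])
  ultimately show ?thesis by (simp add: has_ae_derivative_on_def)
qed

lemma has_vector_derivative_iff_tendsto:
  "(f has_vector_derivative d) (at x within S) \<longleftrightarrow> ((\<lambda>y. (1 / (y - x)) *\<^sub>R (f y - f x)) \<longlongrightarrow> d) (at x within S)"
proof -
  have eq: "norm (f y - f x - (y - x) *\<^sub>R d) / norm (y - x) = norm ((1 / (y - x)) *\<^sub>R (f y - f x) - d)" if "y \<noteq> x" for y
  proof -
    have "(1 / (y - x)) *\<^sub>R (f y - f x) - d = (1 / (y - x)) *\<^sub>R (f y - f x - (y - x) *\<^sub>R d)"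
      using that by (simp add: scaleR_diff_right)
    then show ?thesis by (simp add: divide_inverse mult.commute)
  qed
  have "((\<lambda>y. norm (f y - f x - (y - x) *\<^sub>R d) / norm (y - x)) \<longlongrightarrow> 0) (at x within S) \<longleftrightarrow>
      ((\<lambda>y. norm ((1 / (y - x)) *\<^sub>R (f y - f x) - d)) \<longlongrightarrow> 0) (at x within S)"
    by (intro tendsto_cong) (simp only: eventually_at_filter, intro always_eventually allI impI eq)
  then show ?thesis
    by (simp add: has_vector_derivative_def has_derivative_iff_norm bounded_linear_scaleR_left
        tendsto_norm_zero_iff LIM_zero_iff)
qed

text \<open>The identity G y - G x = - G y (F y - F x) G x gives both absolute continuity and the
  derivative. The bound on \<open>G\<close> is a hypothesis because \<open>I\<close> is an arbitrary
  set, not a compact interval.\<close>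

lemma has_ae_derivative_on_inverse:
  fixes F G :: "real \<Rightarrow> 'h::real_normed_vector \<Rightarrow>\<^sub>L 'h"
  assumes F: "has_ae_derivative_on F f I" and G: "continuous_on I G"
    and bound: "\<And>x. x \<in> I \<Longrightarrow> norm (G x) \<le> M"
    and inv: "\<And>x. x \<in> I \<Longrightarrow> G x o\<^sub>L F x = id_blinfun" "\<And>x. x \<in> I \<Longrightarrow> F x o\<^sub>L G x = id_blinfun"
  shows "has_ae_derivative_on G (\<lambda>x. - (G x o\<^sub>L f x o\<^sub>L G x)) I"
proof -
  have bound: "norm (G x) \<le> \<bar>M\<bar>" if "x \<in> I" for x using bound [OF that] by linarith
  have diff: "G y - G x = - (G y o\<^sub>L (F y - F x) o\<^sub>L G x)" if "x \<in> I" "y \<in> I" for x y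
  proof -
    have "G y o\<^sub>L (F y - F x) o\<^sub>L G x = ((G y o\<^sub>L F y) o\<^sub>L G x) - (G y o\<^sub>L (F x o\<^sub>L G x))"
      by (intro blinfun_eqI) (simp add: blinfun.diff_left blinfun.diff_right)
    also have "\<dots> = G x - G y" using inv that by (intro blinfun_eqI) (simp add: blinfun.diff_left)
    finally show ?thesis by simp
  qed
  have prod: "norm (P o\<^sub>L Q o\<^sub>L R) \<le> norm P * norm Q * norm R" for P Q R :: "'h \<Rightarrow>\<^sub>L 'h"
    by (rule order_trans [OF norm_blinfun_compose]) (intro mult_right_mono norm_blinfun_compose norm_ge_zero)
  have "absolutely_continuous_on I G"
  proof (rule absolutely_continuous_on_compare [where F = F and G = F])
    fix s t assume st: "s \<in> I" "t \<in> I"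
    have "dist (G s) (G t) \<le> norm (G s) * norm (F s - F t) * norm (G t)"
      unfolding dist_norm diff [OF st(2,1)] norm_minus_cancel by (rule prod)
    also have "\<dots> \<le> \<bar>M\<bar> * norm (F s - F t) * \<bar>M\<bar>"
      using bound st by (intro mult_mono) auto
    finally show "dist (G s) (G t) \<le> (\<bar>M\<bar> * \<bar>M\<bar> / 2) * (dist (F s) (F t) + dist (F s) (F t))"
      by (simp add: dist_norm mult_ac)
  qed (use F in \<open>auto simp: has_ae_derivative_on_def\<close>)
  moreover have "AE x in lebesgue. x \<in> I \<longrightarrow> (G has_vector_derivative - (G x o\<^sub>L f x o\<^sub>L G x)) (at x within I)"
    using F [unfolded has_ae_derivative_on_def, THEN conjunct2]
  proof eventually_elim
    case (elim x)
    show ?case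
    proof
      assume x: "x \<in> I"
      with elim have der: "(F has_vector_derivative f x) (at x within I)" by simp
      have "((\<lambda>y. (1 / (y - x)) *\<^sub>R (F y - F x)) \<longlongrightarrow> f x) (at x within I)"
        using der by (simp only: has_vector_derivative_iff_tendsto)
      moreover have "(G \<longlongrightarrow> G x) (at x within I)"
        using G x by (simp add: continuous_on_def)
      ultimately have lim: "((\<lambda>y. - (G y o\<^sub>L ((1 / (y - x)) *\<^sub>R (F y - F x)) o\<^sub>L G x)) \<longlongrightarrow> - (G x o\<^sub>L f x o\<^sub>L G x)) (at x within I)"
        by (intro tendsto_intros bounded_bilinear.tendsto [OF bounded_bilinear_blinfun_compose])
      have eq: "- (G y o\<^sub>L ((1 / (y - x)) *\<^sub>R (F y - F x)) o\<^sub>L G x) = (1 / (y - x)) *\<^sub>R (G y - G x)" if "y \<in> I" for y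
        unfolding diff [OF x that] by (intro blinfun_eqI) (simp add: blinfun.scaleR_left blinfun.scaleR_right blinfun.diff_left blinfun.minus_left)
      have "((\<lambda>y. (1 / (y - x)) *\<^sub>R (G y - G x)) \<longlongrightarrow> - (G x o\<^sub>L f x o\<^sub>L G x)) (at x within I)"
        by (rule Lim_transform_eventually [OF lim]) (simp only: eventually_at_filter, intro always_eventually allI impI eq)
      then show "(G has_vector_derivative - (G x o\<^sub>L f x o\<^sub>L G x)) (at x within I)"
        by (simp only: has_vector_derivative_iff_tendsto)
    qed
  qed
  ultimately show ?thesis by (simp add: has_ae_derivative_on_def)
qed

section \<open>Linear differential equations with integrable coefficients\<close>

lemma strong_L1_real:
  fixes m :: "real \<Rightarrow> real"
  assumes "m absolutely_integrable_on {a..b}"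
  shows "strong_L1 a b m"
  using strong_L1.scaleR [OF assms continuous_on_const [of _ "1::real"]] by simp

text \<open>Repeated integration against \<open>m\<close> produces the terms of an exponential
  series in the integral of \<open>m\<close>; the Picard and Gronwall estimates below are read off
  from this.\<close>

lemma integral_mult_power_indefinite_integral:
  fixes m :: "real \<Rightarrow> real"
  assumes m: "m absolutely_integrable_on {a..b}" and x: "x \<in> {a..b}"
  shows "((\<lambda>t. m t * integral {a..t} m ^ n) has_integral integral {a..x} m ^ Suc n / Suc n) {a..x}"
proof -
  let ?\<kappa> = "\<lambda>t. integral {a..t} m"
  have \<kappa>: "has_ae_derivative_on ?\<kappa> m {a..b}"
    by (rule has_ae_derivative_on_indefinite_integral [OF strong_L1_real [OF m]])
  have "has_ae_derivative_on (\<lambda>t. ?\<kappa> t ^ Suc k) (\<lambda>t. Suc k * (m t * ?\<kappa> t ^ k)) {a..b}" for k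
  proof (induction k)
    case (Suc k)
    show ?case
      using has_ae_derivative_on_bilinear [OF bounded_bilinear_mult \<kappa> Suc] by (simp add: algebra_simps)
  qed (use \<kappa> in simp)
  from has_ae_derivative_on_eq_integral(1) [OF this x]
  have "((\<lambda>t. Suc n * (m t * ?\<kappa> t ^ n)) has_integral ?\<kappa> x ^ Suc n) {a..x}" by simp
  from has_integral_divide [OF this, of "real (Suc n)"] show ?thesis by simp
qed

text \<open>Picard iteration. With the integrable Lipschitz bound \<open>m\<close>, the n-th
  correction is at most C \<kappa>^n / n!, where \<kappa> is the integral of \<open>m\<close>; so
  the iterates converge uniformly on the whole interval, however large \<open>m\<close> is.\<close>

lemma linear_ode_exists:
  fixes K :: "real \<Rightarrow> 'b::banach \<Rightarrow> 'b"
  assumes K: "\<And>Y. continuous_on {a..b} Y \<Longrightarrow> strong_L1 a b (\<lambda>x. K x (Y x))"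
    and m: "m absolutely_integrable_on {a..b}" "\<And>x. 0 \<le> m x"
    and lip: "\<And>x y z. x \<in> {a..b} \<Longrightarrow> norm (K x y - K x z) \<le> m x * norm (y - z)"
  shows "\<exists>Y. continuous_on {a..b} Y \<and> (\<forall>x\<in>{a..b}. Y x = y0 + integral {a..x} (\<lambda>t. K t (Y t)))"
proof -
  define T where "T Y x = y0 + integral {a..x} (\<lambda>t. K t (Y t))" for Y x
  define P where "P n = (T ^^ n) (\<lambda>_. y0)" for n
  have P0: "P 0 = (\<lambda>_. y0)" and PSuc: "P (Suc n) = T (P n)" for n by (simp_all add: P_def)
  have Tcont: "continuous_on {a..b} (T Y)" if "continuous_on {a..b} Y" for Y
    unfolding T_def
    by (intro continuous_on_add continuous_on_const has_ae_derivative_on_imp_continuous_on [OF has_ae_derivative_on_indefinite_integral [OF K [OF that]]])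
  have Pcont: "continuous_on {a..b} (P n)" for n
    by (induction n) (simp_all add: P0 PSuc Tcont)
  have int: "(\<lambda>t. K t (Y t)) integrable_on {a..x}" if "continuous_on {a..b} Y" "x \<in> {a..b}" for Y x
    by (rule integrable_on_subinterval [OF strong_L1_integrable [OF K [OF that(1)]]]) (use that in auto)
  have mi: "m integrable_on {a..x}" if "x \<in> {a..b}" for x
    by (rule integrable_on_subinterval [OF set_lebesgue_integral_eq_integral(1) [OF m(1)]]) (use that in auto)
  let ?\<kappa> = "\<lambda>t. integral {a..t} m"
  have \<kappa>0: "?\<kappa> t \<ge> 0" if "t \<in> {a..b}" for t
    using mi [OF that] m(2) by (intro Henstock_Kurzweil_Integration.integral_nonneg) auto
  have \<kappa>mono: "?\<kappa> t \<le> ?\<kappa> b" if "t \<in> {a..b}" for t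
    using that mi [of b] mi [OF that] m(2) by (intro integral_subset_le) auto
  have Tdiff: "norm (T Y x - T Z x) \<le> B" 
    if "continuous_on {a..b} Y" "continuous_on {a..b} Z" "x \<in> {a..b}" 
      and d: "\<And>t. t \<in> {a..x} \<Longrightarrow> norm (Y t - Z t) \<le> d t" and B: "((\<lambda>t. m t * d t) has_integral B) {a..x}" for Y Z x B d
  proof -
    have "T Y x - T Z x = integral {a..x} (\<lambda>t. K t (Y t) - K t (Z t))"
      using that int by (simp add: T_def Henstock_Kurzweil_Integration.integral_diff)
    also have "norm \<dots> \<le> integral {a..x} (\<lambda>t. m t * d t)"
    proof (rule Henstock_Kurzweil_Integration.integral_norm_bound_integral)
      fix t assume t: "t \<in> {a..x}"
      then have "norm (K t (Y t) - K t (Z t)) \<le> m t * norm (Y t - Z t)" using that by (intro lip) auto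
      also have "\<dots> \<le> m t * d t" using d [OF t] m(2) by (intro mult_left_mono)
      finally show "norm (K t (Y t) - K t (Z t)) \<le> m t * d t" .
    qed (use that int B in \<open>auto intro: Henstock_Kurzweil_Integration.integrable_diff\<close>)
    also have "\<dots> = B" using B by (rule integral_unique)
    finally show ?thesis .
  qed
  obtain C where C: "C \<ge> 0" "\<forall>x\<in>{a..b}. norm (T (\<lambda>_. y0) x - y0) \<le> C"
    using continuous_on_interval_bounded [OF continuous_on_diff [OF Tcont [OF continuous_on_const] continuous_on_const]] by blast
  have step: "norm (P (Suc n) x - P n x) \<le> C * (?\<kappa> x ^ n / fact n)" if "x \<in> {a..b}" for n x
    using that
  proof (induction n arbitrary: x)
    case 0
    then show ?case using C by (simp add: P0 PSuc)
  next
    case (Suc n)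
    have "((\<lambda>t. C / fact n * (m t * ?\<kappa> t ^ n)) has_integral C / fact n * (?\<kappa> x ^ Suc n / Suc n)) {a..x}"
      by (intro has_integral_mult_right integral_mult_power_indefinite_integral [OF m(1) Suc.prems])
    then have B: "((\<lambda>t. m t * (C * (?\<kappa> t ^ n / fact n))) has_integral C * (?\<kappa> x ^ Suc n / fact (Suc n))) {a..x}"
      by (simp add: mult_ac)
    have "norm (T (P (Suc n)) x - T (P n) x) \<le> C * (?\<kappa> x ^ Suc n / fact (Suc n))"
      using Suc.prems by (intro Tdiff [OF Pcont Pcont _ _ B] Suc.IH) auto
    then show ?case by (simp only: PSuc)
  qed
  define Y where "Y x = y0 + (\<Sum>i. P (Suc i) x - P i x)" for x
  have "uniform_limit {a..b} (\<lambda>n x. \<Sum>i<n. P (Suc i) x - P i x) (\<lambda>x. \<Sum>i. P (Suc i) x - P i x) sequentially"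
  proof (rule Weierstrass_m_test)
    show "summable (\<lambda>n. C * (?\<kappa> b ^ n / fact n))"
      using summable_exp_generic [of "?\<kappa> b"] by (intro summable_mult) (simp add: divide_inverse_commute)
    fix n x assume x: "x \<in> {a..b}"
    have "C * (?\<kappa> x ^ n / fact n) \<le> C * (?\<kappa> b ^ n / fact n)"
      using C(1) \<kappa>0 \<kappa>mono x by (intro mult_left_mono divide_right_mono power_mono) auto
    with step [OF x] show "norm (P (Suc n) x - P n x) \<le> C * (?\<kappa> b ^ n / fact n)" by (rule order_trans)
  qed
  then have "uniform_limit {a..b} (\<lambda>n x. y0 + (\<Sum>i<n. P (Suc i) x - P i x)) Y sequentially"
    unfolding Y_def by (intro uniform_limit_add uniform_limit_const)
  moreover have "y0 + (\<Sum>i<n. P (Suc i) x - P i x) = P n x" for n x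
    using sum_lessThan_telescope [of "\<lambda>i. P i x" n] by (simp add: P0)
  ultimately have lim: "uniform_limit {a..b} P Y sequentially" by simp
  have Ycont: "continuous_on {a..b} Y"
    using uniform_limit_theorem [OF _ lim] Pcont by simp
  have "Y x = T Y x" if x: "x \<in> {a..b}" for x
  proof -
    have "(\<lambda>n. P (Suc n) x) \<longlonglongrightarrow> Y x"
      using tendsto_uniform_limitI [OF lim x] by (rule LIMSEQ_Suc)
    moreover have "(\<lambda>n. T (P n) x) \<longlonglongrightarrow> T Y x"
    proof (rule metric_LIMSEQ_I)
      fix e :: real assume "e > 0"
      \<comment> \<open>The integral operator multiplies a uniform error by at most
        \<open>?\<kappa> x\<close>; the summand 1 avoids a division by zero.\<close>
      define \<delta> where "\<delta> = e / (2 * (?\<kappa> x + 1))"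
      have "\<delta> > 0" using \<open>e > 0\<close> \<kappa>0 [OF x] by (simp add: \<delta>_def)
      from uniform_limitD [OF lim this]
      obtain N where N: "\<forall>n\<ge>N. \<forall>t\<in>{a..b}. dist (P n t) (Y t) < \<delta>"
        unfolding eventually_sequentially by blast
      have "dist (T (P n) x) (T Y x) < e" if "n \<ge> N" for n
      proof -
        have "norm (T (P n) x - T Y x) \<le> ?\<kappa> x * \<delta>"
        proof (rule Tdiff [OF Pcont Ycont x])
          show "norm (P n t - Y t) \<le> \<delta>" if "t \<in> {a..x}" for t
            using N \<open>n \<ge> N\<close> that x by (auto simp: dist_norm less_imp_le)
          show "((\<lambda>t. m t * \<delta>) has_integral ?\<kappa> x * \<delta>) {a..x}"
            using mi [OF x] by (intro has_integral_mult_left) (rule integrable_integral)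
        qed
        also have "\<dots> < e"
          using \<open>e > 0\<close> \<kappa>0 [OF x] by (simp add: \<delta>_def divide_simps)
        finally show ?thesis by (simp add: dist_norm)
      qed
      then show "\<exists>N. \<forall>n\<ge>N. dist (T (P n) x) (T Y x) < e" by blast
    qed
    ultimately show ?thesis unfolding PSuc by (rule LIMSEQ_unique)
  qed
  then show ?thesis using Ycont unfolding T_def by blast
qed

lemma linear_ode_solution:
  fixes K :: "real \<Rightarrow> 'b::banach \<Rightarrow> 'b"
  assumes K: "\<And>Y. continuous_on {a..b} Y \<Longrightarrow> strong_L1 a b (\<lambda>x. K x (Y x))"
    and m: "m absolutely_integrable_on {a..b}" "\<And>x. 0 \<le> m x"
    and lip: "\<And>x y z. x \<in> {a..b} \<Longrightarrow> norm (K x y - K x z) \<le> m x * norm (y - z)"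
    and "a \<le> b"
  shows "\<exists>Y. has_ae_derivative_on Y (\<lambda>t. K t (Y t)) {a..b} \<and> Y a = y0"
proof -
  obtain Y where Y: "continuous_on {a..b} Y" "\<forall>x\<in>{a..b}. Y x = y0 + integral {a..x} (\<lambda>t. K t (Y t))"
    using linear_ode_exists [of a b K m y0] assms by blast
  have "has_ae_derivative_on (\<lambda>x. y0 + integral {a..x} (\<lambda>t. K t (Y t))) (\<lambda>t. 0 + K t (Y t)) {a..b}"
    by (intro has_ae_derivative_on_add has_ae_derivative_on_const has_ae_derivative_on_indefinite_integral K Y)
  then have "has_ae_derivative_on Y (\<lambda>t. K t (Y t)) {a..b}"
    by (rule has_ae_derivative_on_cong) (simp_all add: Y(2))
  moreover have "Y a = y0" using Y(2) \<open>a \<le> b\<close> by auto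
  ultimately show ?thesis by blast
qed

section \<open>Operators on complex Hilbert spaces\<close>

lemma blinfun_compose_id [simp]: "T o\<^sub>L id_blinfun = T" "id_blinfun o\<^sub>L T = T"
  by (intro blinfun_eqI; simp)+

lemma blinfun_compose_assoc: "(R o\<^sub>L S) o\<^sub>L T = R o\<^sub>L (S o\<^sub>L T)"
  by (intro blinfun_eqI) simp

lemma scaleC_zero_left [simp]: "0 *\<^sub>C x = (0 :: 'a::complex_hilbert)"
  using scaleC_of_real [of 0 x] by simp

lemma scaleC_one [simp]: "1 *\<^sub>C x = (x :: 'a::complex_hilbert)"
  using scaleC_of_real [of 1 x] by simp

lemma scaleC_minus_left: "(- c) *\<^sub>C x = - (c *\<^sub>C x)" for x :: "'a::complex_hilbert"
  using scaleC_add_left [of c "- c" x] by (simp add: eq_neg_iff_add_eq_0 add.commute)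

lemma cinner_zero_left [simp]: "cinner 0 y = 0" for y :: "'a::complex_hilbert"
  using cinner_scaleC_left [of 0 0 y] by simp

lemma cinner_minus_left: "cinner (- x) y = - cinner x y" for y :: "'a::complex_hilbert"
  using cinner_add_left [of x "- x" y] by (simp add: eq_neg_iff_add_eq_0 add.commute)

lemma cinner_diff_left: "cinner (x - z) y = cinner x y - cinner z y" for y :: "'a::complex_hilbert"
  using cinner_add_left [of x "- z" y] by (simp add: cinner_minus_left)

lemma cinner_add_right: "cinner x (y + z) = cinner x y + cinner x z" for y :: "'a::complex_hilbert"
  by (metis cinner_add_left cinner_commute complex_cnj_add)

lemma cinner_scaleC_right: "cinner x (c *\<^sub>C y) = cnj c * cinner x y" for y :: "'a::complex_hilbert"
  by (metis cinner_commute cinner_scaleC_left complex_cnj_mult)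

lemma cinner_zero_right [simp]: "cinner y 0 = 0" for y :: "'a::complex_hilbert"
  by (metis cinner_commute cinner_zero_left complex_cnj_zero)

lemma cinner_minus_right: "cinner x (- y) = - cinner x y" for y :: "'a::complex_hilbert"
  by (metis cinner_commute cinner_minus_left complex_cnj_minus)

lemma cinner_diff_right: "cinner x (y - z) = cinner x y - cinner x z" for y :: "'a::complex_hilbert"
  by (metis cinner_commute cinner_diff_left complex_cnj_diff)

lemma cinner_scaleR_left: "cinner (r *\<^sub>R x) y = of_real r * cinner x y" for y :: "'a::complex_hilbert"
  by (metis cinner_scaleC_left scaleC_of_real)

lemma cinner_scaleR_right: "cinner x (r *\<^sub>R y) = of_real r * cinner x y" for y :: "'a::complex_hilbert"
  by (metis cinner_scaleC_right scaleC_of_real complex_cnj_complex_of_real)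

lemma cinner_sum_left: "cinner (\<Sum>i\<in>I. f i) y = (\<Sum>i\<in>I. cinner (f i) y)" for y :: "'a::complex_hilbert"
  by (induction I rule: infinite_finite_induct) (auto simp: cinner_add_left)

lemma cinner_sum_right: "cinner y (\<Sum>i\<in>I. f i) = (\<Sum>i\<in>I. cinner y (f i))" for y :: "'a::complex_hilbert"
  by (induction I rule: infinite_finite_induct) (auto simp: cinner_add_right)

lemma cinner_self: "cinner x x = of_real ((norm x)\<^sup>2)" for x :: "'a::complex_hilbert"
proof -
  have "Im (cinner x x) = 0"
    using cinner_commute [of x x] by (metis complex_cnj_cancel_iff Reals_cnj_iff complex_is_Real_iff)
  then show ?thesis
    using inner_eq_Re_cinner [of x x] by (simp add: complex_eq_iff power2_norm_eq_inner)
qed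

lemma norm_scaleC [simp]: "norm (c *\<^sub>C x) = cmod c * norm x" for x :: "'a::complex_hilbert"
proof -
  have "complex_of_real ((norm (c *\<^sub>C x))\<^sup>2) = of_real ((cmod c * norm x)\<^sup>2)"
    unfolding cinner_self [symmetric] cinner_scaleC_left cinner_scaleC_right
    by (simp add: cinner_self power_mult_distrib) (metis complex_norm_square mult.commute of_real_power)
  then show ?thesis
    by (metis norm_ge_zero mult_nonneg_nonneg of_real_eq_iff power2_eq_imp_eq)
qed

lemma cinner_eqI: "(\<And>z. cinner x z = cinner y z) \<Longrightarrow> x = y" for x :: "'a::complex_hilbert"
  by (metis cinner_diff_left cinner_self eq_iff_diff_eq_0 of_real_eq_0_iff zero_eq_power2 norm_eq_zero)

text \<open>A unimodular factor rotates \<open>cinner x y\<close> onto its modulus, which reduces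
  the claim to the real Cauchy-Schwarz inequality.\<close>

lemma cmod_cinner_le: "cmod (cinner x y) \<le> norm x * norm y" for x :: "'a::complex_hilbert"
proof (cases "cinner x y = 0")
  case False
  define u where "u = cnj (sgn (cinner x y))"
  have "cmod u = 1" using False by (simp add: u_def norm_sgn)
  have "u * cinner x y = of_real (cmod (cinner x y))"
    by (simp add: u_def sgn_div_norm scaleR_conv_of_real complex_norm_square [symmetric] mult.commute [of "cnj _"] power2_eq_square field_simps)
  then have "cmod (cinner x y) = inner (u *\<^sub>C x) y"
    by (simp add: inner_eq_Re_cinner cinner_scaleC_left)
  also have "\<dots> \<le> norm (u *\<^sub>C x) * norm y" by (rule norm_cauchy_schwarz)
  finally show ?thesis using \<open>cmod u = 1\<close> by simp
qed simp

lemma scaleC_scaleR: "c *\<^sub>C (r *\<^sub>R x) = r *\<^sub>R (c *\<^sub>C x)" for x :: "'a::complex_hilbert"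
  by (metis mult.commute scaleC_of_real scaleC_scaleC)

lemma bounded_bilinear_scaleC: "bounded_bilinear (\<lambda>c (x::'a::complex_hilbert). c *\<^sub>C x)"
proof
  show "(r *\<^sub>R c) *\<^sub>C x = r *\<^sub>R (c *\<^sub>C x)" for r c and x :: 'a
    by (metis scaleC_of_real scaleC_scaleC scaleR_conv_of_real)
  show "\<exists>K. \<forall>c (x::'a). norm (c *\<^sub>C x) \<le> norm c * norm x * K" by (rule exI [of _ 1]) simp
qed (auto simp: scaleC_add_left scaleC_add_right scaleC_scaleR)

lemma bounded_bilinear_cinner: "bounded_bilinear (cinner :: 'a::complex_hilbert \<Rightarrow> 'a \<Rightarrow> complex)"
proof
  show "\<exists>K. \<forall>(x::'a) y. norm (cinner x y) \<le> norm x * norm y * K"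
    by (intro exI [of _ 1]) (simp add: cmod_cinner_le)
qed (auto simp: cinner_add_left cinner_add_right cinner_scaleR_left cinner_scaleR_right scaleR_conv_of_real)

lemma scalar_op_apply [simp]: "blinfun_apply (scalar_op c) u = c *\<^sub>C u"
  unfolding scalar_op_def
  by (simp add: bounded_linear_Blinfun_apply bounded_bilinear.bounded_linear_right [OF bounded_bilinear_scaleC])

lemma norm_blinfun_le_cinner:
  fixes T :: "'a::real_normed_vector \<Rightarrow>\<^sub>L 'b::complex_hilbert"
  assumes "0 \<le> M" "\<And>u v. cmod (cinner (T u) v) \<le> M * norm u * norm v"
  shows "norm T \<le> M"
proof (rule norm_blinfun_bound [OF assms(1)])
  fix u
  show "norm (T u) \<le> M * norm u"
  proof (cases "T u = 0")
    case False
    have "norm (T u) * norm (T u) \<le> (M * norm u) * norm (T u)"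
      using assms(2) [of u "T u"] by (simp add: cinner_self power2_eq_square norm_mult)
    then show ?thesis using False by simp
  qed (use assms(1) in simp)
qed

lemma norm_scalar_op_le: "norm (scalar_op c :: 'a::complex_hilbert \<Rightarrow>\<^sub>L 'a) \<le> cmod c"
  by (rule norm_blinfun_bound) auto

text \<open>\<open>adj\<close> is a definite description and carries information only once an
  adjoint has been exhibited. This relation always names one, so adjoints on the state space are
  computed explicitly and translated into \<open>adj\<close> at the end.\<close>

definition is_adj :: "('a::complex_hilbert \<Rightarrow>\<^sub>L 'b::complex_hilbert) \<Rightarrow> ('b \<Rightarrow>\<^sub>L 'a) \<Rightarrow> bool"
  where "is_adj T T' \<longleftrightarrow> (\<forall>u v. cinner (T u) v = cinner u (T' v))"

lemma is_adjD: "is_adj T T' \<Longrightarrow> cinner (T u) v = cinner u (T' v)"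
  by (simp add: is_adj_def)

lemma is_adj_sym: "is_adj T T' \<Longrightarrow> is_adj T' T"
  unfolding is_adj_def by (metis cinner_commute)

lemma is_adj_unique: "is_adj T T1 \<Longrightarrow> is_adj T T2 \<Longrightarrow> T1 = T2"
  by (rule blinfun_eqI, rule cinner_eqI) (metis is_adj_sym is_adjD)

lemma is_adj_imp_adj: "is_adj T T' \<Longrightarrow> adj T = T'"
  unfolding adj_def is_adj_def [symmetric] by (rule the_equality) (auto intro: is_adj_unique)

text \<open>The complex inner product sees the scalar, so possession of an adjoint forces complex
  linearity; many linearity facts below are obtained in this way.\<close>

lemma is_adj_complex_linear: "is_adj T T' \<Longrightarrow> complex_linear T"
  unfolding complex_linear_def by (intro allI, rule cinner_eqI) (simp add: is_adjD cinner_scaleC_left)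

lemma is_adj_compose: "is_adj S S' \<Longrightarrow> is_adj T T' \<Longrightarrow> is_adj (S o\<^sub>L T) (T' o\<^sub>L S')"
  by (simp add: is_adj_def)

lemma is_adj_add: "is_adj S S' \<Longrightarrow> is_adj T T' \<Longrightarrow> is_adj (S + T) (S' + T')"
  by (simp add: is_adj_def blinfun.add_left cinner_add_left cinner_add_right)

lemma is_adj_diff: "is_adj S S' \<Longrightarrow> is_adj T T' \<Longrightarrow> is_adj (S - T) (S' - T')"
  by (simp add: is_adj_def blinfun.diff_left cinner_diff_left cinner_diff_right)

lemma is_adj_minus: "is_adj S S' \<Longrightarrow> is_adj (- S) (- S')"
  by (simp add: is_adj_def blinfun.minus_left cinner_minus_left cinner_minus_right)

lemma is_adj_scaleR: "is_adj S S' \<Longrightarrow> is_adj (r *\<^sub>R S) (r *\<^sub>R S')"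
  by (simp add: is_adj_def blinfun.scaleR_left cinner_scaleR_left cinner_scaleR_right)

lemma is_adj_id: "is_adj id_blinfun id_blinfun"
  by (simp add: is_adj_def)

lemma is_adj_scalar_op: "is_adj (scalar_op c) (scalar_op (cnj c))"
  by (simp add: is_adj_def cinner_scaleC_left cinner_scaleC_right)

lemma complex_linearD: "complex_linear T \<Longrightarrow> T (c *\<^sub>C u) = c *\<^sub>C T u"
  by (simp add: complex_linear_def)

lemma complex_linear_compose: "complex_linear S \<Longrightarrow> complex_linear T \<Longrightarrow> complex_linear (S o\<^sub>L T)"
  by (simp add: complex_linear_def)

lemma op_inverse_eq:
  assumes "T' o\<^sub>L T = id_blinfun" "T o\<^sub>L T' = id_blinfun"
  shows "op_inverse T = T'" "op_invertible T"
proof -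
  have uniq: "R = T'" if "R o\<^sub>L T = id_blinfun" for R
  proof (rule blinfun_eqI)
    fix i
    have "R i = (R o\<^sub>L T) (T' i)" using arg_cong [OF assms(2), of "\<lambda>F. blinfun_apply F i"] by simp
    then show "R i = T' i" using that by simp
  qed
  show "op_inverse T = T'"
    unfolding op_inverse_def by (rule the_equality) (use assms in simp, rule uniq, erule conjunct1)
  show "op_invertible T" unfolding op_invertible_def using assms by (intro exI conjI)
qed

lemma op_inverse_compose:
  assumes "op_invertible T"
  shows "op_inverse T o\<^sub>L T = id_blinfun" "T o\<^sub>L op_inverse T = id_blinfun"
  using assms op_inverse_eq(1) unfolding op_invertible_def by blast+

lemma op_inverse_apply:
  assumes "op_invertible T"
  shows "op_inverse T (T u) = u" "T (op_inverse T u) = u"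
  using op_inverse_compose [OF assms, THEN arg_cong, of "\<lambda>F. blinfun_apply F u"] by simp_all

lemma is_adj_op_inverse:
  assumes "is_adj T T'" "op_invertible T" "op_invertible T'"
  shows "is_adj (op_inverse T) (op_inverse T')"
  unfolding is_adj_def
proof (intro allI)
  fix u v
  have "cinner (op_inverse T u) v = cinner (op_inverse T u) (T' (op_inverse T' v))"
    by (simp add: op_inverse_apply assms)
  also have "\<dots> = cinner u (op_inverse T' v)"
    by (simp only: is_adjD [OF assms(1), symmetric] op_inverse_apply(2) [OF assms(2)])
  finally show "cinner (op_inverse T u) v = cinner u (op_inverse T' v)" .
qed

section \<open>Neumann series, inverses and resolvents\<close>

primrec blinfun_power :: "('h::real_normed_vector \<Rightarrow>\<^sub>L 'h) \<Rightarrow> nat \<Rightarrow> 'h \<Rightarrow>\<^sub>L 'h" where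
  "blinfun_power K 0 = id_blinfun"
| "blinfun_power K (Suc n) = K o\<^sub>L blinfun_power K n"

lemma blinfun_power_commute: "blinfun_power K n o\<^sub>L K = K o\<^sub>L blinfun_power K n"
  by (induction n) (simp_all add: blinfun_compose_assoc)

lemma norm_blinfun_power_le: "norm (blinfun_power K n) \<le> norm K ^ n"
proof (induction n)
  case 0
  show ?case by (simp add: norm_blinfun_id_le)
next
  case (Suc n)
  have "norm (K o\<^sub>L blinfun_power K n) \<le> norm K * norm (blinfun_power K n)" by (rule norm_blinfun_compose)
  also have "\<dots> \<le> norm K * norm K ^ n" by (intro mult_left_mono Suc) simp
  finally show ?case by simp
qed

lemma neumann_series:
  fixes K :: "'h::banach \<Rightarrow>\<^sub>L 'h"
  assumes "norm K < 1"
  shows "summable (blinfun_power K)"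
    "(\<Sum>n. blinfun_power K n) o\<^sub>L (id_blinfun - K) = id_blinfun"
    "(id_blinfun - K) o\<^sub>L (\<Sum>n. blinfun_power K n) = id_blinfun"
    "norm (\<Sum>n. blinfun_power K n) \<le> 1 / (1 - norm K)"
proof -
  have sn: "summable (\<lambda>n. norm (blinfun_power K n))"
    by (rule summable_comparison_test' [OF summable_geometric [of "norm K"]]) (use assms norm_blinfun_power_le in auto)
  then show s: "summable (blinfun_power K)" by (rule summable_norm_cancel)
  have "(\<Sum>n. blinfun_power K n) = id_blinfun + (\<Sum>n. blinfun_power K (Suc n))"
    using suminf_split_head [OF s] by simp
  moreover have "(\<Sum>n. blinfun_power K (Suc n)) = K o\<^sub>L (\<Sum>n. blinfun_power K n)"
    using bounded_linear.suminf [OF bounded_bilinear.bounded_linear_right [OF bounded_bilinear_blinfun_compose] s, of K] by simp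
  moreover have "(\<Sum>n. blinfun_power K (Suc n)) = (\<Sum>n. blinfun_power K n) o\<^sub>L K"
    using bounded_linear.suminf [OF bounded_bilinear.bounded_linear_left [OF bounded_bilinear_blinfun_compose] s, of K]
    by (simp add: blinfun_power_commute)
  ultimately have eq: "(\<Sum>n. blinfun_power K n) - (K o\<^sub>L (\<Sum>n. blinfun_power K n)) = id_blinfun"
    "(\<Sum>n. blinfun_power K n) - ((\<Sum>n. blinfun_power K n) o\<^sub>L K) = id_blinfun"
    by (simp_all add: algebra_simps)
  show "(\<Sum>n. blinfun_power K n) o\<^sub>L (id_blinfun - K) = id_blinfun"
    using eq(2) by (simp add: bounded_bilinear.diff_right [OF bounded_bilinear_blinfun_compose])
  show "(id_blinfun - K) o\<^sub>L (\<Sum>n. blinfun_power K n) = id_blinfun"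
    using eq(1) by (simp add: bounded_bilinear.diff_left [OF bounded_bilinear_blinfun_compose])
  have "norm (\<Sum>n. blinfun_power K n) \<le> (\<Sum>n. norm (blinfun_power K n))" by (rule summable_norm [OF sn])
  also have "\<dots> \<le> (\<Sum>n. norm K ^ n)"
    using assms by (intro suminf_le norm_blinfun_power_le sn summable_geometric) auto
  also have "\<dots> = 1 / (1 - norm K)" using assms by (simp add: suminf_geometric)
  finally show "norm (\<Sum>n. blinfun_power K n) \<le> 1 / (1 - norm K)" .
qed

text \<open>T = T0 (I - K) with |K| \<le> 1/2; the Neumann series of K is then bounded by 2, which
  is the factor in the norm estimate.\<close>

lemma op_invertible_perturbation:
  fixes T T0 :: "'h::complex_hilbert \<Rightarrow>\<^sub>L 'h"
  assumes T0: "op_invertible T0" and small: "norm (T - T0) * norm (op_inverse T0) \<le> 1/2"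
  shows "op_invertible T" "norm (op_inverse T) \<le> 2 * norm (op_inverse T0)"
proof -
  define K where "K = op_inverse T0 o\<^sub>L (T0 - T)"
  have "norm K \<le> norm (op_inverse T0) * norm (T0 - T)" unfolding K_def by (rule norm_blinfun_compose)
  then have K: "norm K \<le> 1/2" using small by (simp add: norm_minus_commute mult.commute)
  then have "norm K < 1" by simp
  note N = neumann_series [OF this]
  define G where "G = (\<Sum>n. blinfun_power K n)"
  have TT: "T = T0 o\<^sub>L (id_blinfun - K)"
    by (intro blinfun_eqI) (simp add: K_def blinfun.diff_left blinfun.diff_right op_inverse_apply [OF T0])
  have "(G o\<^sub>L op_inverse T0) o\<^sub>L T = id_blinfun"
  proof (rule blinfun_eqI)
    fix i
    have "(G o\<^sub>L op_inverse T0 o\<^sub>L T) i = (G o\<^sub>L (id_blinfun - K)) i"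
      unfolding TT by (simp add: op_inverse_apply [OF T0])
    then show "(G o\<^sub>L op_inverse T0 o\<^sub>L T) i = id_blinfun i" using N(2) by (simp add: G_def)
  qed
  moreover have "T o\<^sub>L (G o\<^sub>L op_inverse T0) = id_blinfun"
  proof (rule blinfun_eqI)
    fix i
    have "(T o\<^sub>L (G o\<^sub>L op_inverse T0)) i = T0 (((id_blinfun - K) o\<^sub>L G) (op_inverse T0 i))"
      unfolding TT by simp
    then show "(T o\<^sub>L (G o\<^sub>L op_inverse T0)) i = id_blinfun i"
      using N(3) by (simp add: G_def op_inverse_apply [OF T0])
  qed
  ultimately have inv: "op_inverse T = G o\<^sub>L op_inverse T0" "op_invertible T" using op_inverse_eq by blast+
  show "op_invertible T" by fact
  have "norm G \<le> 2"
  proof -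
    have "norm G \<le> 1 / (1 - norm K)" using N(4) by (simp add: G_def)
    also have "\<dots> \<le> 2" using K by (simp add: divide_simps)
    finally show ?thesis .
  qed
  then show "norm (op_inverse T) \<le> 2 * norm (op_inverse T0)"
    unfolding inv(1) by (intro order_trans [OF norm_blinfun_compose] mult_right_mono) auto
qed

lemma continuous_on_op_inverse:
  fixes F :: "'x::metric_space \<Rightarrow> 'h::complex_hilbert \<Rightarrow>\<^sub>L 'h"
  assumes F: "continuous_on S F" and inv: "\<And>x. x \<in> S \<Longrightarrow> op_invertible (F x)"
  shows "continuous_on S (\<lambda>x. op_inverse (F x))"
  unfolding continuous_on_iff
proof (intro ballI allI impI)
  fix x and e :: real assume x: "x \<in> S" and "e > 0"
  define c where "c = norm (op_inverse (F x)) + 1"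
  \<comment> \<open>The first term keeps the norm of the inverse at \<open>y\<close> below 2 c by
    perturbation; the second pays for the product of the two inverses in the identity for their
    difference.\<close>
  define \<delta> where "\<delta> = min (1 / (2 * c)) (e / (2 * c * c))"
  have c: "c > 0" "norm (op_inverse (F x)) < c" by (simp_all add: c_def add_nonneg_pos)
  then have "\<delta> > 0" using \<open>e > 0\<close> by (simp add: \<delta>_def)
  then obtain d where d: "d > 0" "\<forall>y\<in>S. dist y x < d \<longrightarrow> dist (F y) (F x) < \<delta>"
    using F x unfolding continuous_on_iff by blast
  have "dist (op_inverse (F y)) (op_inverse (F x)) < e" if y: "y \<in> S" "dist y x < d" for y
  proof -
    let ?G = "\<lambda>x. op_inverse (F x)"
    have close: "norm (F y - F x) < \<delta>" using d(2) y by (simp add: dist_norm)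
    have "norm (F y - F x) * norm (?G x) \<le> (1 / (2 * c)) * c"
      using close c by (intro mult_mono) (auto simp: \<delta>_def)
    then have "norm (?G y) \<le> 2 * norm (?G x)"
      using c by (intro op_invertible_perturbation(2) inv x) simp
    then have Gy: "norm (?G y) < 2 * c" using c by linarith
    have "?G y - ?G x = - (?G y o\<^sub>L (F y - F x) o\<^sub>L ?G x)"
      by (intro blinfun_eqI) (simp add: blinfun.diff_left blinfun.diff_right blinfun.minus_left op_inverse_apply inv x y)
    then have "norm (?G y - ?G x) \<le> norm (?G y) * norm (F y - F x) * norm (?G x)"
      by (simp add: order_trans [OF norm_blinfun_compose] mult_right_mono norm_blinfun_compose)
    also have "\<dots> \<le> (2 * c) * norm (F y - F x) * c"
      using Gy c by (intro mult_mono) auto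
    also have "\<dots> < (2 * c) * (e / (2 * c * c)) * c"
      using close c by (intro mult_strict_right_mono mult_strict_left_mono) (auto simp: \<delta>_def)
    also have "\<dots> = e" using c by simp
    finally show ?thesis by (simp add: dist_norm)
  qed
  then show "\<exists>d>0. \<forall>y\<in>S. dist y x < d \<longrightarrow> dist (op_inverse (F y)) (op_inverse (F x)) < e" using d(1) by blast
qed

text \<open>Geometric series for (1/l) A. Complex linearity of \<open>A\<close> collects the scalars
  into powers of 1/l and lets them commute with the sum, which makes the result a two-sided
  inverse.\<close>

lemma resolvent_series:
  fixes A :: "'h::complex_hilbert \<Rightarrow>\<^sub>L 'h"
  assumes A: "complex_linear A" and l: "norm A < cmod l"
  shows "op_invertible (scalar_op l - A)"
    "(\<lambda>n. (1 / l ^ Suc n) *\<^sub>C blinfun_power A n v) sums op_inverse (scalar_op l - A) v"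
    "norm (op_inverse (scalar_op l - A)) \<le> 1 / (cmod l - norm A)"
proof -
  have "l \<noteq> 0" using l norm_ge_zero [of A] by auto
  define K where "K = scalar_op (1/l) o\<^sub>L A"
  have "norm K \<le> norm A / cmod l"
    unfolding K_def by (rule order_trans [OF norm_blinfun_compose])
      (use mult_right_mono [OF norm_scalar_op_le [of "1/l"], of "norm A"] in \<open>simp add: norm_divide\<close>)
  moreover have "norm A / cmod l < 1" using l norm_ge_zero [of A] by (simp add: divide_simps)
  ultimately have K: "norm K < 1" by simp
  note N = neumann_series [OF K]
  define G where "G = (\<Sum>n. blinfun_power K n)"
  have pow: "blinfun_power K n v = (1 / l ^ n) *\<^sub>C blinfun_power A n v" for n v
    by (induction n arbitrary: v) (simp_all add: K_def complex_linearD [OF A] scaleC_scaleC mult.commute)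
  have cl: "G (c *\<^sub>C u) = c *\<^sub>C G u" for c u
  proof -
    have "blinfun_power A n (c *\<^sub>C u) = c *\<^sub>C blinfun_power A n u" for n
      by (induction n) (simp_all add: complex_linearD [OF A])
    then have P: "blinfun_power K n (c *\<^sub>C u) = c *\<^sub>C blinfun_power K n u" for n
      by (simp add: pow scaleC_scaleC mult.commute)
    have s: "(\<lambda>n. blinfun_power K n w) sums G w" for w
      unfolding G_def by (rule bounded_linear.sums [OF bounded_linear_apply_blinfun]) (use N(1) in \<open>auto intro: summable_sums\<close>)
    have "(\<lambda>n. c *\<^sub>C blinfun_power K n u) sums (c *\<^sub>C G u)"
      by (rule bounded_linear.sums [OF bounded_bilinear.bounded_linear_right [OF bounded_bilinear_scaleC] s])
    with s [of "c *\<^sub>C u"] show ?thesis by (simp add: P sums_unique2)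
  qed
  have lA: "(scalar_op l - A) u = l *\<^sub>C (id_blinfun - K) u" for u
    using \<open>l \<noteq> 0\<close> by (simp add: K_def blinfun.diff_left scaleC_scaleC bounded_bilinear.diff_right [OF bounded_bilinear_scaleC])
  have GK: "G ((id_blinfun - K) u) = u" "(id_blinfun - K) (G u) = u" for u
    using N(2,3) [THEN arg_cong, of "\<lambda>F. blinfun_apply F u"] by (simp_all add: G_def)
  have inv: "op_inverse (scalar_op l - A) = scalar_op (1/l) o\<^sub>L G" "op_invertible (scalar_op l - A)"
  proof -
    have "(scalar_op (1/l) o\<^sub>L G) o\<^sub>L (scalar_op l - A) = id_blinfun"
      using \<open>l \<noteq> 0\<close> by (intro blinfun_eqI) (simp add: lA cl GK scaleC_scaleC)
    moreover have "(scalar_op l - A) o\<^sub>L (scalar_op (1/l) o\<^sub>L G) = id_blinfun"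
      using \<open>l \<noteq> 0\<close> by (intro blinfun_eqI) (simp add: lA cl [symmetric] GK scaleC_scaleC)
    ultimately show "op_inverse (scalar_op l - A) = scalar_op (1/l) o\<^sub>L G" "op_invertible (scalar_op l - A)"
      using op_inverse_eq by blast+
  qed
  show "op_invertible (scalar_op l - A)" by (rule inv)
  have "(\<lambda>n. blinfun_power K n v) sums G v"
    unfolding G_def by (rule bounded_linear.sums [OF bounded_linear_apply_blinfun]) (use N(1) in \<open>auto intro: summable_sums\<close>)
  then have "(\<lambda>n. (1/l) *\<^sub>C blinfun_power K n v) sums ((1/l) *\<^sub>C G v)"
    by (rule bounded_linear.sums [OF bounded_bilinear.bounded_linear_right [OF bounded_bilinear_scaleC]])
  then show "(\<lambda>n. (1 / l ^ Suc n) *\<^sub>C blinfun_power A n v) sums op_inverse (scalar_op l - A) v"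
    by (simp add: inv(1) pow scaleC_scaleC)
  have "norm (op_inverse (scalar_op l - A)) \<le> cmod (1/l) * norm G"
    unfolding inv by (intro order_trans [OF norm_blinfun_compose] mult_right_mono norm_scalar_op_le) simp
  also have "\<dots> \<le> cmod (1/l) * (1 / (1 - norm K))"
    using N(4) by (intro mult_left_mono) (auto simp: G_def)
  also have "\<dots> \<le> cmod (1/l) * (1 / (1 - norm A / cmod l))"
    using \<open>norm K \<le> norm A / cmod l\<close> \<open>norm A / cmod l < 1\<close> by (intro mult_left_mono divide_left_mono mult_pos_pos) auto
  also have "\<dots> = 1 / (cmod l - norm A)" using \<open>l \<noteq> 0\<close> l by (simp add: norm_divide field_simps)
  finally show "norm (op_inverse (scalar_op l - A)) \<le> 1 / (cmod l - norm A)" .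
qed

section \<open>Finite-dimensional spaces and functions holomorphic near infinity\<close>

text \<open>\<open>Basis\<close> is orthonormal over the reals. The real parts of the coefficients
  reproduce \<open>u\<close>; the imaginary parts reproduce - i u, and the remaining factor i turns
  this into \<open>u\<close> once more.\<close>

lemma Basis_tight_frame:
  fixes u :: "'e::{complex_hilbert, euclidean_space}"
  shows "(\<Sum>b\<in>Basis. cinner u b *\<^sub>C b) = 2 *\<^sub>R u"
proof -
  have "cinner u b *\<^sub>C b = (u \<bullet> b) *\<^sub>R b + \<i> *\<^sub>C (((- \<i>) *\<^sub>C u) \<bullet> b) *\<^sub>R b" for b :: 'e
  proof -
    have "cinner u b = of_real (u \<bullet> b) + \<i> * of_real (((- \<i>) *\<^sub>C u) \<bullet> b)"
      by (simp add: inner_eq_Re_cinner cinner_scaleC_left complex_eq_iff)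
    then show ?thesis by (simp add: scaleC_add_left scaleC_of_real flip: scaleC_scaleC)
  qed
  then have "(\<Sum>b\<in>Basis. cinner u b *\<^sub>C b) = (\<Sum>b\<in>Basis. (u \<bullet> b) *\<^sub>R b) + (\<Sum>b\<in>Basis. \<i> *\<^sub>C (((- \<i>) *\<^sub>C u) \<bullet> b) *\<^sub>R b)"
    by (simp only: sum.distrib)
  also have "(\<Sum>b\<in>Basis. \<i> *\<^sub>C (((- \<i>) *\<^sub>C u) \<bullet> b) *\<^sub>R b) = \<i> *\<^sub>C (\<Sum>b\<in>Basis. (((- \<i>) *\<^sub>C u) \<bullet> b) *\<^sub>R b)"
    by (simp only: bounded_bilinear.sum_right [OF bounded_bilinear_scaleC])
  finally show ?thesis
    by (simp add: euclidean_representation scaleC_scaleC scaleR_2)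
qed

text \<open>The real basis consists of twice as many vectors as the complex dimension, whence the factor \<open>1/2\<close>.\<close>

definition fadj :: "('e::{complex_hilbert, euclidean_space} \<Rightarrow>\<^sub>L 'h::complex_hilbert) \<Rightarrow> 'h \<Rightarrow>\<^sub>L 'e"
  where "fadj T = Blinfun (\<lambda>h. (1/2) *\<^sub>R (\<Sum>b\<in>Basis. cinner h (T b) *\<^sub>C b))"

lemma fadj_apply: "fadj T h = (1/2) *\<^sub>R (\<Sum>b\<in>Basis. cinner h (T b) *\<^sub>C b)"
proof -
  have "bounded_linear (\<lambda>h. (1/2) *\<^sub>R (\<Sum>b\<in>Basis. cinner h (T b) *\<^sub>C b))"
    by (intro bounded_linear_intros bounded_linear_compose [OF bounded_bilinear.bounded_linear_left [OF bounded_bilinear_scaleC]]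
        bounded_bilinear.bounded_linear_left [OF bounded_bilinear_cinner])
  then show ?thesis by (simp add: fadj_def bounded_linear_Blinfun_apply)
qed

lemma is_adj_fadj:
  fixes T :: "'e::{complex_hilbert, euclidean_space} \<Rightarrow>\<^sub>L 'h::complex_hilbert"
  assumes "complex_linear T"
  shows "is_adj T (fadj T)"
  unfolding is_adj_def
proof (intro allI)
  fix u v
  have "2 * cinner (T u) v = cinner (T (\<Sum>b\<in>Basis. cinner u b *\<^sub>C b)) v"
    by (simp add: Basis_tight_frame blinfun.scaleR_right cinner_scaleR_left)
  also have "\<dots> = (\<Sum>b\<in>Basis. cinner u b * cinner (T b) v)"
    by (simp add: blinfun.sum_right cinner_sum_left complex_linearD [OF assms] cinner_scaleC_left)
  also have "\<dots> = 2 * cinner u (fadj T v)"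
    by (simp add: fadj_apply cinner_scaleR_right cinner_sum_right cinner_scaleC_right cinner_commute [of v] mult.commute)
  finally show "cinner (T u) v = cinner u (fadj T v)" by simp
qed

lemma adj_eq_fadj:
  fixes T :: "'e::{complex_hilbert, euclidean_space} \<Rightarrow>\<^sub>L 'h::complex_hilbert"
  shows "complex_linear T \<Longrightarrow> adj T = fadj T"
  by (rule is_adj_imp_adj [OF is_adj_fadj])

text \<open>Unlike \<open>adj\<close>, this formula is total and real linear in the operator, so it
  can be applied to derivatives and to integrable functions without first checking complex
  linearity.\<close>

lemma bounded_linear_fadj: "bounded_linear (fadj :: ('e::{complex_hilbert, euclidean_space} \<Rightarrow>\<^sub>L 'h::complex_hilbert) \<Rightarrow> _)"
proof (rule bounded_linear_intro)
  fix S T :: "'e \<Rightarrow>\<^sub>L 'h" and r :: real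
  show "fadj (S + T) = fadj S + fadj T"
    by (intro blinfun_eqI) (simp add: fadj_apply blinfun.add_left cinner_add_right scaleC_add_left sum.distrib scaleR_add_right)
  have "(of_real r * c) *\<^sub>C b = r *\<^sub>R (c *\<^sub>C b)" for c and b :: 'e
    by (metis scaleC_of_real scaleC_scaleC)
  then show "fadj (r *\<^sub>R T) = r *\<^sub>R fadj T"
    by (intro blinfun_eqI) (simp add: fadj_apply blinfun.scaleR_left cinner_scaleR_right scaleR_sum_right)
  show "norm (fadj T) \<le> norm T * (real DIM('e) / 2)"
  proof (rule norm_blinfun_bound)
    fix h
    have "norm (\<Sum>b\<in>(Basis::'e set). cinner h (T b) *\<^sub>C b) \<le> (\<Sum>b\<in>(Basis::'e set). norm h * norm T)"
    proof (rule sum_norm_le)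
      fix b :: 'e assume b: "b \<in> Basis"
      have "norm (cinner h (T b) *\<^sub>C b) \<le> norm h * norm (T b)"
        using b cmod_cinner_le [of h "T b"] by simp
      also have "\<dots> \<le> norm h * norm T"
        using norm_blinfun [of T b] b by (intro mult_left_mono) auto
      finally show "norm (cinner h (T b) *\<^sub>C b) \<le> norm h * norm T" .
    qed
    then show "norm (fadj T h) \<le> norm T * (real DIM('e) / 2) * norm h"
      by (simp add: fadj_apply mult_ac)
  qed simp
qed

text \<open>A dimension argument on \<open>'e\<close>. It turns one-sided inverses into inverses,
  both for the Cayley transform and for the fundamental solution of the input equation.\<close>

lemma finite_dim_op_inverse:
  fixes T T' :: "'e::{complex_hilbert, euclidean_space} \<Rightarrow>\<^sub>L 'e"
  assumes "T' o\<^sub>L T = id_blinfun"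
  shows "T o\<^sub>L T' = id_blinfun"
proof -
  have "linear T" "linear T'" by (simp_all add: blinfun.bounded_linear_right bounded_linear.linear)
  moreover have "blinfun_apply T' \<circ> blinfun_apply T = id"
    using arg_cong [OF assms, of "\<lambda>F. blinfun_apply F u" for u] by (simp add: fun_eq_iff)
  ultimately have "blinfun_apply T \<circ> blinfun_apply T' = id"
    using linear_inverse_left by blast
  then show ?thesis by (intro blinfun_eqI) (simp add: fun_eq_iff)
qed

text \<open>Real matrix units for the real basis: an operator function on \<open>'e\<close> becomes
  a finite sum of real scalar functions times constant operators.\<close>

definition matrix_unit :: "'e \<Rightarrow> 'e \<Rightarrow> 'e::euclidean_space \<Rightarrow>\<^sub>L 'e"
  where "matrix_unit b c = Blinfun (\<lambda>u. (u \<bullet> b) *\<^sub>R c)"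

lemma matrix_unit_apply: "matrix_unit b c u = (u \<bullet> b) *\<^sub>R c"
proof -
  have "bounded_linear (\<lambda>u. (u \<bullet> b) *\<^sub>R c)"
    by (intro bounded_linear_intros)
  then show ?thesis by (simp add: matrix_unit_def bounded_linear_Blinfun_apply)
qed

lemma blinfun_matrix_units:
  fixes T :: "'e::euclidean_space \<Rightarrow>\<^sub>L 'e"
  shows "T = (\<Sum>b\<in>Basis. \<Sum>c\<in>Basis. (T b \<bullet> c) *\<^sub>R matrix_unit b c)"
proof (rule blinfun_eqI)
  fix u
  have "(\<Sum>b\<in>Basis. \<Sum>c\<in>Basis. (T b \<bullet> c) *\<^sub>R matrix_unit b c) u = (\<Sum>b\<in>Basis. (u \<bullet> b) *\<^sub>R (\<Sum>c\<in>Basis. (T b \<bullet> c) *\<^sub>R c))"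
    by (simp add: blinfun.sum_left blinfun.scaleR_left matrix_unit_apply scaleR_sum_right mult.commute)
  also have "\<dots> = (\<Sum>b\<in>Basis. T ((u \<bullet> b) *\<^sub>R b))"
    by (simp only: euclidean_representation blinfun.scaleR_right)
  also have "\<dots> = T u"
    by (simp only: blinfun.sum_right [symmetric] euclidean_representation)
  finally show "T u = (\<Sum>b\<in>Basis. \<Sum>c\<in>Basis. (T b \<bullet> c) *\<^sub>R matrix_unit b c) u" ..
qed

lemma strong_L1_blinfun:
  fixes F :: "real \<Rightarrow> 'e::euclidean_space \<Rightarrow>\<^sub>L 'e"
  assumes "\<And>u. (\<lambda>x. F x u) absolutely_integrable_on {a..b}"
  shows "strong_L1 a b F"
proof -
  have "(\<lambda>x. F x b' \<bullet> c) absolutely_integrable_on {a..b}" for b' c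
    using absolutely_integrable_linear [OF assms bounded_linear_inner_left] by (simp add: o_def)
  then have "strong_L1 a b (\<lambda>x. \<Sum>b\<in>Basis. \<Sum>c\<in>Basis. (F x b \<bullet> c) *\<^sub>R matrix_unit b c)"
    by (intro strong_L1_sum strong_L1.scaleR continuous_on_const finite_Basis)
  then show ?thesis by (rule strong_L1.cong) (simp flip: blinfun_matrix_units)
qed

section \<open>Functions holomorphic outside a disc\<close>

lemma exterior_disc_inverse:
  fixes \<rho> :: real
  assumes "0 < \<rho>"
  shows "\<rho> < cmod l \<Longrightarrow> inverse l \<in> ball 0 (1/\<rho>)" "w \<in> ball 0 (1/\<rho>) \<Longrightarrow> w \<noteq> 0 \<Longrightarrow> \<rho> < cmod (inverse w)"
proof -
  show "inverse l \<in> ball 0 (1/\<rho>)" if "\<rho> < cmod l"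
    using that assms by (simp add: norm_inverse inverse_eq_divide [of "cmod l"] frac_less2)
  show "\<rho> < cmod (inverse w)" if "w \<in> ball 0 (1/\<rho>)" "w \<noteq> 0"
    using that assms by (simp add: norm_inverse inverse_eq_divide [of "cmod w"] less_divide_eq divide_less_eq mult.commute del: norm_divide)
qed

text \<open>The resolvent series is 1/l times a power series in w = 1/l, so holomorphy follows from
  that of a power series in a disc around w = 0.\<close>

lemma holomorphic_resolvent:
  fixes A :: "'h::complex_hilbert \<Rightarrow>\<^sub>L 'h"
  assumes A: "complex_linear A" and \<rho>: "norm A \<le> \<rho>" "0 < \<rho>" and C: "complex_linear C"
  shows "(\<lambda>l. cinner (C (op_inverse (scalar_op l - A) v)) w) holomorphic_on {l. \<rho> < cmod l}"
proof -
  define a where "a n = cinner (C (blinfun_power A n v)) w" for n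
  define g where "g z = (\<Sum>n. a n * (z - 0) ^ n)" for z
  have sums: "(\<lambda>n. inverse l * (a n * inverse l ^ n)) sums cinner (C (op_inverse (scalar_op l - A) v)) w" if "\<rho> < cmod l" for l
  proof -
    have "norm A < cmod l" using \<rho> that by simp
    note r = resolvent_series(2) [OF A this, of v]
    have "(\<lambda>n. cinner (C ((1 / l ^ Suc n) *\<^sub>C blinfun_power A n v)) w) sums cinner (C (op_inverse (scalar_op l - A) v)) w"
      by (rule bounded_linear.sums [OF bounded_linear_compose [OF bounded_bilinear.bounded_linear_left [OF bounded_bilinear_cinner] blinfun.bounded_linear_right] r])
    then show ?thesis by (simp add: a_def complex_linearD [OF C] cinner_scaleC_left divide_inverse power_inverse mult_ac)
  qed
  have gs: "(\<lambda>n. a n * (z - 0) ^ n) sums g z" if "z \<in> ball 0 (1/\<rho>)" for z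
  proof (cases "z = 0")
    case True
    then show ?thesis using powser_sums_zero [of a] by (simp add: g_def)
  next
    case False
    have "summable (\<lambda>n. z * (a n * z ^ n))"
      using sums [of "inverse z"] exterior_disc_inverse(2) [OF \<rho>(2) that False] by (auto simp: sums_iff)
    then have "summable (\<lambda>n. a n * z ^ n)" using False using summable_mult [of "\<lambda>n. z * (a n * z ^ n)" "inverse z"] by (simp add: mult.assoc [symmetric])
    then show ?thesis by (simp add: g_def summable_sums)
  qed
  have hol: "g holomorphic_on ball 0 (1/\<rho>)" using gs by (rule power_series_holomorphic)
  have "(\<lambda>l. inverse l * g (inverse l)) holomorphic_on {l. \<rho> < cmod l}"
    using \<rho> exterior_disc_inverse(1) [OF \<rho>(2)]
    by (intro holomorphic_intros holomorphic_on_compose_gen [OF _ hol, unfolded o_def]) auto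
  moreover have "inverse l * g (inverse l) = cinner (C (op_inverse (scalar_op l - A) v)) w" if "\<rho> < cmod l" for l
  proof -
    have "(\<lambda>n. inverse l * (a n * inverse l ^ n)) sums (inverse l * g (inverse l))"
      using gs [OF exterior_disc_inverse(1) [OF \<rho>(2) that]] by (intro sums_mult) simp
    with sums [OF that] show ?thesis by (rule sums_unique2 [symmetric])
  qed
  ultimately show ?thesis by (rule holomorphic_transform) auto
qed

text \<open>Under w = 1/l the limit at infinity becomes a limit at 0, and a continuous isolated
  singularity is removable.\<close>

lemma holomorphic_on_at_infinity:
  fixes g :: "complex \<Rightarrow> complex"
  assumes hol: "g holomorphic_on {l. \<rho> < cmod l}" and \<rho>: "0 < \<rho>" and lim: "(g \<longlongrightarrow> 0) at_infinity"
  shows "(\<lambda>w. if w = 0 then 0 else g (inverse w)) holomorphic_on ball 0 (1/\<rho>)"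
proof -
  define B where "B = ball (0::complex) (1/\<rho>)"
  define h where "h w = (if w = 0 then 0 else g (inverse w))" for w
  have oB: "open B" "0 \<in> B" using \<rho> by (auto simp: B_def)
  have gi: "(\<lambda>w. g (inverse w)) holomorphic_on (B - {0})"
    using exterior_disc_inverse(2) [OF \<rho>]
    by (intro holomorphic_on_compose_gen [OF _ hol, unfolded o_def] holomorphic_intros) (auto simp: B_def)
  then have h1: "h holomorphic_on (B - {0})"
    by (rule holomorphic_transform) (auto simp: h_def)
  have "((\<lambda>w. g (inverse w)) \<longlongrightarrow> 0) (at 0)"
    using lim lim_at_infinity_0 [of g 0] by (simp add: o_def)
  then have "(h \<longlongrightarrow> h 0) (at 0)"
    unfolding h_def by (simp, elim Lim_transform_eventually) (simp add: eventually_at_filter)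
  then have "isCont h 0" by (simp add: isCont_def)
  then have "continuous_on B h"
    using holomorphic_on_imp_continuous_on [OF h1] oB
    by (auto simp: continuous_on_eq_continuous_at open_delete)
  then have "h holomorphic_on B"
    using h1 oB by (intro no_isolated_singularity [of B h "{0}"]) auto
  then show ?thesis unfolding h_def [abs_def] B_def .
qed

text \<open>The Taylor series in w = 1/l has no constant term because the limit at infinity is 0;
  hence the index shift.\<close>

lemma exterior_power_series:
  fixes g :: "complex \<Rightarrow> complex"
  assumes hol: "g holomorphic_on {l. \<rho> < cmod l}" and \<rho>: "0 < \<rho>" and lim: "(g \<longlongrightarrow> 0) at_infinity"
  shows "\<exists>a. \<forall>l. \<rho> < cmod l \<longrightarrow> (\<lambda>n. a n / l ^ Suc n) sums g l"
proof -
  define h where "h w = (if w = 0 then 0 else g (inverse w))" for w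
  define c where "c n = (deriv ^^ n) h 0 / fact n" for n
  have h: "h holomorphic_on ball 0 (1/\<rho>)"
    using holomorphic_on_at_infinity [OF assms] by (simp add: h_def [abs_def])
  have c0: "c 0 = 0" by (simp add: c_def h_def)
  have "(\<lambda>n. c (Suc n) / l ^ Suc n) sums g l" if l: "\<rho> < cmod l" for l
  proof -
    have "l \<noteq> 0" using l \<rho> by auto
    have "(\<lambda>n. c n * (inverse l - 0) ^ n) sums h (inverse l)"
      unfolding c_def by (rule holomorphic_power_series [OF h exterior_disc_inverse(1) [OF \<rho> l]])
    then have "(\<lambda>n. c n / l ^ n) sums g l"
      using \<open>l \<noteq> 0\<close> by (simp add: h_def divide_inverse power_inverse)
    then show ?thesis using sums_Suc_iff [of "\<lambda>n. c n / l ^ n" "g l"] c0 by simp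
  qed
  then show ?thesis by (intro exI [of _ "\<lambda>n. c (Suc n)"]) blast
qed

text \<open>A Schwarz lemma at infinity: in w = 1/l the function vanishes at 0, so l g(l) is its
  quotient by w and stays holomorphic there. The residue is the value of this quotient at 0, and the
  maximum principle on |w| \<le> 1/r bounds it by the values on the circle.\<close>

lemma exterior_residue_scalar:
  fixes g :: "complex \<Rightarrow> complex"
  assumes hol: "g holomorphic_on {l. \<rho> < cmod l}" and \<rho>: "0 < \<rho>" "\<rho> < r" and lim: "(g \<longlongrightarrow> 0) at_infinity"
    and bound: "\<And>l. cmod l = r \<Longrightarrow> cmod (g l) \<le> G"
  shows "\<exists>c. ((\<lambda>l. l * g l) \<longlongrightarrow> c) at_infinity" "\<And>l. r \<le> cmod l \<Longrightarrow> cmod (l * g l) \<le> r * G"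
proof -
  define B where "B = ball (0::complex) (1/\<rho>)"
  define h where "h w = (if w = 0 then 0 else g (inverse w))" for w
  have oB: "open B" "0 \<in> B" using \<rho> by (auto simp: B_def)
  have hB: "h holomorphic_on B"
    using holomorphic_on_at_infinity [OF hol \<rho>(1) lim] by (simp add: h_def [abs_def] B_def)
  define k where "k w = (if w = 0 then deriv h 0 else (h w - h 0) / (w - 0))" for w
  have kB: "k holomorphic_on B"
    unfolding k_def using hB oB by (intro pole_lemma) (auto simp: interior_open)
  have kl: "l * g l = k (inverse l)" if "l \<noteq> 0" for l
    using that by (simp add: k_def h_def divide_inverse)
  have "isCont k 0" using holomorphic_on_imp_continuous_on [OF kB] oB by (simp add: continuous_on_eq_continuous_at)
  then have "((\<lambda>l. k (inverse l)) \<longlongrightarrow> k 0) at_infinity"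
    using tendsto_inverse_0 by (rule isCont_tendsto_compose)
  then have "((\<lambda>l. l * g l) \<longlongrightarrow> k 0) at_infinity"
    by (rule Lim_transform_eventually) (use eventually_not_equal_at_infinity [of 0] in \<open>auto simp: kl elim!: eventually_mono\<close>)
  then show "\<exists>c. ((\<lambda>l. l * g l) \<longlongrightarrow> c) at_infinity" by blast
  fix l assume l: "r \<le> cmod l"
  have "l \<noteq> 0" using l \<rho> by auto
  have sub: "cball 0 (1/r) \<subseteq> B"
    using \<rho> frac_less2 [of 1 1 \<rho> r] by (auto simp: B_def)
  have "cmod (k (inverse l)) \<le> r * G"
  proof (rule maximum_modulus_frontier [of k "cball 0 (1/r)"])
    show "k holomorphic_on interior (cball 0 (1/r))"
      by (rule holomorphic_on_subset [OF kB]) (use sub interior_subset in blast)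
    show "continuous_on (closure (cball 0 (1/r))) k"
      by (rule continuous_on_subset [OF holomorphic_on_imp_continuous_on [OF kB]]) (use sub in auto)
    show "inverse l \<in> cball 0 (1/r)" using l \<rho> \<open>l \<noteq> 0\<close> by (simp add: norm_inverse le_imp_inverse_le inverse_eq_divide [of r, symmetric])
    fix z :: complex assume "z \<in> frontier (cball 0 (1/r))"
    then have z: "cmod z = 1/r" by simp
    then have "z \<noteq> 0" "cmod (inverse z) = r" using \<rho> by (auto simp: norm_inverse)
    have "k z = inverse z * g (inverse z)" using kl [of "inverse z"] \<open>z \<noteq> 0\<close> by simp
    then have "cmod (k z) = r * cmod (g (inverse z))" using \<open>cmod (inverse z) = r\<close> by (simp only: norm_mult)
    also have "\<dots> \<le> r * G" using bound [OF \<open>cmod (inverse z) = r\<close>] \<rho> by (intro mult_left_mono) auto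
    finally show "cmod (k z) \<le> r * G" .
  qed simp
  then show "cmod (l * g l) \<le> r * G" using kl [OF \<open>l \<noteq> 0\<close>] by simp
qed

text \<open>Norms are tested on pairs of vectors, where the scalar result gives a bound with the
  same constant; the limit operator is assembled from finitely many real basis coefficients.\<close>

lemma exterior_residue:
  fixes f :: "complex \<Rightarrow> 'e::{complex_hilbert, euclidean_space} \<Rightarrow>\<^sub>L 'e"
  assumes hol: "\<And>u v. (\<lambda>l. cinner (f l u) v) holomorphic_on {l. \<rho> < cmod l}" and \<rho>: "0 < \<rho>" "\<rho> < r" 
    and lim: "(f \<longlongrightarrow> 0) at_infinity"
    and bound: "\<And>l. cmod l = r \<Longrightarrow> norm (f l) \<le> G"
  shows "\<exists>L. ((\<lambda>l. scalar_op l o\<^sub>L f l) \<longlongrightarrow> L) at_infinity \<and> norm L \<le> r * G"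
    "\<And>l. r \<le> cmod l \<Longrightarrow> norm (scalar_op l o\<^sub>L f l) \<le> r * G"
proof -
  have "norm (f (of_real r)) \<le> G" using \<rho> by (intro bound) auto
  then have "G \<ge> 0" using norm_ge_zero order_trans by blast
  have lim': "((\<lambda>l. cinner (f l u) v) \<longlongrightarrow> 0) at_infinity" for u v
  proof -
    have "((\<lambda>l. cinner (f l u) v) \<longlongrightarrow> cinner ((0 :: 'e \<Rightarrow>\<^sub>L 'e) u) v) at_infinity"
      by (intro bounded_bilinear.tendsto [OF bounded_bilinear_cinner] tendsto_intros blinfun.tendsto lim)
    then show ?thesis by simp
  qed
  have bound': "cmod (cinner (f l u) v) \<le> norm u * norm v * G" if "cmod l = r" for l u v
  proof -
    have "cmod (cinner (f l u) v) \<le> norm (f l u) * norm v" by (rule cmod_cinner_le)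
    also have "\<dots> \<le> (G * norm u) * norm v"
      using bound [OF that] by (intro mult_right_mono order_trans [OF norm_blinfun]) auto
    finally show ?thesis by (simp add: mult_ac)
  qed
  note ex = exterior_residue_scalar [OF hol \<rho> lim' bound']
  show le: "norm (scalar_op l o\<^sub>L f l) \<le> r * G" if "r \<le> cmod l" for l
  proof (rule norm_blinfun_le_cinner)
    fix u v
    show "cmod (cinner ((scalar_op l o\<^sub>L f l) u) v) \<le> r * G * norm u * norm v"
      using ex(2) [OF _ that, of u v] by (simp add: cinner_scaleC_left mult_ac)
  qed (use \<rho> \<open>G \<ge> 0\<close> in simp)
  obtain c where c: "\<And>u v. ((\<lambda>l. l * cinner (f l u) v) \<longlongrightarrow> c u v) at_infinity"
    using ex(1) by metis
  define L where "L = (\<Sum>b\<in>Basis. \<Sum>d\<in>Basis. Re (c b d) *\<^sub>R matrix_unit b (d::'e))"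
  have "((\<lambda>l. \<Sum>b\<in>Basis. \<Sum>d\<in>Basis. Re (l * cinner (f l b) d) *\<^sub>R matrix_unit b (d::'e)) \<longlongrightarrow> L) at_infinity"
    unfolding L_def by (intro tendsto_intros c)
  moreover have "(\<Sum>b\<in>Basis. \<Sum>d\<in>Basis. Re (l * cinner (f l b) d) *\<^sub>R matrix_unit b (d::'e)) = scalar_op l o\<^sub>L f l" for l
    by (subst blinfun_matrix_units [of "scalar_op l o\<^sub>L f l"]) (simp add: inner_eq_Re_cinner cinner_scaleC_left)
  ultimately have L: "((\<lambda>l. scalar_op l o\<^sub>L f l) \<longlongrightarrow> L) at_infinity" by simp
  moreover have "norm L \<le> r * G"
  proof (rule tendsto_upperbound [OF tendsto_norm [OF L]])
    show "\<forall>\<^sub>F l in at_infinity. norm (scalar_op l o\<^sub>L f l) \<le> r * G"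
      unfolding eventually_at_infinity by (intro exI [of _ r]) (auto intro: le)
  qed (use trivial_limit_at_infinity in auto)
  ultimately show "\<exists>L. ((\<lambda>l. scalar_op l o\<^sub>L f l) \<longlongrightarrow> L) at_infinity \<and> norm L \<le> r * G" by blast
qed

text \<open>The identity theorem: the exterior of a disc is connected, and every point of the circle
  is an accumulation point of it.\<close>

lemma exterior_disc_eqI:
  fixes f g :: "complex \<Rightarrow> 'e::{complex_hilbert, euclidean_space} \<Rightarrow>\<^sub>L 'e"
  assumes hol: "\<And>u v. (\<lambda>l. cinner (f l u) v) holomorphic_on {l. \<rho> < cmod l}" 
    and \<rho>: "0 < \<rho>" "\<rho> < r" and zero: "\<And>l. cmod l = r \<Longrightarrow> f l = 0" and l: "\<rho> < cmod l"
  shows "f l = 0"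
proof (rule blinfun_eqI, rule cinner_eqI)
  fix u v
  have "{l::complex. \<rho> < cmod l} = - cball 0 \<rho>" by auto
  moreover have "connected (- cball (0::complex) \<rho>)" "open (- cball (0::complex) \<rho>)"
    by (auto intro: connected_complement_bounded_convex)
  ultimately have S: "connected {l::complex. \<rho> < cmod l}" "open {l::complex. \<rho> < cmod l}" by simp_all
  have "cinner (f l u) v = 0"
  proof (rule analytic_continuation [OF hol S(2,1), of "sphere 0 r" "of_real r"])
    have "connected (sphere (0::complex) r)" by (rule connected_sphere) simp
    moreover have "of_real r \<in> sphere (0::complex) r" "- of_real r \<in> sphere (0::complex) r" using \<rho> by auto
    moreover have "of_real r \<noteq> (- of_real r :: complex)" using \<rho> by auto
    ultimately show "of_real r islimpt sphere (0::complex) r" by (metis connected_imp_perfect singletonD)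
  qed (use \<rho> l zero in auto)
  then show "cinner (f l u) v = cinner ((0 :: 'e \<Rightarrow>\<^sub>L 'e) u) v" by simp
qed

section \<open>Isometries of the sequence space\<close>

lemma ell2_eqI: "(\<And>n. coord x n = coord y n) \<Longrightarrow> x = y"
  by (simp add: coord_inject [symmetric] fun_eq_iff)

lemmas coord_simps = plus_ell2.rep_eq minus_ell2.rep_eq uminus_ell2.rep_eq zero_ell2.rep_eq scaleR_ell2.rep_eq

lemma coord_scaleC: "coord (c *\<^sub>C x) n = c * coord x n"
  by (simp add: scaleC_ell2_def scale_ell2.rep_eq)

lemma coord_sum: "coord (\<Sum>i\<in>I. f i) n = (\<Sum>i\<in>I. coord (f i) n)"
  by (induction I rule: infinite_finite_induct) (auto simp: coord_simps)

text \<open>The isometry that moves coordinate n to f n; \<open>pull\<close> is its adjoint, the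
  restriction to the range. Only strictly increasing f occur, namely shifts and arithmetic
  progressions, and series can be reindexed along them.\<close>

definition push :: "(nat \<Rightarrow> nat) \<Rightarrow> ell2 \<Rightarrow> ell2"
  where "push f x = Abs_ell2 (\<lambda>m. if m \<in> range f then coord x (inv f m) else 0)"

definition pull :: "(nat \<Rightarrow> nat) \<Rightarrow> ell2 \<Rightarrow> ell2"
  where "pull f x = Abs_ell2 (\<lambda>n. coord x (f n))"

lemma coord_push:
  assumes "strict_mono f"
  shows "coord (push f x) m = (if m \<in> range f then coord x (inv f m) else 0)"
    and "coord (push f x) (f n) = coord x n"
proof -
  let ?g = "\<lambda>m. if m \<in> range f then coord x (inv f m) else 0"
  have "inj f" using assms by (rule strict_mono_imp_inj_on)
  have "summable (\<lambda>n. (cmod (?g (f n)))\<^sup>2)" using \<open>inj f\<close> summable_coord [of x] by simp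
  then have "summable (\<lambda>m. (cmod (?g m))\<^sup>2)"
    by (subst (asm) summable_mono_reindex [OF assms, of "\<lambda>m. (cmod (?g m))\<^sup>2"]) auto
  then show *: "coord (push f x) m = ?g m" for m
    unfolding push_def by (subst Abs_ell2_inverse) auto
  show "coord (push f x) (f n) = coord x n"
    using \<open>inj f\<close> by (simp add: *)
qed

lemma coord_pull:
  assumes "strict_mono f"
  shows "coord (pull f x) n = coord x (f n)"
proof -
  have "summable ((\<lambda>m. (cmod (coord x m))\<^sup>2) \<circ> f)"
    by (rule summable_reindex [OF summable_coord strict_mono_imp_inj_on [OF assms]]) simp
  then show ?thesis unfolding pull_def by (subst Abs_ell2_inverse) (auto simp: o_def)
qed

lemma norm_push: "strict_mono f \<Longrightarrow> norm (push f x) = norm x"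
proof -
  assume f: "strict_mono f"
  have "(\<Sum>m. (cmod (coord (push f x) m))\<^sup>2) = (\<Sum>n. (cmod (coord (push f x) (f n)))\<^sup>2)"
    by (rule suminf_mono_reindex [OF f, symmetric]) (simp add: coord_push(1) [OF f])
  then have "(norm (push f x))\<^sup>2 = (norm x)\<^sup>2" by (simp add: norm_ell2_sq coord_push(2) [OF f])
  then show ?thesis by (simp add: power2_eq_iff_nonneg)
qed

lemma norm_pull_le: "strict_mono f \<Longrightarrow> norm (pull f x) \<le> norm x"
proof -
  assume f: "strict_mono f"
  have "(\<Sum>n. (cmod (coord (pull f x) n))\<^sup>2) \<le> (\<Sum>m. (cmod (coord x m))\<^sup>2)"
    using suminf_reindex_mono [OF summable_coord strict_mono_imp_inj_on [OF f], of x] by (simp add: coord_pull [OF f] o_def)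
  then have "(norm (pull f x))\<^sup>2 \<le> (norm x)\<^sup>2" by (simp only: norm_ell2_sq)
  then show ?thesis by (rule power2_le_imp_le) simp
qed

definition Push :: "(nat \<Rightarrow> nat) \<Rightarrow> ell2 \<Rightarrow>\<^sub>L ell2" where "Push f = Blinfun (push f)"
definition Pull :: "(nat \<Rightarrow> nat) \<Rightarrow> ell2 \<Rightarrow>\<^sub>L ell2" where "Pull f = Blinfun (pull f)"

lemma Push_apply:
  assumes f: "strict_mono f"
  shows "Push f x = push f x"
proof -
  have "bounded_linear (push f)"
  proof (rule bounded_linear_intro [where K = 1])
    show "push f (x + y) = push f x + push f y" for x y
      by (rule ell2_eqI) (simp add: coord_push(1) [OF f] coord_simps)
    show "push f (r *\<^sub>R x) = r *\<^sub>R push f x" for r x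
      by (rule ell2_eqI) (simp add: coord_push(1) [OF f] coord_simps)
  qed (simp add: norm_push [OF f])
  then show ?thesis unfolding Push_def by (simp add: bounded_linear_Blinfun_apply)
qed

lemma Pull_apply:
  assumes f: "strict_mono f"
  shows "Pull f x = pull f x"
proof -
  have "bounded_linear (pull f)"
  proof (rule bounded_linear_intro [where K = 1])
    show "pull f (x + y) = pull f x + pull f y" for x y
      by (rule ell2_eqI) (simp add: coord_pull [OF f] coord_simps)
    show "pull f (r *\<^sub>R x) = r *\<^sub>R pull f x" for r x
      by (rule ell2_eqI) (simp add: coord_pull [OF f] coord_simps)
  qed (simp add: norm_pull_le [OF f])
  then show ?thesis unfolding Pull_def by (simp add: bounded_linear_Blinfun_apply)
qed

lemma is_adj_Push: "strict_mono f \<Longrightarrow> is_adj (Push f) (Pull f)"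
  unfolding is_adj_def
proof (intro allI)
  fix u v assume f: "strict_mono f"
  have "(\<Sum>m. coord (push f u) m * cnj (coord v m)) = (\<Sum>n. coord (push f u) (f n) * cnj (coord v (f n)))"
    by (rule suminf_mono_reindex [OF f, symmetric]) (simp add: coord_push(1) [OF f])
  then show "cinner (Push f u) v = cinner u (Pull f v)"
    by (simp add: cinner_ell2_def ip_ell2.rep_eq Push_apply Pull_apply f coord_push(2) coord_pull)
qed

lemma Pull_Push: "strict_mono f \<Longrightarrow> Pull f (Push f x) = x"
  by (rule ell2_eqI) (simp add: Push_apply Pull_apply coord_push(2) coord_pull)

lemma Pull_Push_disjoint: "strict_mono f \<Longrightarrow> strict_mono g \<Longrightarrow> range f \<inter> range g = {} \<Longrightarrow> Pull f (Push g x) = 0"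
  by (rule ell2_eqI) (auto simp: Push_apply Pull_apply coord_push(1) coord_pull coord_simps)

definition ket :: "nat \<Rightarrow> ell2" where "ket n = Abs_ell2 (\<lambda>m. if m = n then 1 else 0)"

lemma coord_ket: "coord (ket n) m = (if m = n then 1 else 0)"
proof -
  have "summable (\<lambda>m. (cmod (if m = n then 1 else 0))\<^sup>2)"
    by (rule summable_finite [of "{n}"]) auto
  then show ?thesis unfolding ket_def by (subst Abs_ell2_inverse) auto
qed

lemma cinner_ket: "cinner (ket n) y = cnj (coord y n)"
proof -
  have "(\<Sum>m. coord (ket n) m * cnj (coord y m)) = (\<Sum>m\<in>{n}. coord (ket n) m * cnj (coord y m))"
    by (rule suminf_finite) (auto simp: coord_ket)
  then show ?thesis by (simp add: cinner_ell2_def ip_ell2.rep_eq coord_ket)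
qed

lemma Push_ket: "strict_mono f \<Longrightarrow> Push f (ket n) = ket (f n)"
  by (rule ell2_eqI) (auto simp: Push_apply coord_push(1) coord_ket strict_mono_eq inv_f_f strict_mono_imp_inj_on)

text \<open>Two isometries with orthogonal ranges that together span the space. They identify
  \<open>ell2\<close> with \<open>ell2 \<oplus> ell2\<close>, so that direct sums of state spaces
  stay within one type; block operators are sums of terms such as
  \<open>V0 o\<^sub>L R o\<^sub>L V1a\<close>.\<close>

definition V0 :: "ell2 \<Rightarrow>\<^sub>L ell2" where "V0 = Push (\<lambda>n. 2 * n)"
definition V1 :: "ell2 \<Rightarrow>\<^sub>L ell2" where "V1 = Push (\<lambda>n. 2 * n + 1)"
definition V0a :: "ell2 \<Rightarrow>\<^sub>L ell2" where "V0a = Pull (\<lambda>n. 2 * n)"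
definition V1a :: "ell2 \<Rightarrow>\<^sub>L ell2" where "V1a = Pull (\<lambda>n. 2 * n + 1)"

lemma strict_mono_even_odd: "strict_mono (\<lambda>n::nat. 2 * n)" "strict_mono (\<lambda>n::nat. 2 * n + 1)"
  by (auto simp: strict_mono_def)

lemma range_even_odd: "range (\<lambda>n::nat. 2 * n) \<inter> range (\<lambda>n. 2 * n + 1) = {}"
  by (auto simp: image_iff) presburger

lemma V_adj: "is_adj V0 V0a" "is_adj V1 V1a" "is_adj V0a V0" "is_adj V1a V1"
  using is_adj_Push [OF strict_mono_even_odd(1)] is_adj_Push [OF strict_mono_even_odd(2)]
  by (auto simp: V0_def V0a_def V1_def V1a_def intro: is_adj_sym)

lemma V_simps [simp]: "V0a (V0 x) = x" "V1a (V1 x) = x" "V0a (V1 x) = 0" "V1a (V0 x) = 0"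
  using range_even_odd
  by (simp_all only: V0_def V0a_def V1_def V1a_def Pull_Push Pull_Push_disjoint strict_mono_even_odd Int_commute)

lemma V_sum: "V0 (V0a x) + V1 (V1a x) = x"
proof (rule ell2_eqI)
  fix n :: nat
  show "coord (V0 (V0a x) + V1 (V1a x)) n = coord x n"
  proof (cases "even n")
    case True
    then obtain k where n: "n = 2 * k" by (elim evenE)
    then have "n \<notin> range (\<lambda>n. 2 * n + 1)" by (auto simp: image_iff) presburger
    moreover have "coord (push (\<lambda>n. 2 * n) (pull (\<lambda>n. 2 * n) x)) n = coord x n"
      unfolding n using coord_push(2) [OF strict_mono_even_odd(1)] by (simp only: coord_pull strict_mono_even_odd)
    ultimately show ?thesis
      by (simp only: V0_def V0a_def V1_def V1a_def Push_apply Pull_apply strict_mono_even_odd coord_simps coord_push(1) if_False add_0_right)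
  next
    case False
    then obtain k where n: "n = 2 * k + 1" by (elim oddE)
    then have "n \<notin> range (\<lambda>n. 2 * n)" by (auto simp: image_iff) presburger
    moreover have "coord (push (\<lambda>n. 2 * n + 1) (pull (\<lambda>n. 2 * n + 1) x)) n = coord x n"
      unfolding n using coord_push(2) [OF strict_mono_even_odd(2)] by (simp only: coord_pull strict_mono_even_odd)
    ultimately show ?thesis
      by (simp only: V0_def V0a_def V1_def V1a_def Push_apply Pull_apply strict_mono_even_odd coord_simps coord_push(1) if_False add_0_left)
  qed
qed

lemma norm_V: "norm (V0 x) = norm x" "norm (V1 x) = norm x"
  by (simp_all only: V0_def V1_def Push_apply strict_mono_even_odd norm_push)

lemma norm_V_sum: "(norm (V0 x + V1 y))\<^sup>2 = (norm x)\<^sup>2 + (norm y)\<^sup>2"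
proof -
  have "cinner (V0 x) (V1 y) = 0" by (simp add: is_adjD [OF V_adj(1)])
  then have "inner (V0 x) (V1 y) = 0" by (simp add: inner_eq_Re_cinner)
  then have "(norm (V0 x + V1 y))\<^sup>2 = (norm (V0 x))\<^sup>2 + (norm (V1 y))\<^sup>2"
    by (simp add: power2_norm_eq_inner inner_add_left inner_add_right inner_commute)
  then show ?thesis by (simp add: norm_V)
qed

text \<open>By Pythagoras a block diagonal operator needs only the larger of the two bounds, not
  their sum; so adding the shift summand later does not push the norm beyond the radius of the
  disc.\<close>

lemma norm_direct_sum_le:
  assumes "norm S \<le> M" "norm T \<le> M" "0 \<le> M"
  shows "norm ((V0 o\<^sub>L S o\<^sub>L V0a) + (V1 o\<^sub>L T o\<^sub>L V1a)) \<le> M"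
proof (rule norm_blinfun_bound [OF assms(3)])
  fix x
  have b: "norm (R y) \<le> M * norm y" if "norm R \<le> M" for R :: "ell2 \<Rightarrow>\<^sub>L ell2" and y
    by (rule order_trans [OF norm_blinfun]) (intro mult_right_mono that norm_ge_zero)
  have "(norm (((V0 o\<^sub>L S o\<^sub>L V0a) + (V1 o\<^sub>L T o\<^sub>L V1a)) x))\<^sup>2 = (norm (S (V0a x)))\<^sup>2 + (norm (T (V1a x)))\<^sup>2"
    by (simp add: blinfun.add_left norm_V_sum)
  also have "\<dots> \<le> (M * norm (V0a x))\<^sup>2 + (M * norm (V1a x))\<^sup>2"
    using b assms by (intro add_mono power_mono) auto
  also have "\<dots> = M\<^sup>2 * (norm (V0 (V0a x) + V1 (V1a x)))\<^sup>2"
    by (simp only: norm_V_sum) (simp add: power_mult_distrib algebra_simps)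
  also have "\<dots> = (M * norm x)\<^sup>2" by (simp only: V_sum power_mult_distrib)
  finally show "norm (((V0 o\<^sub>L S o\<^sub>L V0a) + (V1 o\<^sub>L T o\<^sub>L V1a)) x) \<le> M * norm x"
    by (rule power2_le_imp_le) (use assms in simp)
qed

section \<open>Realization at a single point\<close>

definition finite_rank :: "'i set \<Rightarrow> ('i \<Rightarrow> 'a::complex_hilbert) \<Rightarrow> ('i \<Rightarrow> 'b::complex_hilbert) \<Rightarrow> 'a \<Rightarrow>\<^sub>L 'b"
  where "finite_rank J \<xi> \<eta> = Blinfun (\<lambda>u. \<Sum>j\<in>J. cinner u (\<xi> j) *\<^sub>C \<eta> j)"

lemma finite_rank_apply: "finite_rank J \<xi> \<eta> u = (\<Sum>j\<in>J. cinner u (\<xi> j) *\<^sub>C \<eta> j)"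
proof -
  have "bounded_linear (\<lambda>u. \<Sum>j\<in>J. cinner u (\<xi> j) *\<^sub>C \<eta> j)"
    by (intro bounded_linear_sum bounded_linear_compose [OF bounded_bilinear.bounded_linear_left [OF bounded_bilinear_scaleC]]
        bounded_bilinear.bounded_linear_left [OF bounded_bilinear_cinner])
  then show ?thesis by (simp add: finite_rank_def bounded_linear_Blinfun_apply)
qed

lemma is_adj_finite_rank: "is_adj (finite_rank J \<xi> \<eta>) (finite_rank J \<eta> \<xi>)"
  unfolding is_adj_def
  by (simp add: finite_rank_apply cinner_sum_left cinner_sum_right cinner_scaleC_left cinner_scaleC_right
      cinner_commute [of _ "\<eta> _"] mult.commute)

lemma summable_power2_abs:
  fixes f :: "nat \<Rightarrow> real"
  assumes "summable (\<lambda>n. \<bar>f n\<bar>)"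
  shows "summable (\<lambda>n. (f n)\<^sup>2)"
proof (rule summable_comparison_test_ev [OF _ assms])
  have "(\<lambda>n. \<bar>f n\<bar>) \<longlonglongrightarrow> 0" by (rule summable_LIMSEQ_zero [OF assms])
  then have "eventually (\<lambda>n. \<bar>f n\<bar> < 1) sequentially" by (rule order_tendstoD) simp
  then show "eventually (\<lambda>n. norm ((f n)\<^sup>2) \<le> \<bar>f n\<bar>) sequentially"
  proof eventually_elim
    case (elim n)
    then have "\<bar>f n\<bar> * \<bar>f n\<bar> \<le> 1 * \<bar>f n\<bar>" by (intro mult_right_mono) auto
    then show ?case by (simp add: power2_eq_square abs_mult)
  qed
qed

text \<open>Coordinate \<open>f b n\<close> stands for the n-th power of \<open>T\<close> applied to
  the image of the basis vector b. \<open>D\<close> writes b into slot 0, \<open>T\<close> advances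
  all slots by one and multiplies by r, and \<open>C\<close> reads off the Taylor coefficients
  divided by r^n; so C T^n D is the n-th coefficient of \<open>F\<close> at infinity.\<close>

lemma shift_realization:
  fixes F :: "complex \<Rightarrow> 'e::{complex_hilbert, euclidean_space} \<Rightarrow>\<^sub>L 'e"
  assumes hol: "\<And>u v. (\<lambda>l. cinner (F l u) v) holomorphic_on {l. \<rho> < cmod l}" and \<rho>: "0 < \<rho>"
    and lim: "(F \<longlongrightarrow> 0) at_infinity" and lin: "\<And>l. \<rho> < cmod l \<Longrightarrow> complex_linear (F l)"
  shows "\<exists>(T :: ell2 \<Rightarrow>\<^sub>L ell2) Ta C Ca D Da. is_adj T Ta \<and> is_adj C Ca \<and> is_adj D Da \<and>
    (\<forall>l. max \<rho> (norm T) < cmod l \<longrightarrow> F l = C o\<^sub>L op_inverse (scalar_op l - T) o\<^sub>L D)"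
proof -
  \<comment> \<open>Strictly larger than \<rho>, so that the coefficients divided by r^n are square
    summable.\<close>
  define r where "r = \<rho> + 1"
  define M where "M = DIM('e)"
  have r: "\<rho> < r" "0 < r" using \<rho> by (auto simp: r_def)
  have M: "M > 0" by (simp add: M_def)
  obtain idx :: "'e \<Rightarrow> nat" where idx: "bij_betw idx Basis {..<M}"
    using ex_bij_betw_finite_nat [of "Basis :: 'e set"] by (auto simp: M_def atLeast0LessThan)
  have idxM: "idx b < M" if "b \<in> Basis" for b using bij_betw_apply [OF idx that] by simp
  \<comment> \<open>\<open>M\<close> interleaved sequences, one for each real basis vector: residues
    modulo \<open>M\<close> keep them disjoint, and a shift by \<open>M\<close> advances all of them
    together.\<close>
  define f where "f b n = idx b + n * M" for b n
  have f: "strict_mono (f b)" for b using M by (auto simp: strict_mono_def f_def)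
  have g: "strict_mono (\<lambda>k. k + M)" by (auto simp: strict_mono_def)
  have f_disj: "f b n \<noteq> f b' m" if "b \<in> Basis" "b' \<in> Basis" "b \<noteq> b'" for b b' n m
  proof
    assume "f b n = f b' m"
    then have "f b n mod M = f b' m mod M" by simp
    then have "idx b = idx b'" using idxM that by (simp add: f_def)
    then show False using idx that by (auto simp: bij_betw_def inj_on_def)
  qed
  have lim': "((\<lambda>l. cinner (F l u) v) \<longlongrightarrow> 0) at_infinity" for u v
  proof -
    have "((\<lambda>l. cinner (F l u) v) \<longlongrightarrow> cinner ((0 :: 'e \<Rightarrow>\<^sub>L 'e) u) v) at_infinity"
      by (intro bounded_bilinear.tendsto [OF bounded_bilinear_cinner] tendsto_intros blinfun.tendsto lim)
    then show ?thesis by simp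
  qed
  obtain a where a: "\<And>b c l. \<rho> < cmod l \<Longrightarrow> (\<lambda>n. a b c n / l ^ Suc n) sums cinner (F l b) c"
    using exterior_power_series [OF hol \<rho> lim'] by metis
  have asum: "summable (\<lambda>n. (cmod (cnj (a b c n / of_real r ^ n) / 4))\<^sup>2)" for b c
  proof (rule summable_power2_abs)
    \<comment> \<open>A radius between \<rho> and r: convergence here gives absolute convergence at
      r.\<close>
    define l where "l = complex_of_real (\<rho> + 1/2)"
    have l: "\<rho> < cmod l" "cmod (inverse (of_real r)) < cmod (inverse l)" "l \<noteq> 0"
      using \<rho> by (auto simp: l_def r_def norm_inverse simp flip: of_real_add intro!: less_imp_inverse_less)
    have "summable (\<lambda>n. l * (a b c n / l ^ Suc n))" using a [OF l(1), of b c] by (intro summable_mult) (simp add: sums_iff)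
    then have "summable (\<lambda>n. a b c n * inverse l ^ n)" using l(3) by (simp add: divide_inverse power_inverse mult_ac)
    from powser_insidea [OF this l(2)] have "summable (\<lambda>n. cmod (a b c n / of_real r ^ n))"
      by (simp add: divide_inverse power_inverse)
    then have "summable (\<lambda>n. cmod (a b c n / of_real r ^ n) / 4)" by (rule summable_divide)
    then show "summable (\<lambda>n. \<bar>cmod (cnj (a b c n / of_real r ^ n) / 4)\<bar>)" by (simp add: norm_divide)
  qed
  \<comment> \<open>Conjugated because \<eta> enters the conjugate-linear slot of
    \<open>cinner\<close>. The factor 1/4 compensates two sums over the real basis, each of which
    doubles by \<open>Basis_tight_frame\<close>.\<close>
  define \<zeta> where "\<zeta> b c = Abs_ell2 (\<lambda>n. cnj (a b c n / of_real r ^ n) / 4)" for b c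
  have \<zeta>: "coord (\<zeta> b c) n = cnj (a b c n / of_real r ^ n) / 4" for b c n
    unfolding \<zeta>_def using asum by (subst Abs_ell2_inverse) auto
  define \<eta> where "\<eta> c = (\<Sum>b\<in>Basis. push (f b) (\<zeta> b c))" for c
  have \<eta>: "coord (\<eta> c) (f b n) = cnj (a b c n / of_real r ^ n) / 4" if "b \<in> Basis" for b c n
  proof -
    have "coord (\<eta> c) (f b n) = (\<Sum>b'\<in>Basis. coord (push (f b') (\<zeta> b' c)) (f b n))"
      by (simp add: \<eta>_def coord_sum)
    also have "\<dots> = (\<Sum>b'\<in>Basis. if b' = b then coord (\<zeta> b c) n else 0)"
    proof (rule sum.cong [OF refl])
      fix b' :: 'e assume b': "b' \<in> Basis"
      show "coord (push (f b') (\<zeta> b' c)) (f b n) = (if b' = b then coord (\<zeta> b c) n else 0)"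
      proof (cases "b' = b")
        case True
        then show ?thesis by (simp add: coord_push(2) [OF f])
      next
        case False
        then have "f b n \<notin> range (f b')" using f_disj [OF that b'] by auto
        then show ?thesis using False by (simp add: coord_push(1) [OF f])
      qed
    qed
    also have "\<dots> = coord (\<zeta> b c) n" using that by simp
    finally show ?thesis by (simp add: \<zeta>)
  qed
  define T where "T = r *\<^sub>R Push (\<lambda>k. k + M)"
  define D where "D = finite_rank Basis (\<lambda>b::'e. b) (\<lambda>b. ket (f b 0))"
  define C where "C = finite_rank Basis \<eta> (\<lambda>b::'e. b)"
  have T: "is_adj T (r *\<^sub>R Pull (\<lambda>k. k + M))"
    unfolding T_def by (intro is_adj_scaleR is_adj_Push g)
  have Clin: "complex_linear C" and Tlin: "complex_linear T"
    unfolding C_def by (rule is_adj_complex_linear [OF is_adj_finite_rank], rule is_adj_complex_linear [OF T])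
  have pow: "blinfun_power T n (ket (f b 0)) = (r ^ n) *\<^sub>R ket (f b n)" for n b
  proof (induction n)
    case (Suc n)
    have "f b n + M = f b (Suc n)" by (simp add: f_def)
    then show ?case using Suc by (simp add: T_def blinfun.scaleR_left blinfun.scaleR_right Push_ket [OF g])
  qed simp
  have CTD: "C (blinfun_power T n (D u)) = (\<Sum>b\<in>Basis. \<Sum>c\<in>Basis. (1/4 * cinner u b * a b c n) *\<^sub>C c)" for n u
  proof -
    have plin: "blinfun_power T n (z *\<^sub>C x) = z *\<^sub>C blinfun_power T n x" for z x
      by (induction n) (simp_all add: complex_linearD [OF Tlin])
    have "C (blinfun_power T n (D u)) = (\<Sum>b\<in>Basis. cinner u b *\<^sub>C ((r ^ n) *\<^sub>R C (ket (f b n))))"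
      by (simp add: D_def finite_rank_apply blinfun.sum_right plin complex_linearD [OF Clin] pow blinfun.scaleR_right)
    also have "\<dots> = (\<Sum>b\<in>Basis. \<Sum>c\<in>Basis. (1/4 * cinner u b * a b c n) *\<^sub>C c)"
    proof (rule sum.cong [OF refl])
      fix b :: 'e assume b: "b \<in> Basis"
      have "(r ^ n) *\<^sub>R C (ket (f b n)) = (\<Sum>c\<in>Basis. (a b c n / 4) *\<^sub>C c)"
        using r b by (simp add: C_def finite_rank_apply cinner_ket \<eta> bounded_bilinear.sum_right [OF bounded_bilinear_scaleC] scaleC_scaleC flip: scaleC_of_real)
      then show "cinner u b *\<^sub>C ((r ^ n) *\<^sub>R C (ket (f b n))) = (\<Sum>c\<in>Basis. (1/4 * cinner u b * a b c n) *\<^sub>C c)"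
        by (simp add: bounded_bilinear.sum_right [OF bounded_bilinear_scaleC] scaleC_scaleC)
    qed
    finally show ?thesis .
  qed
  have "F l = C o\<^sub>L op_inverse (scalar_op l - T) o\<^sub>L D" if l: "max \<rho> (norm T) < cmod l" for l
  proof (rule blinfun_eqI)
    fix u
    have l': "\<rho> < cmod l" "norm T < cmod l" using l by auto
    have "(\<lambda>n. C ((1 / l ^ Suc n) *\<^sub>C blinfun_power T n (D u))) sums C (op_inverse (scalar_op l - T) (D u))"
      by (rule bounded_linear.sums [OF blinfun.bounded_linear_right resolvent_series(2) [OF Tlin l'(2)]])
    moreover have "C ((1 / l ^ Suc n) *\<^sub>C blinfun_power T n (D u))
        = (\<Sum>b\<in>Basis. \<Sum>c\<in>Basis. (1/4 * cinner u b * (a b c n / l ^ Suc n)) *\<^sub>C c)" for n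
      by (simp add: complex_linearD [OF Clin] CTD bounded_bilinear.sum_right [OF bounded_bilinear_scaleC] scaleC_scaleC mult_ac)
    moreover have "(\<lambda>n. \<Sum>b\<in>Basis. \<Sum>c\<in>Basis. (1/4 * cinner u b * (a b c n / l ^ Suc n)) *\<^sub>C c) sums
        (\<Sum>b\<in>Basis. \<Sum>c\<in>Basis. (1/4 * cinner u b * cinner (F l b) c) *\<^sub>C c)"
      by (intro sums_sum bounded_linear.sums [OF bounded_bilinear.bounded_linear_left [OF bounded_bilinear_scaleC]] sums_mult a l')
    ultimately have "C (op_inverse (scalar_op l - T) (D u)) = (\<Sum>b\<in>Basis. \<Sum>c\<in>Basis. (1/4 * cinner u b * cinner (F l b) c) *\<^sub>C c)"
      using sums_unique2 by simp
    also have "\<dots> = (\<Sum>b\<in>Basis. (1/4 * cinner u b) *\<^sub>C (\<Sum>c\<in>Basis. cinner (F l b) c *\<^sub>C c))"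
      by (simp add: bounded_bilinear.sum_right [OF bounded_bilinear_scaleC] scaleC_scaleC)
    also have "\<dots> = (\<Sum>b\<in>Basis. (1/2) *\<^sub>R F l (cinner u b *\<^sub>C b))"
      by (simp add: Basis_tight_frame complex_linearD [OF lin [OF l'(1)]] scaleC_scaleC flip: scaleC_of_real)
    also have "\<dots> = (1/2) *\<^sub>R F l (\<Sum>b\<in>Basis. cinner u b *\<^sub>C b)"
      by (simp only: scaleR_sum_right blinfun.sum_right)
    also have "\<dots> = F l u" by (simp only: Basis_tight_frame blinfun.scaleR_right) simp
    finally show "F l u = (C o\<^sub>L op_inverse (scalar_op l - T) o\<^sub>L D) u" by simp
  qed
  then show ?thesis
    using T is_adj_finite_rank [of Basis \<eta> "\<lambda>b. b"] is_adj_finite_rank [of Basis "\<lambda>b. b" "\<lambda>b. ket (f b 0)"]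
    unfolding C_def D_def by blast
qed

text \<open>A multiple of the following operator is lossless for the metric that exchanges the summands, and its
  spectrum is a disc.\<close>

definition shift_pair :: "ell2 \<Rightarrow>\<^sub>L ell2" where "shift_pair = (V0 o\<^sub>L Push Suc o\<^sub>L V0a) - (V1 o\<^sub>L Pull Suc o\<^sub>L V1a)"

text \<open>A solution would satisfy l x_0 = 1 and l x_(n+1) = \<rho> x_n; for |l| \<le> \<rho> the
  moduli of its coordinates then never decrease, which contradicts square summability.\<close>

lemma shift_spectrum:
  assumes "cmod l \<le> \<rho>" "0 < \<rho>"
  shows "l *\<^sub>C x - \<rho> *\<^sub>R Push Suc x \<noteq> ket 0"
proof
  assume eq: "l *\<^sub>C x - \<rho> *\<^sub>R Push Suc x = ket 0"
  have S: "strict_mono Suc" by (simp add: strict_mono_def)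
  have 0: "l * coord x 0 = 1"
    using arg_cong [OF eq, of "\<lambda>y. coord y 0"] by (simp add: coord_simps coord_scaleC Push_apply S coord_push(1) coord_ket)
  then have ne: "l \<noteq> 0" "coord x 0 \<noteq> 0" by auto
  have step: "l * coord x (Suc n) = of_real \<rho> * coord x n" for n
    using arg_cong [OF eq, of "\<lambda>y. coord y (Suc n)"] by (simp add: coord_simps coord_scaleC Push_apply S coord_push(2) coord_ket)
  have "cmod (coord x 0) \<le> cmod (coord x n)" for n
  proof (induction n)
    case (Suc n)
    have "cmod l * cmod (coord x n) \<le> \<rho> * cmod (coord x n)" using assms by (intro mult_right_mono) auto
    also have "\<dots> = cmod l * cmod (coord x (Suc n))"
      using arg_cong [OF step [of n], of cmod] assms by (simp add: norm_mult)
    finally show ?case using Suc ne by simp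
  qed simp
  moreover have "(\<lambda>n. (cmod (coord x n))\<^sup>2) \<longlonglongrightarrow> 0" by (rule summable_LIMSEQ_zero [OF summable_coord])
  ultimately have "(cmod (coord x 0))\<^sup>2 \<le> 0"
    by (intro LIMSEQ_le_const [where X = "\<lambda>n. (cmod (coord x n))\<^sup>2"]) (auto intro: power_mono)
  then show False using ne by simp
qed

lemmas blinfun_linear = blinfun.add_left blinfun.add_right blinfun.diff_left blinfun.diff_right
  blinfun.minus_left blinfun.minus_right blinfun.scaleR_left blinfun.scaleR_right

lemma op_inverse_blinfunI:
  fixes T T' :: "'h::complex_hilbert \<Rightarrow>\<^sub>L 'h"
  assumes "\<And>x. T' (T x) = x" "\<And>x. T (T' x) = x"
  shows "op_inverse T = T'" "op_invertible T"
proof -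
  have "T' o\<^sub>L T = id_blinfun" "T o\<^sub>L T' = id_blinfun" using assms by (auto intro: blinfun_eqI)
  then show "op_inverse T = T'" "op_invertible T" by (rule op_inverse_eq)+
qed

lemma resolvent_equation:
  fixes A :: "'h::complex_hilbert \<Rightarrow>\<^sub>L 'h"
  assumes "complex_linear A" "norm A < cmod l"
  shows "l *\<^sub>C op_inverse (scalar_op l - A) x - A (op_inverse (scalar_op l - A) x) = x"
    and "op_inverse (scalar_op l - A) (l *\<^sub>C x - A x) = x"
  using op_inverse_apply [OF resolvent_series(1) [OF assms], of x] by (simp_all add: blinfun.diff_left)

text \<open>Write I - S0 = C (l - T)^-1 D. Feedback turns this into a realization of N = 2 (I +
  S0)^-1 - I, for which the symmetry of S0 becomes linear: J N(l) equals minus the adjoint of N(-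
  cnj l) times J. Hence N is the sum of half of itself and half of its reflected adjoint, realized
  on two summands that the metric exchanges.\<close>

lemma lossless_realization:
  fixes S0 :: "complex \<Rightarrow> 'e::{complex_hilbert, euclidean_space} \<Rightarrow>\<^sub>L 'e" and J :: "'e \<Rightarrow>\<^sub>L 'e"
  assumes hol: "\<And>u v. (\<lambda>l. cinner (S0 l u) v) holomorphic_on {l. \<rho> < cmod l}" and \<rho>: "0 < \<rho>"
    and lim: "(S0 \<longlongrightarrow> id_blinfun) at_infinity" and lin: "\<And>l. \<rho> < cmod l \<Longrightarrow> complex_linear (S0 l)"
    and J: "op_invertible J" "is_adj J J"
    and sym: "\<And>l. \<rho> < cmod l \<Longrightarrow> fadj (S0 (- cnj l)) o\<^sub>L J o\<^sub>L S0 l = J"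
  shows "\<exists>(A :: ell2 \<Rightarrow>\<^sub>L ell2) Aa B X. is_adj A Aa \<and> complex_linear B \<and> is_adj X X \<and> op_invertible X \<and>
    (A o\<^sub>L X) + (X o\<^sub>L Aa) + (B o\<^sub>L J o\<^sub>L fadj B) = 0 \<and>
    (\<exists>r. \<forall>l. r < cmod l \<longrightarrow> S0 l = id_blinfun - (fadj B o\<^sub>L op_inverse X o\<^sub>L op_inverse (scalar_op l - A) o\<^sub>L B o\<^sub>L J))"
proof -
  define F where "F l = id_blinfun - S0 l" for l
  have "(\<lambda>l. cinner u v - cinner (S0 l u) v) holomorphic_on {l. \<rho> < cmod l}" for u v
    by (intro holomorphic_intros hol)
  then have Fhol: "(\<lambda>l. cinner (F l u) v) holomorphic_on {l. \<rho> < cmod l}" for u v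
    by (simp add: F_def blinfun.diff_left cinner_diff_left)
  have "((\<lambda>l. id_blinfun - S0 l) \<longlongrightarrow> id_blinfun - id_blinfun) at_infinity" by (intro tendsto_intros lim)
  then have Flim: "(F \<longlongrightarrow> 0) at_infinity" by (simp add: F_def [abs_def])
  have Flin: "complex_linear (F l)" if "\<rho> < cmod l" for l
    using lin [OF that] by (simp add: complex_linear_def F_def blinfun.diff_left bounded_bilinear.diff_right [OF bounded_bilinear_scaleC])
  obtain T :: "ell2 \<Rightarrow>\<^sub>L ell2" and Ta C Ca D Da where T: "is_adj T Ta" and C: "is_adj C Ca" and D: "is_adj D Da"
    and real: "\<forall>l. max \<rho> (norm T) < cmod l \<longrightarrow> F l = C o\<^sub>L op_inverse (scalar_op l - T) o\<^sub>L D"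
    using shift_realization [OF Fhol \<rho> Flim Flin] by blast
  \<comment> \<open>Since (I + S0) / 2 = I - (1/2) C (l - T)^-1 D, its inverse is I + (1/2) C (l -
    K)^-1 D for this K.\<close>
  define K where "K = T + (1/2) *\<^sub>R (D o\<^sub>L C)"
  define Ka where "Ka = Ta + (1/2) *\<^sub>R (Ca o\<^sub>L Da)"
  have K: "is_adj K Ka"
    unfolding K_def Ka_def by (intro is_adj_add is_adj_scaleR is_adj_compose T C D)
  define Ji where "Ji = op_inverse J"
  have Ji: "is_adj Ji Ji" unfolding Ji_def by (intro is_adj_op_inverse J)
  have JJ [simp]: "J (Ji x) = x" "Ji (J x) = x" for x
    using op_inverse_apply [OF J(1)] by (simp_all add: Ji_def)
  define A0 where "A0 = (V0 o\<^sub>L K o\<^sub>L V0a) - (V1 o\<^sub>L Ka o\<^sub>L V1a)"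
  define A0a where "A0a = (V0 o\<^sub>L Ka o\<^sub>L V0a) - (V1 o\<^sub>L K o\<^sub>L V1a)"
  have A0: "is_adj A0 A0a" 
    using is_adj_diff [OF is_adj_compose [OF is_adj_compose [OF V_adj(1) K] V_adj(3)]
        is_adj_compose [OF is_adj_compose [OF V_adj(2) is_adj_sym [OF K]] V_adj(4)]]
    by (simp add: A0_def A0a_def blinfun_compose_assoc)
  \<comment> \<open>The exchange of the two summands. It satisfies A0 X + X A0a = 0 because the
    second summand carries - Ka.\<close>
  define X where "X = (V0 o\<^sub>L V1a) + (V1 o\<^sub>L V0a)"
  have X: "is_adj X X"
    using is_adj_add [OF is_adj_compose [OF V_adj(1) V_adj(4)] is_adj_compose [OF V_adj(2) V_adj(3)]]
    by (simp add: X_def add.commute)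
  have XX [simp]: "X (X x) = x" for x
    using V_sum [of x] by (simp add: X_def blinfun_linear add.commute)
  have Xinv: "op_invertible X" "op_inverse X = X"
    using op_inverse_blinfunI [of X X] by simp_all
  \<comment> \<open>The factor 1/4 is the 1/2 in N times the 1/2 of the splitting. It is put on one
    component, so that in the product with the output \<open>B1a o\<^sub>L X\<close> it occurs
    exactly once on either summand.\<close>
  define B1 where "B1 = (V0 o\<^sub>L D o\<^sub>L Ji) + (1/4) *\<^sub>R (V1 o\<^sub>L Ca)"
  define B1a where "B1a = (Ji o\<^sub>L Da o\<^sub>L V0a) + (1/4) *\<^sub>R (C o\<^sub>L V1a)"
  have B1: "is_adj B1 B1a"
    using is_adj_add [OF is_adj_compose [OF is_adj_compose [OF V_adj(1) D] Ji]
        is_adj_scaleR [OF is_adj_compose [OF V_adj(2) is_adj_sym [OF C]], of "1/4"]]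
    by (simp add: B1_def B1a_def blinfun_compose_assoc)
  define Cp where "Cp = B1a o\<^sub>L X"
  have Cp: "is_adj Cp (X o\<^sub>L B1)"
    unfolding Cp_def by (intro is_adj_compose is_adj_sym [OF B1] X)
  \<comment> \<open>State feedback by the output Cp: it replaces the input x by w = x + N x, which
    undoes the Cayley transform.\<close>
  define A where "A = A0 - (B1 o\<^sub>L J o\<^sub>L Cp)"
  define Aa where "Aa = A0a - (X o\<^sub>L B1 o\<^sub>L J o\<^sub>L B1a)"
  have A: "is_adj A Aa"
    using is_adj_diff [OF A0 is_adj_compose [OF is_adj_compose [OF B1 J(2)] Cp]]
    by (simp add: A_def Aa_def blinfun_compose_assoc)
  \<comment> \<open>The result is S0 = I - 2 Cp (l - A)^-1 B1 J; the 2 is shared evenly by B and its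
    adjoint. The same 2 appears in the Lyapunov equation, where A X and X Aa each contribute - B1 J
    B1a.\<close>
  define B where "B = sqrt 2 *\<^sub>R B1"
  have B: "is_adj B (sqrt 2 *\<^sub>R B1a)" unfolding B_def by (intro is_adj_scaleR B1)
  have Blin: "complex_linear B" by (rule is_adj_complex_linear [OF B])
  have fB: "fadj B = sqrt 2 *\<^sub>R B1a" by (rule is_adj_unique [OF is_adj_fadj [OF Blin] B])
  have lyap: "(A o\<^sub>L X) + (X o\<^sub>L Aa) + (B o\<^sub>L J o\<^sub>L fadj B) = 0"
  proof (rule blinfun_eqI)
    fix x
    have zero: "A0 (X x) + X (A0a x) = 0" by (simp add: A0_def A0a_def X_def blinfun_linear)
    have "A (X x) = A0 (X x) - B1 (J (B1a x))" by (simp add: A_def Cp_def blinfun_linear)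
    moreover have "X (Aa x) = X (A0a x) - B1 (J (B1a x))" by (simp add: Aa_def blinfun_linear)
    moreover have "B (J (fadj B x)) = B1 (J (B1a x)) + B1 (J (B1a x))"
      unfolding fB by (simp add: B_def blinfun_linear scaleR_2)
    ultimately have "A (X x) + X (Aa x) + B (J (fadj B x)) = A0 (X x) + X (A0a x)" by simp
    then show "((A o\<^sub>L X) + (X o\<^sub>L Aa) + (B o\<^sub>L J o\<^sub>L fadj B)) x = blinfun_apply 0 x"
      by (simp add: blinfun.add_left zero)
  qed
  define r where "r = max \<rho> (max (norm T) (max (norm K) (max (norm Ka) (max (norm A) (norm A0)))))"
  have main: "S0 l = id_blinfun - (fadj B o\<^sub>L op_inverse X o\<^sub>L op_inverse (scalar_op l - A) o\<^sub>L B o\<^sub>L J)" if l: "r < cmod l" for l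
  proof -
    have bounds: "\<rho> < cmod l" "norm T < cmod l" "norm K < cmod l" "norm (- Ka) < cmod l" "norm A < cmod l" "norm A0 < cmod l"
      using l by (auto simp: r_def)
    define N where "N l = (1/2) *\<^sub>R (C o\<^sub>L op_inverse (scalar_op l - K) o\<^sub>L D)" for l
    have UV: "((1/2) *\<^sub>R (S0 l + id_blinfun)) o\<^sub>L (id_blinfun + N l) = id_blinfun" if "r < cmod l" for l
    proof (rule blinfun_eqI)
      fix x
      have b: "\<rho> < cmod l" "norm T < cmod l" "norm K < cmod l" using that by (auto simp: r_def)
      let ?R = "op_inverse (scalar_op l - T)" and ?Q = "op_inverse (scalar_op l - K)"
      have Fl: "F l = C o\<^sub>L ?R o\<^sub>L D" using real b by simp
      have "S0 l = id_blinfun - F l" by (simp add: F_def)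
      then have S: "S0 l y = y - C (?R (D y))" for y
        unfolding Fl by (simp add: blinfun.diff_left)
      define q where "q = ?Q (D x)"
      have "l *\<^sub>C q - K q = D x"
        unfolding q_def by (rule resolvent_equation [OF is_adj_complex_linear [OF K] b(3)])
      then have "l *\<^sub>C q - T q = D x + (1/2) *\<^sub>R D (C q)" by (simp add: K_def blinfun_linear algebra_simps)
      moreover have "?R (l *\<^sub>C q - T q) = q" by (rule resolvent_equation [OF is_adj_complex_linear [OF T] b(2)])
      ultimately have q: "q = ?R (D x) + (1/2) *\<^sub>R ?R (D (C q))" by (simp add: blinfun_linear)
      have Nx: "N l x = (1/2) *\<^sub>R C q" by (simp add: N_def q_def blinfun_linear)
      have Cq: "C q = C (?R (D x)) + (1/2) *\<^sub>R C (?R (D (C q)))"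
        by (subst q) (simp add: blinfun_linear)
      have "(((1/2) *\<^sub>R (S0 l + id_blinfun)) o\<^sub>L (id_blinfun + N l)) x
        = x + (1/2) *\<^sub>R C q - (1/2) *\<^sub>R (C (?R (D x)) + (1/2) *\<^sub>R C (?R (D (C q))))"
        by (simp add: blinfun_linear S Nx) (simp add: algebra_simps scaleR_add_left [symmetric])
      also have "\<dots> = x" using Cq by simp
      finally show "(((1/2) *\<^sub>R (S0 l + id_blinfun)) o\<^sub>L (id_blinfun + N l)) x = id_blinfun x" by simp
    qed
    have lm: "r < cmod (- cnj l)" using l by simp
    \<comment> \<open>Passing to - cnj l and to the adjoint turns the resolvent of K into minus the
      resolvent of - Ka, the operator on the second summand.\<close>
    have Nadj: "is_adj (N (- cnj l)) ((1/2) *\<^sub>R (Da o\<^sub>L (- op_inverse (scalar_op l - (- Ka))) o\<^sub>L Ca))"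
    proof -
      have "is_adj (scalar_op (- cnj l) - K) (scalar_op (- l) - Ka)"
        using is_adj_diff [OF is_adj_scalar_op [of "- cnj l"] K] by simp
      moreover have b: "norm K < cmod (- cnj l)" "norm Ka < cmod (- l)" using lm by (auto simp: r_def)
      ultimately have "is_adj (op_inverse (scalar_op (- cnj l) - K)) (op_inverse (scalar_op (- l) - Ka))"
        by (intro is_adj_op_inverse resolvent_series(1)) (auto intro: is_adj_complex_linear [OF K] is_adj_complex_linear [OF is_adj_sym [OF K]])
      moreover have "op_inverse (scalar_op (- l) - Ka) = - op_inverse (scalar_op l - (- Ka))"
      proof (rule op_inverse_blinfunI(1))
        have lk: "complex_linear (- Ka)" using is_adj_complex_linear [OF is_adj_minus [OF is_adj_sym [OF K]]] .
        note nr = resolvent_equation [OF lk bounds(4)]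
        show "(- op_inverse (scalar_op l - - Ka)) ((scalar_op (- l) - Ka) x) = x" for x
          using nr(2) [of x] by (simp add: blinfun_linear scaleC_minus_left flip: blinfun.minus_right)
        show "(scalar_op (- l) - Ka) ((- op_inverse (scalar_op l - - Ka)) x) = x" for x
          using nr(1) [of x] by (simp add: blinfun_linear scaleC_minus_left bounded_bilinear.minus_right [OF bounded_bilinear_scaleC] add.commute)
      qed
      ultimately have R: "is_adj (op_inverse (scalar_op (- cnj l) - K)) (- op_inverse (scalar_op l - (- Ka)))" by simp
      show ?thesis
        using is_adj_scaleR [OF is_adj_compose [OF is_adj_compose [OF C R] D], of "1/2"]
        by (simp add: N_def blinfun_compose_assoc)
    qed
    define Ns where "Ns = (1/2) *\<^sub>R (Da o\<^sub>L (- op_inverse (scalar_op l - (- Ka))) o\<^sub>L Ca)"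
    have S0lin: "complex_linear (S0 (- cnj l))" using lin bounds by simp
    have UVx: "S0 l (x + N l x) + (x + N l x) = 2 *\<^sub>R x" for x
    proof -
      define w where "w = x + N l x"
      have "(1/2) *\<^sub>R (S0 l w + w) = x"
        using arg_cong [OF UV [OF l], of "\<lambda>F. blinfun_apply F x"] by (simp add: blinfun.add_left blinfun.scaleR_left w_def)
      then have "2 *\<^sub>R ((1/2) *\<^sub>R (S0 l w + w)) = 2 *\<^sub>R x" by (rule arg_cong)
      then show ?thesis by (simp add: w_def)
    qed
    have VUs: "fadj (S0 (- cnj l)) z + z + Ns (fadj (S0 (- cnj l)) z + z) = 2 *\<^sub>R z" for z
    proof -
      have "is_adj (((1/2) *\<^sub>R (S0 (- cnj l) + id_blinfun)) o\<^sub>L (id_blinfun + N (- cnj l)))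
        ((id_blinfun + Ns) o\<^sub>L ((1/2) *\<^sub>R (fadj (S0 (- cnj l)) + id_blinfun)))"
        unfolding Ns_def by (intro is_adj_compose is_adj_add is_adj_scaleR is_adj_id is_adj_fadj S0lin Nadj)
      then have "(id_blinfun + Ns) o\<^sub>L ((1/2) *\<^sub>R (fadj (S0 (- cnj l)) + id_blinfun)) = id_blinfun"
        unfolding UV [OF lm] by (rule is_adj_unique [OF _ is_adj_id])
      moreover define w where "w = fadj (S0 (- cnj l)) z + z"
      then have "((1/2) *\<^sub>R (fadj (S0 (- cnj l)) + id_blinfun)) z = (1/2) *\<^sub>R w" by (simp add: blinfun_linear)
      ultimately have "(1/2) *\<^sub>R w + (1/2) *\<^sub>R Ns w = z"
        by (metis blinfun.add_left blinfun.scaleR_right blinfun_apply_blinfun_compose blinfun_apply_id_blinfun id_apply)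
      then have "2 *\<^sub>R ((1/2) *\<^sub>R w + (1/2) *\<^sub>R Ns w) = 2 *\<^sub>R z" by (rule arg_cong)
      then show ?thesis by (simp add: w_def scaleR_add_right)
    qed
    \<comment> \<open>With w = x + N x one has 2 x = S0 w + w. The symmetry of S0 evaluates the
      adjoint of S0(- cnj l) at J (S0 w), and the adjoint form \<open>VUs\<close> of the Cayley
      relation turns this into the symmetry of N.\<close>
    have lossless: "J (N l x) = - Ns (J x)" for x
    proof -
      define w where "w = x + N l x"
      have x2: "2 *\<^sub>R x = S0 l w + w" unfolding w_def by (rule UVx [symmetric])
      have "fadj (S0 (- cnj l)) (J (S0 l w)) = J w"
        using arg_cong [OF sym [OF bounds(1)], of "\<lambda>F. blinfun_apply F w"] by simp
      with VUs [of "J (S0 l w)"] have "J (2 *\<^sub>R x) + Ns (J (2 *\<^sub>R x)) = 2 *\<^sub>R J (S0 l w)"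
        unfolding x2 by (simp add: blinfun_linear add.commute)
      also have "\<dots> = 2 *\<^sub>R J (2 *\<^sub>R x - w)" by (simp add: x2)
      finally have "2 *\<^sub>R (J x + Ns (J x)) = 2 *\<^sub>R (J (x - N l x))"
        by (simp add: w_def blinfun_linear scaleR_add_right scaleR_2)
      then show ?thesis by (simp add: blinfun_linear)
    qed
    have lk: "complex_linear (- Ka)" using is_adj_complex_linear [OF is_adj_minus [OF is_adj_sym [OF K]]] .
    \<comment> \<open>z is (l - A0)^-1 B1 J x, computed by components. By \<open>lossless\<close>
      the second summand contributes the same (1/2) N x to the output as the first.\<close>
    have key: "\<exists>z. l *\<^sub>C z - A0 z = B1 (J x) \<and> Cp z = N l x" for x
    proof -
      define p where "p = op_inverse (scalar_op l - K) (D x)"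
      define q where "q = op_inverse (scalar_op l - (- Ka)) (Ca (J x))"
      have p: "l *\<^sub>C p - K p = D x"
        unfolding p_def by (rule resolvent_equation [OF is_adj_complex_linear [OF K] bounds(3)])
      have q: "l *\<^sub>C q + Ka q = Ca (J x)"
        using resolvent_equation(1) [OF lk bounds(4), of "Ca (J x)"] by (simp add: q_def blinfun.minus_left)
      define z where "z = V0 p + (1/4) *\<^sub>R V1 q"
      have Vc: "c *\<^sub>C V0 y = V0 (c *\<^sub>C y)" "c *\<^sub>C V1 y = V1 (c *\<^sub>C y)" for c y
        using V_adj(1,2) [THEN is_adj_complex_linear] by (simp_all add: complex_linearD)
      have "l *\<^sub>C z - A0 z = V0 (l *\<^sub>C p - K p) + (1/4) *\<^sub>R V1 (l *\<^sub>C q + Ka q)"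
        by (simp add: z_def A0_def blinfun_linear scaleC_add_right scaleC_scaleR Vc scaleR_add_right)
      also have "\<dots> = B1 (J x)" by (simp add: p q B1_def blinfun_linear)
      finally have 1: "l *\<^sub>C z - A0 z = B1 (J x)" .
      have "Cp z = (1/4) *\<^sub>R Ji (Da q) + (1/4) *\<^sub>R C p"
        by (simp add: Cp_def B1a_def X_def z_def blinfun_linear)
      also have "Da q = - (2 *\<^sub>R Ns (J x))"
        by (simp add: Ns_def q_def blinfun_linear)
      also have "\<dots> = 2 *\<^sub>R J (N l x)" by (simp add: lossless)
      also have "C p = 2 *\<^sub>R N l x" by (simp add: N_def p_def blinfun_linear)
      finally have "Cp z = N l x" by (simp add: blinfun_linear scaleR_add_left [symmetric])
      with 1 show ?thesis by blast
    qed
    show ?thesis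
    proof (rule blinfun_eqI)
      fix w
      define x where "x = (1/2) *\<^sub>R (S0 l w + w)"
      have "((id_blinfun + N l) o\<^sub>L ((1/2) *\<^sub>R (S0 l + id_blinfun))) w = id_blinfun w"
        by (simp only: finite_dim_op_inverse [OF UV [OF l]])
      moreover have "((1/2) *\<^sub>R (S0 l + id_blinfun)) w = x"
        by (simp add: x_def blinfun.add_left blinfun.scaleR_left)
      ultimately have "(id_blinfun + N l) x = w" by simp
      then have w: "x + N l x = w" by (simp add: blinfun.add_left)
      obtain z where z: "l *\<^sub>C z - A0 z = B1 (J x)" "Cp z = N l x" using key by blast
      have "l *\<^sub>C z - A z = (l *\<^sub>C z - A0 z) + B1 (J (Cp z))" by (simp add: A_def blinfun_linear)
      also have "\<dots> = B1 (J w)" by (simp add: z blinfun_linear flip: w)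
      finally have "op_inverse (scalar_op l - A) (B1 (J w)) = z"
        using resolvent_equation(2) [OF is_adj_complex_linear [OF A] bounds(5), of z] by simp
      then have "(fadj B o\<^sub>L op_inverse X o\<^sub>L op_inverse (scalar_op l - A) o\<^sub>L B o\<^sub>L J) w = 2 *\<^sub>R Cp z"
        unfolding fB by (simp add: B_def Xinv Cp_def blinfun_linear)
      then have M: "(fadj B o\<^sub>L op_inverse X o\<^sub>L op_inverse (scalar_op l - A) o\<^sub>L B o\<^sub>L J) w = 2 *\<^sub>R (w - x)"
        unfolding z(2) using w by (metis add_diff_cancel_left')
      have "S0 l w + w = 2 *\<^sub>R x" using UVx [of x] by (simp only: w)
      then have "S0 l w = 2 *\<^sub>R x - w" by (simp add: eq_diff_eq)
      also have "\<dots> = w - 2 *\<^sub>R (w - x)" by (simp add: scaleR_2 algebra_simps)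
      finally show "S0 l w = (id_blinfun - (fadj B o\<^sub>L op_inverse X o\<^sub>L op_inverse (scalar_op l - A) o\<^sub>L B o\<^sub>L J)) w"
        unfolding blinfun.diff_left M by simp
    qed
  qed
  show ?thesis using A Blin X Xinv(1) lyap main by blast
qed

lemma norm_shift_pair_le: "norm shift_pair \<le> 1"
proof -
  have S: "strict_mono Suc" by (simp add: strict_mono_def)
  have "norm (Push Suc) \<le> 1" "norm (- Pull Suc) \<le> 1"
    by (auto intro!: norm_blinfun_bound simp: Push_apply Pull_apply S norm_push norm_pull_le)
  then have "norm ((V0 o\<^sub>L Push Suc o\<^sub>L V0a) + (V1 o\<^sub>L (- Pull Suc) o\<^sub>L V1a)) \<le> 1"
    by (intro norm_direct_sum_le) auto
  also have "(V0 o\<^sub>L Push Suc o\<^sub>L V0a) + (V1 o\<^sub>L (- Pull Suc) o\<^sub>L V1a) = shift_pair"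
    by (intro blinfun_eqI) (simp add: shift_pair_def blinfun_linear)
  finally show ?thesis .
qed

text \<open>B has no component in the added summand, so the transfer function is unchanged, and the
  exchange Y solves the Lyapunov equation there with zero input. The one radius r serves as a bound
  for the norm of A and as the radius of the disc of spectrum.\<close>

lemma exterior_realization:
  fixes S0 :: "complex \<Rightarrow> 'e::{complex_hilbert, euclidean_space} \<Rightarrow>\<^sub>L 'e" and J :: "'e \<Rightarrow>\<^sub>L 'e"
  assumes hol: "\<And>u v. (\<lambda>l. cinner (S0 l u) v) holomorphic_on {l. \<rho> < cmod l}" and \<rho>: "0 < \<rho>"
    and lim: "(S0 \<longlongrightarrow> id_blinfun) at_infinity" and lin: "\<And>l. \<rho> < cmod l \<Longrightarrow> complex_linear (S0 l)"
    and J: "op_invertible J" "is_adj J J"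
    and sym: "\<And>l. \<rho> < cmod l \<Longrightarrow> fadj (S0 (- cnj l)) o\<^sub>L J o\<^sub>L S0 l = J"
  shows "\<exists>(A :: ell2 \<Rightarrow>\<^sub>L ell2) Aa B X r. is_adj A Aa \<and> complex_linear B \<and> is_adj X X \<and> op_invertible X \<and>
    (A o\<^sub>L X) + (X o\<^sub>L Aa) + (B o\<^sub>L J o\<^sub>L fadj B) = 0 \<and>
    \<rho> \<le> r \<and> norm A \<le> r \<and> resolvent_set A \<subseteq> {l. r < cmod l} \<and>
    (\<forall>l. r < cmod l \<longrightarrow> S0 l = id_blinfun - (fadj B o\<^sub>L op_inverse X o\<^sub>L op_inverse (scalar_op l - A) o\<^sub>L B o\<^sub>L J))"
proof -
  obtain A1 :: "ell2 \<Rightarrow>\<^sub>L ell2" and A1a B1 X1 r1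
    where A1: "is_adj A1 A1a" and B1: "complex_linear B1" and X1: "is_adj X1 X1" "op_invertible X1"
      and lyap1: "(A1 o\<^sub>L X1) + (X1 o\<^sub>L A1a) + (B1 o\<^sub>L J o\<^sub>L fadj B1) = 0"
      and S1: "\<forall>l. r1 < cmod l \<longrightarrow> S0 l = id_blinfun - (fadj B1 o\<^sub>L op_inverse X1 o\<^sub>L op_inverse (scalar_op l - A1) o\<^sub>L B1 o\<^sub>L J)"
    using lossless_realization [OF assms] by blast
  define r where "r = max \<rho> (max r1 (norm A1)) + 1"
  have r: "\<rho> \<le> r" "r1 < r" "norm A1 < r" "0 < r" using \<rho> by (auto simp: r_def)
  define Q where "Q = r *\<^sub>R shift_pair"
  define Qa where "Qa = r *\<^sub>R ((V0 o\<^sub>L Pull Suc o\<^sub>L V0a) - (V1 o\<^sub>L Push Suc o\<^sub>L V1a))"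
  define Y where "Y = (V0 o\<^sub>L V1a) + (V1 o\<^sub>L V0a)"
  have P: "is_adj (Push Suc) (Pull Suc)" by (rule is_adj_Push) (simp add: strict_mono_def)
  have Q: "is_adj Q Qa"
    using is_adj_scaleR [OF is_adj_diff [OF is_adj_compose [OF is_adj_compose [OF V_adj(1) P] V_adj(3)]
        is_adj_compose [OF is_adj_compose [OF V_adj(2) is_adj_sym [OF P]] V_adj(4)]], of r]
    by (simp add: Q_def Qa_def shift_pair_def blinfun_compose_assoc)
  have Y: "is_adj Y Y"
    using is_adj_add [OF is_adj_compose [OF V_adj(1) V_adj(4)] is_adj_compose [OF V_adj(2) V_adj(3)]]
    by (simp add: Y_def add.commute)
  have YY: "Y (Y x) = x" for x
    using V_sum [of x] by (simp add: Y_def blinfun_linear add.commute)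
  have sum_adj: "is_adj ((V0 o\<^sub>L R o\<^sub>L V0a) + (V1 o\<^sub>L R' o\<^sub>L V1a)) ((V0 o\<^sub>L Ra o\<^sub>L V0a) + (V1 o\<^sub>L Ra' o\<^sub>L V1a))"
    if "is_adj R Ra" "is_adj R' Ra'" for R R' Ra Ra'
    using is_adj_add [OF is_adj_compose [OF is_adj_compose [OF V_adj(1) that(1)] V_adj(3)]
        is_adj_compose [OF is_adj_compose [OF V_adj(2) that(2)] V_adj(4)]]
    by (simp add: blinfun_compose_assoc)
  define A where "A = (V0 o\<^sub>L A1 o\<^sub>L V0a) + (V1 o\<^sub>L Q o\<^sub>L V1a)"
  define Aa where "Aa = (V0 o\<^sub>L A1a o\<^sub>L V0a) + (V1 o\<^sub>L Qa o\<^sub>L V1a)"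
  define X where "X = (V0 o\<^sub>L X1 o\<^sub>L V0a) + (V1 o\<^sub>L Y o\<^sub>L V1a)"
  define Xi where "Xi = (V0 o\<^sub>L op_inverse X1 o\<^sub>L V0a) + (V1 o\<^sub>L Y o\<^sub>L V1a)"
  define B where "B = V0 o\<^sub>L B1"
  have A: "is_adj A Aa" unfolding A_def Aa_def by (rule sum_adj [OF A1 Q])
  have X: "is_adj X X" unfolding X_def by (rule sum_adj [OF X1(1) Y])
  have Blin: "complex_linear B"
    unfolding B_def by (intro complex_linear_compose B1 is_adj_complex_linear [OF V_adj(1)])
  have fB: "fadj B = fadj B1 o\<^sub>L V0a"
    by (rule is_adj_unique [OF is_adj_fadj [OF Blin]]) (unfold B_def, intro is_adj_compose V_adj is_adj_fadj B1)
  have "Xi (X x) = x" "X (Xi x) = x" for x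
    by (simp_all add: X_def Xi_def blinfun_linear op_inverse_apply [OF X1(2)] YY V_sum)
  then have Xinv: "op_inverse X = Xi" "op_invertible X"
    using op_inverse_blinfunI [of Xi X] by blast+
  have lyap: "(A o\<^sub>L X) + (X o\<^sub>L Aa) + (B o\<^sub>L J o\<^sub>L fadj B) = 0"
  proof (rule blinfun_eqI)
    fix x
    have "A1 (X1 y) + X1 (A1a y) + B1 (J (fadj B1 y)) = 0" for y
      using arg_cong [OF lyap1, of "\<lambda>F. blinfun_apply F y"] by (simp add: blinfun.add_left)
    then have "V0 (A1 (X1 (V0a x)) + X1 (A1a (V0a x)) + B1 (J (fadj B1 (V0a x)))) = 0" by simp
    moreover have "Q (Y y) + Y (Qa y) = 0" for y
      by (simp add: Q_def Qa_def Y_def shift_pair_def blinfun_linear scaleR_diff_right)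
    then have "V1 (Q (Y (V1a x)) + Y (Qa (V1a x))) = 0" by simp
    ultimately show "((A o\<^sub>L X) + (X o\<^sub>L Aa) + (B o\<^sub>L J o\<^sub>L fadj B)) x = blinfun_apply 0 x"
      unfolding fB by (simp add: A_def Aa_def X_def B_def blinfun_linear) (simp add: algebra_simps)
  qed
  have normA: "norm A \<le> r"
    unfolding A_def using r norm_shift_pair_le by (intro norm_direct_sum_le) (auto simp: Q_def)
  have res: "resolvent_set A \<subseteq> {l. r < cmod l}"
  proof (rule ccontr)
    assume "\<not> resolvent_set A \<subseteq> {l. r < cmod l}"
    then obtain l where "l \<in> resolvent_set A" "\<not> r < cmod l" by auto
    then have l: "op_invertible (scalar_op l - A)" "cmod l \<le> r" by (auto simp: resolvent_set_def)
    \<comment> \<open>The vector \<open>V1 (V0 (ket 0))\<close> would have to lie in the range of l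
      - A, which \<open>shift_spectrum\<close> excludes for |l| \<le> r.\<close>
    define y where "y = op_inverse (scalar_op l - A) (V1 (V0 (ket 0)))"
    have "l *\<^sub>C y - A y = V1 (V0 (ket 0))"
      using op_inverse_apply(2) [OF l(1), of "V1 (V0 (ket 0))"] by (simp add: y_def blinfun.diff_left)
    then have "V0a (V1a (l *\<^sub>C y - A y)) = ket 0" by simp
    moreover have "V0a (V1a (l *\<^sub>C y)) = l *\<^sub>C V0a (V1a y)"
      using V_adj(3,4) [THEN is_adj_complex_linear] by (simp add: complex_linearD)
    moreover have "V0a (V1a (A y)) = r *\<^sub>R Push Suc (V0a (V1a y))"
      by (simp add: A_def Q_def shift_pair_def blinfun_linear)
    ultimately have "l *\<^sub>C V0a (V1a y) - r *\<^sub>R Push Suc (V0a (V1a y)) = ket 0"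
      by (simp add: blinfun_linear)
    then show False using shift_spectrum [OF l(2) r(4)] by blast
  qed
  have "S0 l = id_blinfun - (fadj B o\<^sub>L op_inverse X o\<^sub>L op_inverse (scalar_op l - A) o\<^sub>L B o\<^sub>L J)" if l: "r < cmod l" for l
  proof -
    have b: "norm A1 < cmod l" "norm A < cmod l" "r1 < cmod l" using l r normA by auto
    have "op_inverse (scalar_op l - A) (V0 y) = V0 (op_inverse (scalar_op l - A1) y)" for y
    proof -
      define z where "z = op_inverse (scalar_op l - A1) y"
      have "l *\<^sub>C z - A1 z = y"
        unfolding z_def by (rule resolvent_equation [OF is_adj_complex_linear [OF A1] b(1)])
      then have "V0 (l *\<^sub>C z - A1 z) = V0 y" by simp
      then have "l *\<^sub>C V0 z - A (V0 z) = V0 y"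
        using complex_linearD [OF is_adj_complex_linear [OF V_adj(1)], of l z]
        by (simp add: A_def blinfun_linear)
      then show ?thesis
        using resolvent_equation(2) [OF is_adj_complex_linear [OF A] b(2), of "V0 z"] by (simp add: z_def)
    qed
    then have "fadj B o\<^sub>L op_inverse X o\<^sub>L op_inverse (scalar_op l - A) o\<^sub>L B o\<^sub>L J
      = fadj B1 o\<^sub>L op_inverse X1 o\<^sub>L op_inverse (scalar_op l - A1) o\<^sub>L B1 o\<^sub>L J"
      unfolding fB by (intro blinfun_eqI) (simp add: B_def Xinv Xi_def blinfun_linear)
    then show ?thesis using S1 b(3) by simp
  qed
  then show ?thesis using A Blin X Xinv(2) lyap r(1) normA res by blast
qed

section \<open>Evolution in the real variable\<close>

lemma has_integral_mult_power_fact: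
  fixes m :: "real \<Rightarrow> real"
  assumes m: "m absolutely_integrable_on {a..b}" and x: "x \<in> {a..b}"
  shows "((\<lambda>t. m t * (C * (integral {a..t} m ^ n / fact n))) has_integral C * (integral {a..x} m ^ Suc n / fact (Suc n))) {a..x}"
proof -
  have "((\<lambda>t. C / fact n * (m t * integral {a..t} m ^ n)) has_integral C / fact n * (integral {a..x} m ^ Suc n / Suc n)) {a..x}"
    by (intro has_integral_mult_right integral_mult_power_indefinite_integral [OF m x])
  then show ?thesis by (simp add: mult_ac)
qed

text \<open>Gronwall for a family in which each member is controlled by bounds on all the others.
  The supremum over the family need not be measurable in t, so only explicit bounds \<phi> are
  integrated, starting from the constant M; after n rounds the bound is M \<kappa>^n / n!, with
  \<kappa> the integral of \<open>m\<close>.\<close>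

lemma iterated_integral_bound_imp_zero:
  fixes m :: "real \<Rightarrow> real" and G :: "'i \<Rightarrow> real \<Rightarrow> 'b::real_normed_vector"
  assumes m: "m absolutely_integrable_on {a..b}"
    and bound: "\<And>i t. i \<in> I \<Longrightarrow> t \<in> {a..b} \<Longrightarrow> norm (G i t) \<le> M"
    and step: "\<And>i x \<phi> c. i \<in> I \<Longrightarrow> x \<in> {a..b} \<Longrightarrow> (\<And>j t. j \<in> I \<Longrightarrow> t \<in> {a..x} \<Longrightarrow> norm (G j t) \<le> \<phi> t) \<Longrightarrow>
      ((\<lambda>t. m t * \<phi> t) has_integral c) {a..x} \<Longrightarrow> norm (G i x) \<le> c"
    and "i \<in> I" "x \<in> {a..b}"
  shows "G i x = 0"
proof -
  have le: "norm (G i x) \<le> M * (integral {a..x} m ^ n / fact n)" if "i \<in> I" "x \<in> {a..b}" for i x n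
    using that
  proof (induction n arbitrary: i x)
    case (Suc n)
    show ?case
      by (rule step [OF Suc.prems _ has_integral_mult_power_fact [OF m Suc.prems(2)]]) (use Suc in auto)
  qed (use bound in auto)
  have "summable (\<lambda>n. M * (integral {a..x} m ^ n / fact n))"
    using summable_exp_generic [of "integral {a..x} m"] by (intro summable_mult) (simp add: divide_inverse_commute)
  then have "(\<lambda>n. M * (integral {a..x} m ^ n / fact n)) \<longlonglongrightarrow> 0" by (rule summable_LIMSEQ_zero)
  then have "norm (G i x) \<le> 0"
    by (rule LIMSEQ_le_const) (use le [OF assms(4,5)] in auto)
  then show ?thesis by simp
qed

text \<open>Iterating the integral inequality builds the partial sums of the exponential series,
  with a remainder M \<kappa>^n / n! that tends to 0.\<close>

lemma gronwall_ae:
  fixes G :: "real \<Rightarrow> 'b::banach"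
  assumes G: "has_ae_derivative_on G g {a..b}" and m: "m absolutely_integrable_on {a..b}" "\<And>x. 0 \<le> m x"
    and le: "\<And>x. x \<in> {a..b} \<Longrightarrow> norm (g x) \<le> m x * norm (G x)" and x: "x \<in> {a..b}"
  shows "norm (G x) \<le> norm (G a) * exp (integral {a..x} m)"
proof -
  let ?\<kappa> = "\<lambda>t. integral {a..t} m"
  obtain M where M: "\<forall>x\<in>{a..b}. norm (G x) \<le> M"
    using continuous_on_interval_bounded [OF has_ae_derivative_on_imp_continuous_on [OF G]] by blast
  have bound: "norm (G x) \<le> (\<Sum>k<n. norm (G a) * (?\<kappa> x ^ k / fact k)) + M * (?\<kappa> x ^ n / fact n)"
    if "x \<in> {a..b}" for n x
    using that
  proof (induction n arbitrary: x)
    case (Suc n)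
    let ?\<phi> = "\<lambda>t. (\<Sum>k<n. norm (G a) * (?\<kappa> t ^ k / fact k)) + M * (?\<kappa> t ^ n / fact n)"
    have I: "((\<lambda>t. m t * ?\<phi> t) has_integral (\<Sum>k<n. norm (G a) * (?\<kappa> x ^ Suc k / fact (Suc k))) + M * (?\<kappa> x ^ Suc n / fact (Suc n))) {a..x}"
      unfolding distrib_left sum_distrib_left
      by (intro has_integral_add has_integral_sum has_integral_mult_power_fact [OF m(1) Suc.prems] finite_lessThan)
    note g = has_ae_derivative_on_eq_integral [OF G Suc.prems]
    have "norm (integral {a..x} g) \<le> integral {a..x} (\<lambda>t. m t * ?\<phi> t)"
    proof (rule Henstock_Kurzweil_Integration.integral_norm_bound_integral)
      show "g integrable_on {a..x}" using g(1) by blast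
      show "(\<lambda>t. m t * ?\<phi> t) integrable_on {a..x}" using I by blast
      fix t assume "t \<in> {a..x}"
      then have t: "t \<in> {a..b}" using Suc.prems by auto
      have "norm (g t) \<le> m t * norm (G t)" by (rule le [OF t])
      also have "\<dots> \<le> m t * ?\<phi> t" by (intro mult_left_mono Suc.IH t m(2))
      finally show "norm (g t) \<le> m t * ?\<phi> t" .
    qed
    also have "\<dots> = (\<Sum>k<n. norm (G a) * (?\<kappa> x ^ Suc k / fact (Suc k))) + M * (?\<kappa> x ^ Suc n / fact (Suc n))"
      using I by (rule integral_unique)
    finally have "norm (G x) \<le> norm (G a) + ((\<Sum>k<n. norm (G a) * (?\<kappa> x ^ Suc k / fact (Suc k))) + M * (?\<kappa> x ^ Suc n / fact (Suc n)))"
      unfolding g(2) by (rule order_trans [OF norm_triangle_ineq add_left_mono])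
    also have "\<dots> = (\<Sum>k<Suc n. norm (G a) * (?\<kappa> x ^ k / fact k)) + M * (?\<kappa> x ^ Suc n / fact (Suc n))"
      by (subst sum.lessThan_Suc_shift) simp
    finally show ?case .
  qed (use M in auto)
  have s: "(\<lambda>n. ?\<kappa> x ^ n / fact n) sums exp (?\<kappa> x)"
    using exp_converges [of "?\<kappa> x"] by (simp add: divide_inverse_commute)
  have "(\<lambda>n. (\<Sum>k<n. norm (G a) * (?\<kappa> x ^ k / fact k)) + M * (?\<kappa> x ^ n / fact n)) \<longlonglongrightarrow> norm (G a) * exp (?\<kappa> x) + M * 0"
    using sums_mult [OF s, of "norm (G a)"] summable_LIMSEQ_zero [OF sums_summable [OF s]]
    by (intro tendsto_intros) (simp_all add: sums_def)
  then show ?thesis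
    by (intro LIMSEQ_le_const [where X = "\<lambda>n. (\<Sum>k<n. norm (G a) * (?\<kappa> x ^ k / fact k)) + M * (?\<kappa> x ^ n / fact n)"])
       (use bound [OF x] in auto)
qed

lemma has_ae_derivative_on_zero_const:
  fixes F :: "real \<Rightarrow> 'b::banach"
  assumes "has_ae_derivative_on F (\<lambda>_. 0) {a..b}" "x \<in> {a..b}"
  shows "F x = F a"
  using has_ae_derivative_on_eq_integral(2) [OF assms] by simp

text \<open>The vessel parameters give \<sigma>1 a derivative at every point. Integrability of that
  derivative and the fundamental theorem make \<sigma>1 an indefinite integral, hence absolutely
  continuous.\<close>

lemma strong_L1_imp_has_ae_derivative:
  fixes F :: "real \<Rightarrow> 'b::banach"
  assumes f: "strong_L1 a b f" and F: "\<And>x. x \<in> {a..b} \<Longrightarrow> (F has_vector_derivative f x) (at x within {a..b})"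
  shows "has_ae_derivative_on F f {a..b}"
proof -
  have "has_ae_derivative_on (\<lambda>x. F a + integral {a..x} f) (\<lambda>x. 0 + f x) {a..b}"
    by (intro has_ae_derivative_on_add has_ae_derivative_on_const has_ae_derivative_on_indefinite_integral f)
  moreover have "F a + integral {a..x} f = F x" if x: "x \<in> {a..b}" for x
  proof -
    have "(f has_integral (F x - F a)) {a..x}"
      using x by (intro fundamental_theorem_of_calculus) (auto intro: has_vector_derivative_within_subset [OF F])
    then show ?thesis by (simp add: integral_unique)
  qed
  ultimately show ?thesis by (rule has_ae_derivative_on_cong) simp_all
qed

section \<open>Coefficients multiplied by the inverse of \<sigma>1\<close>

locale vessel_coefficients =
  fixes \<sigma>1 \<sigma>2 \<gamma> \<gamma>s :: "real \<Rightarrow> ('e::{complex_hilbert, euclidean_space}) \<Rightarrow>\<^sub>L 'e" and a b :: real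
  assumes params: "vessel_parameters \<sigma>1 \<sigma>2 \<gamma> \<gamma>s a b"
begin

text \<open>In these terms the input and output equations read u' = (l s + q) u and y' = (l s + p)
  y.\<close>

definition "si x = op_inverse (\<sigma>1 x)"
definition "s x = si x o\<^sub>L \<sigma>2 x"
definition "q x = si x o\<^sub>L \<gamma> x"
definition "p x = si x o\<^sub>L \<gamma>s x"

lemma a_less_b: "a < b" using params by (simp add: vessel_parameters_def)

lemma complex_linear_params: "x \<in> {a..b} \<Longrightarrow> complex_linear (\<sigma>1 x)" "x \<in> {a..b} \<Longrightarrow> complex_linear (\<sigma>2 x)"
  "x \<in> {a..b} \<Longrightarrow> complex_linear (\<gamma> x)" "x \<in> {a..b} \<Longrightarrow> complex_linear (\<gamma>s x)"
  using params by (simp_all add: vessel_parameters_def)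

lemma strong_L1_params: "strong_L1 a b \<sigma>1" "strong_L1 a b \<sigma>2" "strong_L1 a b \<gamma>" "strong_L1 a b \<gamma>s"
  using params by (auto simp: vessel_parameters_def locally_integrable_on_def intro: strong_L1_blinfun)

lemma op_invertible_sigma1: "x \<in> {a..b} \<Longrightarrow> op_invertible (\<sigma>1 x)"
  using params by (simp add: vessel_parameters_def)

lemma si_simps [simp]: "x \<in> {a..b} \<Longrightarrow> si x (\<sigma>1 x u) = u" "x \<in> {a..b} \<Longrightarrow> \<sigma>1 x (si x u) = u"
  using op_inverse_apply [OF op_invertible_sigma1] by (simp_all add: si_def)

lemma selfadj: "x \<in> {a..b} \<Longrightarrow> is_adj (\<sigma>1 x) (\<sigma>1 x)" "x \<in> {a..b} \<Longrightarrow> is_adj (\<sigma>2 x) (\<sigma>2 x)"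
  "x \<in> {a..b} \<Longrightarrow> is_adj (si x) (si x)"
proof -
  assume x: "x \<in> {a..b}"
  show 1: "is_adj (\<sigma>1 x) (\<sigma>1 x)"
    using is_adj_fadj [OF complex_linear_params(1) [OF x]] adj_eq_fadj [OF complex_linear_params(1) [OF x]] params x
    by (simp add: vessel_parameters_def self_adjoint_def)
  show "is_adj (\<sigma>2 x) (\<sigma>2 x)"
    using is_adj_fadj [OF complex_linear_params(2) [OF x]] adj_eq_fadj [OF complex_linear_params(2) [OF x]] params x
    by (simp add: vessel_parameters_def self_adjoint_def)
  show "is_adj (si x) (si x)"
    unfolding si_def by (intro is_adj_op_inverse 1 op_invertible_sigma1 x)
qed

lemma si_lin: "x \<in> {a..b} \<Longrightarrow> complex_linear (si x)"
  by (rule is_adj_complex_linear [OF selfadj(3)])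

lemma complex_linear_quotients: "x \<in> {a..b} \<Longrightarrow> complex_linear (s x)" "x \<in> {a..b} \<Longrightarrow> complex_linear (q x)" "x \<in> {a..b} \<Longrightarrow> complex_linear (p x)"
  by (simp_all add: s_def q_def p_def complex_linear_compose si_lin complex_linear_params)

lemma \<sigma>1_ae: "has_ae_derivative_on \<sigma>1 (\<lambda>x. - (\<gamma> x + fadj (\<gamma> x))) {a..b}"
proof (rule strong_L1_imp_has_ae_derivative)
  show "strong_L1 a b (\<lambda>x. - (\<gamma> x + fadj (\<gamma> x)))"
    by (intro strong_L1_minus strong_L1.add strong_L1_linear [OF bounded_linear_fadj] strong_L1_params)
  fix x assume x: "x \<in> {a..b}"
  then show "(\<sigma>1 has_vector_derivative - (\<gamma> x + fadj (\<gamma> x))) (at x within {a..b})"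
    using params unfolding vessel_parameters_def adj_eq_fadj [OF complex_linear_params(3) [OF x], symmetric] by blast
qed

lemma si_cont: "continuous_on {a..b} si"
  unfolding si_def [abs_def]
  by (intro continuous_on_op_inverse op_invertible_sigma1 has_ae_derivative_on_imp_continuous_on [OF \<sigma>1_ae])

lemma si_ae: "has_ae_derivative_on si (\<lambda>x. si x o\<^sub>L (\<gamma> x + fadj (\<gamma> x)) o\<^sub>L si x) {a..b}"
proof -
  obtain M where M: "\<forall>x\<in>{a..b}. norm (si x) \<le> M" using continuous_on_interval_bounded [OF si_cont] by blast
  have "has_ae_derivative_on si (\<lambda>x. - (si x o\<^sub>L - (\<gamma> x + fadj (\<gamma> x)) o\<^sub>L si x)) {a..b}"
    by (rule has_ae_derivative_on_inverse [OF \<sigma>1_ae si_cont, of M]) (use M op_inverse_compose [OF op_invertible_sigma1] in \<open>auto simp: si_def\<close>)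
  then show ?thesis
    by (rule has_ae_derivative_on_cong) (auto intro!: AE_I2 blinfun_eqI simp: blinfun_linear)
qed

lemma strong_L1_quotients: "strong_L1 a b s" "strong_L1 a b q" "strong_L1 a b p"
  unfolding s_def [abs_def] q_def [abs_def] p_def [abs_def]
  by (intro strong_L1_bilinear' [OF bounded_bilinear_blinfun_compose] strong_L1_params si_cont)+

end

lemma op_has_ae_derivative_compose:
  fixes F :: "real \<Rightarrow> 'b::real_normed_vector \<Rightarrow>\<^sub>L 'c::real_normed_vector" and G :: "real \<Rightarrow> 'a::real_normed_vector \<Rightarrow>\<^sub>L 'b"
  assumes "has_ae_derivative_on F f {a..b}" "has_ae_derivative_on G g {a..b}"
  shows "has_ae_derivative_on (\<lambda>x. F x o\<^sub>L G x) (\<lambda>x. (F x o\<^sub>L g x) + (f x o\<^sub>L G x)) {a..b}"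
  by (rule has_ae_derivative_on_bilinear [OF bounded_bilinear_blinfun_compose assms])

lemma has_ae_derivative_on_eq_rhs:
  assumes "has_ae_derivative_on F f I" "\<And>x. x \<in> I \<Longrightarrow> f x = g x"
  shows "has_ae_derivative_on F g I"
  by (rule has_ae_derivative_on_cong [OF assms(1) refl]) (simp add: assms(2))

lemmas bounded_linear_compose_left = bounded_bilinear.bounded_linear_right [OF bounded_bilinear_blinfun_compose]
lemmas bounded_linear_compose_right = bounded_bilinear.bounded_linear_left [OF bounded_bilinear_blinfun_compose]

section \<open>Solving the vessel equations from the left endpoint\<close>

context vessel_coefficients
begin

abbreviation transfer :: "('h::complex_hilbert \<Rightarrow>\<^sub>L 'h) \<Rightarrow> (real \<Rightarrow> 'e \<Rightarrow>\<^sub>L 'h) \<Rightarrow> (real \<Rightarrow> 'h \<Rightarrow>\<^sub>L 'h) \<Rightarrow> complex \<Rightarrow> real \<Rightarrow> 'e \<Rightarrow>\<^sub>L 'e"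
  where "transfer A B X l x \<equiv>
    id_blinfun - (fadj (B x) o\<^sub>L op_inverse (X x) o\<^sub>L op_inverse (scalar_op l - A) o\<^sub>L B x o\<^sub>L \<sigma>1 x)"

text \<open>With \<open>c = \<sigma>1\<^sup>-\<^sup>1 \<gamma>s\<close> this is the derivative of a function that maps solutions of the input equation to
  solutions of the output equation.\<close>

abbreviation flow :: "complex \<Rightarrow> real \<Rightarrow> ('e \<Rightarrow>\<^sub>L 'e) \<Rightarrow> ('e \<Rightarrow>\<^sub>L 'e) \<Rightarrow> 'e \<Rightarrow>\<^sub>L 'e"
  where "flow l x c F \<equiv> (scalar_op l o\<^sub>L ((s x o\<^sub>L F) - (F o\<^sub>L s x))) + (c o\<^sub>L F) - (F o\<^sub>L q x)"

text \<open>The first vessel equation in the unknown Z = B \<sigma>1, for which no derivative of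
  \<sigma>1 occurs. Taken on \<open>'e\<close> with A = l I, it is also the equation for the inverse
  of a fundamental solution of the input equation.\<close>

lemma input_ode_exists:
  fixes A :: "'h::complex_hilbert \<Rightarrow>\<^sub>L 'h" and Z0 :: "'e \<Rightarrow>\<^sub>L 'h"
  shows "\<exists>Z. has_ae_derivative_on Z (\<lambda>x. - ((A o\<^sub>L Z x o\<^sub>L s x) + (Z x o\<^sub>L q x))) {a..b} \<and> Z a = Z0"
proof -
  obtain ms where ms: "ms absolutely_integrable_on {a..b}" "\<forall>x. 0 \<le> ms x" "\<forall>x\<in>{a..b}. norm (s x) \<le> ms x"
    using strong_L1_bound [OF strong_L1_quotients(1)] by blast
  obtain mq where mq: "mq absolutely_integrable_on {a..b}" "\<forall>x. 0 \<le> mq x" "\<forall>x\<in>{a..b}. norm (q x) \<le> mq x"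
    using strong_L1_bound [OF strong_L1_quotients(2)] by blast
  show ?thesis
  proof (rule linear_ode_solution [where K = "\<lambda>x Y. - ((A o\<^sub>L Y o\<^sub>L s x) + (Y o\<^sub>L q x))" and m = "\<lambda>x. norm A *\<^sub>R ms x + mq x"])
    show "strong_L1 a b (\<lambda>x. - ((A o\<^sub>L Y x o\<^sub>L s x) + (Y x o\<^sub>L q x)))" if "continuous_on {a..b} Y" for Y :: "real \<Rightarrow> 'e \<Rightarrow>\<^sub>L 'h"
      by (intro strong_L1_minus strong_L1.add strong_L1_bilinear' [OF bounded_bilinear_blinfun_compose] strong_L1_quotients that
          bounded_linear.continuous_on [OF bounded_linear_compose_left])
    show "(\<lambda>x. norm A *\<^sub>R ms x + mq x) absolutely_integrable_on {a..b}"
      by (intro set_integral_add absolutely_integrable_scaleR_left ms mq)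
    fix x and Y Z :: "'e \<Rightarrow>\<^sub>L 'h" assume x: "x \<in> {a..b}"
    have "- ((A o\<^sub>L Y o\<^sub>L s x) + (Y o\<^sub>L q x)) - - ((A o\<^sub>L Z o\<^sub>L s x) + (Z o\<^sub>L q x))
      = - ((A o\<^sub>L (Y - Z) o\<^sub>L s x) + ((Y - Z) o\<^sub>L q x))"
      by (intro blinfun_eqI) (simp add: blinfun_linear)
    also have "norm \<dots> \<le> norm (A o\<^sub>L (Y - Z) o\<^sub>L s x) + norm ((Y - Z) o\<^sub>L q x)"
      unfolding norm_minus_cancel by (rule norm_triangle_ineq)
    also have "\<dots> \<le> norm A * norm (Y - Z) * norm (s x) + norm (Y - Z) * norm (q x)"
      by (intro add_mono norm_blinfun_compose order_trans [OF norm_blinfun_compose] mult_right_mono norm_ge_zero)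
    also have "\<dots> \<le> norm A * norm (Y - Z) * ms x + norm (Y - Z) * mq x"
      using ms mq x by (intro add_mono mult_left_mono) auto
    finally show "norm (- ((A o\<^sub>L Y o\<^sub>L s x) + (Y o\<^sub>L q x)) - - ((A o\<^sub>L Z o\<^sub>L s x) + (Z o\<^sub>L q x))) \<le> (norm A *\<^sub>R ms x + mq x) * norm (Y - Z)"
      by (simp add: algebra_simps)
  qed (use ms mq a_less_b in auto)
qed

lemma input_ode_unique:
  fixes A :: "'h::complex_hilbert \<Rightarrow>\<^sub>L 'h"
  assumes G: "has_ae_derivative_on G (\<lambda>x. - ((A o\<^sub>L G x o\<^sub>L s x) + (G x o\<^sub>L q x))) {a..b}" and "G a = 0" and x: "x \<in> {a..b}"
  shows "G x = 0"
proof -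
  obtain ms where ms: "ms absolutely_integrable_on {a..b}" "\<forall>x. 0 \<le> ms x" "\<forall>x\<in>{a..b}. norm (s x) \<le> ms x"
    using strong_L1_bound [OF strong_L1_quotients(1)] by blast
  obtain mq where mq: "mq absolutely_integrable_on {a..b}" "\<forall>x. 0 \<le> mq x" "\<forall>x\<in>{a..b}. norm (q x) \<le> mq x"
    using strong_L1_bound [OF strong_L1_quotients(2)] by blast
  have "norm (G x) \<le> norm (G a) * exp (integral {a..x} (\<lambda>x. norm A *\<^sub>R ms x + mq x))"
  proof (rule gronwall_ae [OF G _ _ _ x])
    show "(\<lambda>x. norm A *\<^sub>R ms x + mq x) absolutely_integrable_on {a..b}"
      by (intro set_integral_add absolutely_integrable_scaleR_left ms mq)
    fix x assume x: "x \<in> {a..b}"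
    have "norm (- ((A o\<^sub>L G x o\<^sub>L s x) + (G x o\<^sub>L q x))) \<le> norm (A o\<^sub>L G x o\<^sub>L s x) + norm (G x o\<^sub>L q x)"
      unfolding norm_minus_cancel by (rule norm_triangle_ineq)
    also have "\<dots> \<le> norm A * norm (G x) * norm (s x) + norm (G x) * norm (q x)"
      by (intro add_mono norm_blinfun_compose order_trans [OF norm_blinfun_compose] mult_right_mono norm_ge_zero)
    also have "\<dots> \<le> norm A * norm (G x) * ms x + norm (G x) * mq x"
      using ms mq x by (intro add_mono mult_left_mono) auto
    finally show "norm (- ((A o\<^sub>L G x o\<^sub>L s x) + (G x o\<^sub>L q x))) \<le> (norm A *\<^sub>R ms x + mq x) * norm (G x)"
      by (simp add: algebra_simps)
  qed (use ms mq in auto)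
  then show ?thesis using \<open>G a = 0\<close> by simp
qed

text \<open>The defect of commuting with a fixed scalar solves the same equation with initial value
  0.\<close>

lemma input_ode_complex_linear:
  fixes A :: "'h::complex_hilbert \<Rightarrow>\<^sub>L 'h"
  assumes Z: "has_ae_derivative_on Z (\<lambda>x. - ((A o\<^sub>L Z x o\<^sub>L s x) + (Z x o\<^sub>L q x))) {a..b}"
    and A: "complex_linear A" and "complex_linear (Z a)" and x: "x \<in> {a..b}"
  shows "complex_linear (Z x)"
  unfolding complex_linear_def
proof (intro allI)
  fix c u
  define G where "G x = (Z x o\<^sub>L scalar_op c) - (scalar_op c o\<^sub>L Z x)" for x
  have "has_ae_derivative_on G (\<lambda>x. (- ((A o\<^sub>L Z x o\<^sub>L s x) + (Z x o\<^sub>L q x)) o\<^sub>L scalar_op c) - (scalar_op c o\<^sub>L - ((A o\<^sub>L Z x o\<^sub>L s x) + (Z x o\<^sub>L q x)))) {a..b}"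
    unfolding G_def [abs_def]
    by (intro has_ae_derivative_on_diff has_ae_derivative_on_linear [OF bounded_linear_compose_left] has_ae_derivative_on_linear [OF bounded_linear_compose_right] Z)
  then have "has_ae_derivative_on G (\<lambda>x. - ((A o\<^sub>L G x o\<^sub>L s x) + (G x o\<^sub>L q x))) {a..b}"
  proof (rule has_ae_derivative_on_eq_rhs)
    fix x assume "x \<in> {a..b}"
    then show "(- ((A o\<^sub>L Z x o\<^sub>L s x) + (Z x o\<^sub>L q x)) o\<^sub>L scalar_op c) - (scalar_op c o\<^sub>L - ((A o\<^sub>L Z x o\<^sub>L s x) + (Z x o\<^sub>L q x)))
      = - ((A o\<^sub>L G x o\<^sub>L s x) + (G x o\<^sub>L q x))"
      by (intro blinfun_eqI) (simp add: G_def blinfun_linear complex_linearD [OF A] complex_linearD [OF complex_linear_quotients(1)] complex_linearD [OF complex_linear_quotients(2)]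
          scaleC_add_right bounded_bilinear.minus_right [OF bounded_bilinear_scaleC] algebra_simps)
  qed
  moreover have "G a = 0"
    by (intro blinfun_eqI) (simp add: G_def blinfun.diff_left complex_linearD [OF assms(3)])
  ultimately have "G x = 0" using x by (rule input_ode_unique)
  from arg_cong [OF this, of "\<lambda>F. blinfun_apply F u"] show "Z x (c *\<^sub>C u) = c *\<^sub>C Z x u"
    by (simp add: G_def blinfun.diff_left)
qed

text \<open>The vessel conditions that the construction provides; the relation between \<gamma> and
  \<open>\<gamma>s\<close> is left for later. The derivative of the adjoint of B is recorded as
  well, since the transfer function is differentiated through it.\<close>

definition evolves :: "('h::complex_hilbert \<Rightarrow>\<^sub>L 'h) \<Rightarrow> ('h \<Rightarrow>\<^sub>L 'h) \<Rightarrow> (real \<Rightarrow> 'e \<Rightarrow>\<^sub>L 'h) \<Rightarrow> (real \<Rightarrow> 'h \<Rightarrow>\<^sub>L 'h) \<Rightarrow> real \<Rightarrow> bool"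
  where "evolves A Aa B X d \<longleftrightarrow>
    (\<forall>x\<in>{a..d}. complex_linear (B x) \<and> is_adj (X x) (X x) \<and> op_invertible (X x) \<and>
      (A o\<^sub>L X x) + (X x o\<^sub>L Aa) + (B x o\<^sub>L \<sigma>1 x o\<^sub>L fadj (B x)) = 0) \<and>
    has_ae_derivative_on (\<lambda>x. B x o\<^sub>L \<sigma>1 x) (\<lambda>x. - ((A o\<^sub>L B x o\<^sub>L \<sigma>2 x) + (B x o\<^sub>L \<gamma> x))) {a..d} \<and>
    has_ae_derivative_on X (\<lambda>x. B x o\<^sub>L \<sigma>2 x o\<^sub>L fadj (B x)) {a..d} \<and>
    has_ae_derivative_on (\<lambda>x. fadj (B x)) (\<lambda>x. (q x o\<^sub>L fadj (B x)) - (s x o\<^sub>L fadj (B x) o\<^sub>L Aa)) {a..d}"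

text \<open>Z solves a linear equation and X is then an integral. The Lyapunov expression and the
  symmetry defect of X have derivative 0, so both conditions are inherited from \<open>a\<close>;
  only the invertibility of X calls for a shorter interval.\<close>

lemma vessel_evolution:
  fixes A Aa X0 :: "'h::complex_hilbert \<Rightarrow>\<^sub>L 'h" and B0 :: "'e \<Rightarrow>\<^sub>L 'h"
  assumes A: "is_adj A Aa" and B0: "complex_linear B0" and X0: "is_adj X0 X0" "op_invertible X0"
    and lyap: "(A o\<^sub>L X0) + (X0 o\<^sub>L Aa) + (B0 o\<^sub>L \<sigma>1 a o\<^sub>L fadj B0) = 0"
  shows "\<exists>B X d. a < d \<and> d \<le> b \<and> B a = B0 \<and> X a = X0 \<and> 
    evolves A Aa B X d"
proof -
  have Alin: "complex_linear A" by (rule is_adj_complex_linear [OF A])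
  obtain Z where Z: "has_ae_derivative_on Z (\<lambda>x. - ((A o\<^sub>L Z x o\<^sub>L s x) + (Z x o\<^sub>L q x))) {a..b}" and Za: "Z a = B0 o\<^sub>L \<sigma>1 a"
    using input_ode_exists [of A "B0 o\<^sub>L \<sigma>1 a"] by blast
  have aI: "a \<in> {a..b}" using a_less_b by simp
  have Zlin: "complex_linear (Z x)" if "x \<in> {a..b}" for x
    by (rule input_ode_complex_linear [OF Z Alin _ that]) (simp add: Za complex_linear_compose B0 complex_linear_params(1) [OF aI])
  define B where "B x = Z x o\<^sub>L si x" for x
  have BZ: "B x (\<sigma>1 x u) = Z x u" if "x \<in> {a..b}" for x u
    using that by (simp add: B_def)
  have Blin: "complex_linear (B x)" if "x \<in> {a..b}" for x
    unfolding B_def by (intro complex_linear_compose Zlin si_lin that)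
  define Bs where "Bs x = fadj (B x)" for x
  have Bs: "is_adj (B x) (Bs x)" if "x \<in> {a..b}" for x
    unfolding Bs_def by (rule is_adj_fadj [OF Blin [OF that]])
  \<comment> \<open>The \<gamma> in the derivative of the inverse of \<sigma>1 cancels the \<gamma>
    in the equation of Z; only its adjoint survives.\<close>
  have Bae: "has_ae_derivative_on B (\<lambda>x. (B x o\<^sub>L fadj (\<gamma> x) o\<^sub>L si x) - (A o\<^sub>L B x o\<^sub>L \<sigma>2 x o\<^sub>L si x)) {a..b}"
    unfolding B_def
    by (rule has_ae_derivative_on_eq_rhs [OF op_has_ae_derivative_compose [OF Z si_ae]])
       (intro blinfun_eqI, simp add: blinfun_linear s_def q_def)
  have Bcont: "continuous_on {a..b} B" by (rule has_ae_derivative_on_imp_continuous_on [OF Bae])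
  have Bsae: "has_ae_derivative_on Bs (\<lambda>x. (q x o\<^sub>L Bs x) - (s x o\<^sub>L Bs x o\<^sub>L Aa)) {a..b}"
    unfolding Bs_def [abs_def]
  proof (rule has_ae_derivative_on_eq_rhs [OF has_ae_derivative_on_linear [OF bounded_linear_fadj Bae]])
    fix x assume x: "x \<in> {a..b}"
    have "is_adj ((B x o\<^sub>L fadj (\<gamma> x) o\<^sub>L si x) - (A o\<^sub>L B x o\<^sub>L \<sigma>2 x o\<^sub>L si x))
      ((si x o\<^sub>L (\<gamma> x o\<^sub>L Bs x)) - (si x o\<^sub>L (\<sigma>2 x o\<^sub>L (Bs x o\<^sub>L Aa))))"
      by (intro is_adj_diff is_adj_compose A Bs selfadj x is_adj_sym [OF is_adj_fadj [OF complex_linear_params(3) [OF x]]])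
    from is_adj_unique [OF is_adj_fadj [OF is_adj_complex_linear [OF this]] this]
    show "fadj ((B x o\<^sub>L fadj (\<gamma> x) o\<^sub>L si x) - (A o\<^sub>L B x o\<^sub>L \<sigma>2 x o\<^sub>L si x)) = (q x o\<^sub>L fadj (B x)) - (s x o\<^sub>L fadj (B x) o\<^sub>L Aa)"
      by (simp add: q_def s_def Bs_def blinfun_compose_assoc)
  qed
  have XL1: "strong_L1 a b (\<lambda>x. B x o\<^sub>L \<sigma>2 x o\<^sub>L Bs x)"
    by (intro strong_L1_bilinear [OF bounded_bilinear_blinfun_compose] strong_L1_bilinear' [OF bounded_bilinear_blinfun_compose] strong_L1_params Bcont
        has_ae_derivative_on_imp_continuous_on [OF Bsae])
  define X where "X x = X0 + integral {a..x} (\<lambda>x. B x o\<^sub>L \<sigma>2 x o\<^sub>L Bs x)" for x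
  have "has_ae_derivative_on X (\<lambda>x. 0 + (B x o\<^sub>L \<sigma>2 x o\<^sub>L Bs x)) {a..b}"
    unfolding X_def [abs_def]
    by (intro has_ae_derivative_on_add has_ae_derivative_on_const has_ae_derivative_on_indefinite_integral XL1)
  then have Xae: "has_ae_derivative_on X (\<lambda>x. B x o\<^sub>L \<sigma>2 x o\<^sub>L Bs x) {a..b}" by simp
  have Xa: "X a = X0" by (simp add: X_def)
  have Ba: "B a = B0"
    using aI by (intro blinfun_eqI) (simp add: B_def Za)
  have Xadj: "is_adj (X x) (X x)" if x: "x \<in> {a..b}" for x
    unfolding is_adj_def
  proof (intro allI)
    fix u v
    \<comment> \<open>For fixed u and v the symmetry defect is a bounded linear functional of the
      operator, so it can be differentiated along X.\<close>
    let ?h = "\<lambda>T::'h \<Rightarrow>\<^sub>L 'h. cinner (T u) v - cinner u (T v)"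
    have h: "bounded_linear ?h"
      by (intro bounded_linear_sub bounded_linear_compose [OF bounded_bilinear.bounded_linear_left [OF bounded_bilinear_cinner]]
          bounded_linear_compose [OF bounded_bilinear.bounded_linear_right [OF bounded_bilinear_cinner]] blinfun.bounded_linear_left)
    have "has_ae_derivative_on (\<lambda>x. ?h (X x)) (\<lambda>x. 0) {a..b}"
    proof (rule has_ae_derivative_on_eq_rhs [OF has_ae_derivative_on_linear [OF h Xae]])
      fix x assume x: "x \<in> {a..b}"
      have "is_adj (B x o\<^sub>L \<sigma>2 x o\<^sub>L Bs x) (B x o\<^sub>L (\<sigma>2 x o\<^sub>L Bs x))"
        by (intro is_adj_compose Bs is_adj_sym [OF Bs] selfadj x)
      then show "?h (B x o\<^sub>L \<sigma>2 x o\<^sub>L Bs x) = 0" by (simp add: is_adj_def)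
    qed
    from has_ae_derivative_on_zero_const [OF this x] show "cinner (X x u) v = cinner u (X x v)"
      using is_adjD [OF X0(1), of u v] by (simp add: Xa)
  qed
  have Lyap: "(A o\<^sub>L X x) + (X x o\<^sub>L Aa) + (Z x o\<^sub>L Bs x) = 0" if x: "x \<in> {a..b}" for x
  proof -
    have "has_ae_derivative_on (\<lambda>x. (A o\<^sub>L X x) + (X x o\<^sub>L Aa) + (Z x o\<^sub>L Bs x)) (\<lambda>x. 0) {a..b}"
    proof (rule has_ae_derivative_on_eq_rhs [OF has_ae_derivative_on_add [OF has_ae_derivative_on_add 
          [OF has_ae_derivative_on_linear [OF bounded_linear_compose_left Xae] has_ae_derivative_on_linear [OF bounded_linear_compose_right Xae]]
          op_has_ae_derivative_compose [OF Z Bsae]]])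
      fix x assume "x \<in> {a..b}"
      show "(A o\<^sub>L (B x o\<^sub>L \<sigma>2 x o\<^sub>L Bs x)) + (B x o\<^sub>L \<sigma>2 x o\<^sub>L Bs x o\<^sub>L Aa) +
        ((Z x o\<^sub>L (q x o\<^sub>L Bs x) - (s x o\<^sub>L Bs x o\<^sub>L Aa)) + (- ((A o\<^sub>L Z x o\<^sub>L s x) + (Z x o\<^sub>L q x)) o\<^sub>L Bs x)) = 0"
        by (intro blinfun_eqI) (simp add: blinfun_linear B_def s_def)
    qed
    from has_ae_derivative_on_zero_const [OF this x]
    show ?thesis using lyap by (simp add: Xa Za Bs_def Ba)
  qed
  have Xcont: "continuous_on {a..b} X" by (rule has_ae_derivative_on_imp_continuous_on [OF Xae])
  obtain d where d: "a < d" "d \<le> b" "\<And>x. x \<in> {a..d} \<Longrightarrow> op_invertible (X x)"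
  proof -
    define \<epsilon> where "\<epsilon> = 1 / (2 * (norm (op_inverse X0) + 1))"
    have "\<epsilon> > 0" by (simp add: \<epsilon>_def add_nonneg_pos)
    then obtain r where r: "r > 0" "\<forall>y\<in>{a..b}. dist y a < r \<longrightarrow> dist (X y) (X a) < \<epsilon>"
      using Xcont aI unfolding continuous_on_iff by blast
    define d where "d = min b (a + r/2)"
    have "op_invertible (X x)" if "x \<in> {a..d}" for x
    proof (rule op_invertible_perturbation(1) [OF X0(2)])
      have "norm (X x - X0) < \<epsilon>" using r that Xa by (auto simp: d_def dist_norm)
      then have "norm (X x - X0) * norm (op_inverse X0) \<le> \<epsilon> * (norm (op_inverse X0) + 1)"
        using \<open>\<epsilon> > 0\<close> by (intro mult_mono) auto
      also have "\<dots> = 1/2" using add_nonneg_pos [of "norm (op_inverse X0)" 1] by (simp add: \<epsilon>_def divide_simps)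
      finally show "norm (X x - X0) * norm (op_inverse X0) \<le> 1/2" .
    qed
    moreover have "a < d" "d \<le> b" using r a_less_b by (auto simp: d_def)
    ultimately show ?thesis using that by blast
  qed
  have sub: "{a..d} \<subseteq> {a..b}" using d by auto
  have Bsig: "B x o\<^sub>L \<sigma>1 x = Z x" if "x \<in> {a..b}" for x
    using BZ [OF that] by (intro blinfun_eqI) simp
  have 1: "has_ae_derivative_on (\<lambda>x. B x o\<^sub>L \<sigma>1 x) (\<lambda>x. - ((A o\<^sub>L B x o\<^sub>L \<sigma>2 x) + (B x o\<^sub>L \<gamma> x))) {a..b}"
  proof (rule has_ae_derivative_on_cong [OF Z])
    show "AE x in lebesgue. x \<in> {a..b} \<longrightarrow>
      - ((A o\<^sub>L Z x o\<^sub>L s x) + (Z x o\<^sub>L q x)) = - ((A o\<^sub>L B x o\<^sub>L \<sigma>2 x) + (B x o\<^sub>L \<gamma> x))"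
      by (intro AE_I2 impI) (simp add: B_def s_def q_def blinfun_compose_assoc)
  qed (simp add: Bsig)
  show ?thesis
    unfolding evolves_def
  proof (intro exI [of _ B] exI [of _ X] exI [of _ d] conjI ballI d(1,2) Ba Xa)
    fix x assume "x \<in> {a..d}"
    then have x: "x \<in> {a..b}" using sub by auto
    show "complex_linear (B x)" "is_adj (X x) (X x)" by (intro Blin Xadj x)+
    show "op_invertible (X x)" by (rule d) fact
    show "(A o\<^sub>L X x) + (X x o\<^sub>L Aa) + (B x o\<^sub>L \<sigma>1 x o\<^sub>L fadj (B x)) = 0"
      using Lyap [OF x] by (simp add: Bsig [OF x] Bs_def)
  qed (use has_ae_derivative_on_subset [OF _ sub] 1 Xae Bsae in \<open>auto simp: Bs_def [abs_def]\<close>)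
qed

end

section \<open>Resolvents near infinity, and a criterion for vanishing almost everywhere\<close>

lemma scaleC_diff_right: "c *\<^sub>C (x - y) = c *\<^sub>C x - c *\<^sub>C y" for x :: "'a::complex_hilbert"
  by (rule bounded_bilinear.diff_right [OF bounded_bilinear_scaleC])

lemma scaleC_minus_right: "c *\<^sub>C (- x) = - (c *\<^sub>C x)" for x :: "'a::complex_hilbert"
  by (rule bounded_bilinear.minus_right [OF bounded_bilinear_scaleC])

lemma tendsto_resolvent_at_infinity:
  fixes A :: "'h::complex_hilbert \<Rightarrow>\<^sub>L 'h"
  assumes A: "complex_linear A"
  shows "((\<lambda>l. op_inverse (scalar_op l - A)) \<longlongrightarrow> 0) at_infinity"
proof (rule Lim_null_comparison)
  show "\<forall>\<^sub>F l in at_infinity. norm (op_inverse (scalar_op l - A)) \<le> 1 / (norm l - norm A)"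
    unfolding eventually_at_infinity
    by (intro exI [of _ "norm A + 1"]) (use resolvent_series(3) [OF A] in auto)
  have "filterlim (\<lambda>l::complex. - norm A + norm l) at_top at_infinity"
    by (rule filterlim_tendsto_add_at_top [OF tendsto_const filterlim_norm_at_top])
  then have "((\<lambda>l::complex. inverse (- norm A + norm l)) \<longlongrightarrow> 0) at_infinity"
    by (rule tendsto_inverse_0_at_top)
  then show "((\<lambda>l::complex. 1 / (norm l - norm A)) \<longlongrightarrow> 0) at_infinity"
    by (simp add: inverse_eq_divide)
qed

lemma tendsto_scaled_resolvent_at_infinity:
  fixes A :: "'h::complex_hilbert \<Rightarrow>\<^sub>L 'h"
  assumes A: "complex_linear A"
  shows "((\<lambda>l. scalar_op l o\<^sub>L op_inverse (scalar_op l - A)) \<longlongrightarrow> id_blinfun) at_infinity"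
proof -
  have "((\<lambda>l. id_blinfun + (A o\<^sub>L op_inverse (scalar_op l - A))) \<longlongrightarrow> id_blinfun + (A o\<^sub>L 0)) at_infinity"
    by (intro tendsto_intros bounded_bilinear.tendsto [OF bounded_bilinear_blinfun_compose] tendsto_resolvent_at_infinity A)
  moreover have "A o\<^sub>L 0 = 0" by (intro blinfun_eqI) simp
  ultimately have "((\<lambda>l. id_blinfun + (A o\<^sub>L op_inverse (scalar_op l - A))) \<longlongrightarrow> id_blinfun) at_infinity" by simp
  then show ?thesis
  proof (rule Lim_transform_eventually)
    have "id_blinfun + (A o\<^sub>L op_inverse (scalar_op l - A)) = scalar_op l o\<^sub>L op_inverse (scalar_op l - A)"
      if "norm A + 1 \<le> norm l" for l
      using resolvent_equation(1) [OF A, of l] that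
      by (intro blinfun_eqI) (simp add: blinfun.add_left algebra_simps)
    then show "\<forall>\<^sub>F l in at_infinity. id_blinfun + (A o\<^sub>L op_inverse (scalar_op l - A)) = scalar_op l o\<^sub>L op_inverse (scalar_op l - A)"
      unfolding eventually_at_infinity by blast
  qed
qed

text \<open>Averages over intervals to the right of x converge to g x off a null set, and here they
  are 0. The endpoint b has no such interval inside \<open>{a..b}\<close> and joins the null
  set.\<close>

lemma AE_zero_of_integral_zero:
  fixes g :: "real \<Rightarrow> 'b::euclidean_space"
  assumes g: "g integrable_on {a..b}" and zero: "\<And>x. x \<in> {a..b} \<Longrightarrow> integral {a..x} g = 0"
  shows "AE x in lebesgue. x \<in> {a..b} \<longrightarrow> g x = 0"
proof -
  define k where "k x = (if x \<in> {a..b} then g x else 0)" for x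
  have k: "k integrable_on cbox u v" for u v
  proof -
    have "{a..b} \<inter> cbox u v = {max a u..min b v}" by auto
    then have "g integrable_on ({a..b} \<inter> cbox u v)"
      using integrable_on_subinterval [OF g, of "max a u" "min b v"] by auto
    then show ?thesis unfolding k_def by (simp only: integrable_restrict_Int)
  qed
  then obtain N where N: "negligible N" "\<And>x e. \<lbrakk>x \<notin> N; 0 < e\<rbrakk> \<Longrightarrow>
      \<exists>d>0. \<forall>h. 0 < h \<and> h < d \<longrightarrow> norm (integral (cbox x (x + h *\<^sub>R One)) k /\<^sub>R h ^ DIM(real) - k x) < e"
    using integrable_ccontinuous_explicit [of k] by metis
  have "g x = 0" if x: "a \<le> x" "x < b" "x \<notin> N" for x
  proof -
    have "norm (k x) \<le> 0"
    proof (rule field_le_epsilon)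
      fix e :: real assume "e > 0"
      then obtain d where d: "d > 0" "\<forall>h. 0 < h \<and> h < d \<longrightarrow> norm (integral (cbox x (x + h *\<^sub>R One)) k /\<^sub>R h ^ DIM(real) - k x) < e"
        using N(2) [OF x(3)] by blast
      define h where "h = min (d/2) (b - x)"
      have h: "0 < h" "h < d" "x + h \<le> b" using d x by (auto simp: h_def)
      have "integral {x..x+h} k = integral {x..x+h} g"
        using h x by (intro integral_cong) (auto simp: k_def)
      also have "\<dots> = integral {a..x+h} g - integral {a..x} g"
        using h x by (intro integral_increment [OF g, symmetric]) auto
      also have "\<dots> = 0" using h x zero by auto
      finally have "integral {x..x+h} k = 0" .
      then have "norm (k x) < e" using d(2) [rule_format, of h] h by simp
      then show "norm (k x) \<le> 0 + e" by simp
    qed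
    then show ?thesis using x by (simp add: k_def)
  qed
  moreover have "insert b N \<in> null_sets lebesgue"
    using N(1) by (simp add: negligible_iff_null_sets [symmetric])
  ultimately show ?thesis by (intro AE_I' [of "insert b N"]) (force simp: less_le)+
qed

section \<open>Differential equations of the transfer function and of \<open>S\<close>\<close>

context vessel_coefficients
begin

text \<open>The constructed transfer function satisfies the flow of an output equation of its own,
  with coefficient q + [s, N]; N is the coefficient of - 1/l in its expansion at infinity. The
  Lyapunov equation moves the adjoint of A past the inverse of X, and the resolvent equation then
  trades A for l.\<close>

lemma transfer_ode:
  fixes A Aa :: "'h::complex_hilbert \<Rightarrow>\<^sub>L 'h" and B :: "real \<Rightarrow> 'e \<Rightarrow>\<^sub>L 'h" and X :: "real \<Rightarrow> 'h \<Rightarrow>\<^sub>L 'h"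
  assumes A: "is_adj A Aa" and d: "d \<le> b" and l: "norm A < cmod l"
    and ev: "evolves A Aa B X d"
  defines "N \<equiv> \<lambda>x. fadj (B x) o\<^sub>L op_inverse (X x) o\<^sub>L B x o\<^sub>L \<sigma>1 x"
  shows "has_ae_derivative_on (transfer A B X l)
    (\<lambda>x. flow l x (q x + ((s x o\<^sub>L N x) - (N x o\<^sub>L s x))) (transfer A B X l x)) {a..d}"
proof -
  note BX = ev [unfolded evolves_def, THEN conjunct1]
    and Z = ev [unfolded evolves_def, THEN conjunct2, THEN conjunct1]
    and X = ev [unfolded evolves_def, THEN conjunct2, THEN conjunct2, THEN conjunct1]
    and Bs = ev [unfolded evolves_def, THEN conjunct2, THEN conjunct2, THEN conjunct2]
  define M where "M x = fadj (B x) o\<^sub>L op_inverse (X x) o\<^sub>L op_inverse (scalar_op l - A) o\<^sub>L B x o\<^sub>L \<sigma>1 x" for x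
  define Xi where "Xi x = op_inverse (X x)" for x
  define R where "R = op_inverse (scalar_op l - A)"
  have sub: "{a..d} \<subseteq> {a..b}" using d by auto
  have inv: "op_invertible (X x)" if "x \<in> {a..d}" for x using BX that by blast
  have Xi_cont: "continuous_on {a..d} Xi"
    unfolding Xi_def [abs_def] by (intro continuous_on_op_inverse has_ae_derivative_on_imp_continuous_on [OF X] inv)
  obtain K where K: "\<forall>x\<in>{a..d}. norm (Xi x) \<le> K" using continuous_on_interval_bounded [OF Xi_cont] by blast
  have Xi_ae: "has_ae_derivative_on Xi (\<lambda>x. - (Xi x o\<^sub>L (B x o\<^sub>L \<sigma>2 x o\<^sub>L fadj (B x)) o\<^sub>L Xi x)) {a..d}"
    by (rule has_ae_derivative_on_inverse [OF X Xi_cont, of K]) (use K op_inverse_compose [OF inv] in \<open>auto simp: Xi_def\<close>)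
  define W where "W x = ((fadj (B x) o\<^sub>L ((Xi x o\<^sub>L (R o\<^sub>L - ((A o\<^sub>L B x o\<^sub>L \<sigma>2 x) + (B x o\<^sub>L \<gamma> x))))
        + (- (Xi x o\<^sub>L (B x o\<^sub>L \<sigma>2 x o\<^sub>L fadj (B x)) o\<^sub>L Xi x) o\<^sub>L (R o\<^sub>L (B x o\<^sub>L \<sigma>1 x)))))
      + (((q x o\<^sub>L fadj (B x)) - (s x o\<^sub>L fadj (B x) o\<^sub>L Aa)) o\<^sub>L (Xi x o\<^sub>L (R o\<^sub>L (B x o\<^sub>L \<sigma>1 x)))))" for x
  have ae: "has_ae_derivative_on (\<lambda>x. id_blinfun - (fadj (B x) o\<^sub>L (Xi x o\<^sub>L (R o\<^sub>L (B x o\<^sub>L \<sigma>1 x)))))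
    (\<lambda>x. 0 - W x) {a..d}"
    unfolding W_def
    by (intro has_ae_derivative_on_diff has_ae_derivative_on_const op_has_ae_derivative_compose
        has_ae_derivative_on_linear [OF bounded_linear_compose_left] Bs Xi_ae Z)
  have "has_ae_derivative_on (\<lambda>x. id_blinfun - M x)
    (\<lambda>x. flow l x (q x + ((s x o\<^sub>L N x) - (N x o\<^sub>L s x))) (id_blinfun - M x)) {a..d}"
  proof (rule has_ae_derivative_on_eq_rhs)
    show "has_ae_derivative_on (\<lambda>x. id_blinfun - M x) (\<lambda>x. 0 - W x) {a..d}"
      using ae by (simp only: M_def Xi_def R_def W_def blinfun_compose_assoc)
    fix x assume x: "x \<in> {a..d}"
    then have x': "x \<in> {a..b}" using sub by auto
    let ?Z = "\<lambda>u. B x (\<sigma>1 x u)" and ?Bs = "fadj (B x)"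
    have Bl: "complex_linear (B x)" using BX x by blast
    have Bsl: "complex_linear ?Bs" by (rule is_adj_complex_linear [OF is_adj_sym [OF is_adj_fadj [OF Bl]]])
    have Alin: "complex_linear A" by (rule is_adj_complex_linear [OF A])
    have AR: "A (R y) = l *\<^sub>C R y - y" for y
      using resolvent_equation(1) [OF Alin l, of y] by (simp add: R_def algebra_simps)
    have RA: "R (A y) = l *\<^sub>C R y - y" for y
    proof -
      have "R (l *\<^sub>C y) = l *\<^sub>C R y"
      proof -
        have "R (l *\<^sub>C (l *\<^sub>C R y - A (R y)) - A (l *\<^sub>C R y - A (R y))) = l *\<^sub>C R y - A (R y)"
          unfolding R_def by (rule resolvent_equation(2) [OF Alin l])
        moreover have "l *\<^sub>C (l *\<^sub>C R y) - A (l *\<^sub>C R y) = l *\<^sub>C y"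
          by (simp add: complex_linearD [OF Alin] AR scaleC_diff_right)
        moreover have "R (l *\<^sub>C (l *\<^sub>C R y) - A (l *\<^sub>C R y)) = l *\<^sub>C R y"
          unfolding R_def by (rule resolvent_equation(2) [OF Alin l])
        ultimately show ?thesis by simp
      qed
      moreover have "R (l *\<^sub>C y - A y) = y" unfolding R_def by (rule resolvent_equation(2) [OF Alin l])
      ultimately show ?thesis by (simp add: blinfun.diff_right algebra_simps)
    qed
    have XXi: "X x (Xi x y) = y" "Xi x (X x y) = y" for y
      using op_inverse_apply [OF inv [OF x]] by (simp_all add: Xi_def)
    \<comment> \<open>The Lyapunov equation multiplied by the inverse of X on both sides.\<close>
    have AaXi: "Aa (Xi x y) = - Xi x (A y) - Xi x (?Z (?Bs (Xi x y)))" for y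
    proof -
      have "A (X x (Xi x y)) + X x (Aa (Xi x y)) + ?Z (?Bs (Xi x y)) = 0"
        using BX x arg_cong [of _ 0 "\<lambda>F. blinfun_apply F (Xi x y)"] by (fastforce simp: blinfun.add_left)
      then have "Xi x (A y + X x (Aa (Xi x y)) + ?Z (?Bs (Xi x y))) = 0" by (simp add: XXi)
      then have "Aa (Xi x y) + (Xi x (A y) + Xi x (?Z (?Bs (Xi x y)))) = 0"
        by (simp add: blinfun.add_right XXi algebra_simps)
      then show ?thesis by (simp add: eq_neg_iff_add_eq_0 [symmetric])
    qed
    have Zs: "B x (\<sigma>2 x y) = ?Z (s x y)" "B x (\<gamma> x y) = ?Z (q x y)" for y
      using x' by (simp_all add: s_def q_def)
    show "0 - W x = flow l x (q x + ((s x o\<^sub>L N x) - (N x o\<^sub>L s x))) (id_blinfun - M x)"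
    proof -
      have Ma: "M x y = ?Bs (Xi x (R (?Z y)))" for y by (simp add: M_def Xi_def R_def)
      have Na: "N x y = ?Bs (Xi x (?Z y))" for y by (simp add: N_def Xi_def)
      have Xil: "complex_linear (Xi x)"
        unfolding Xi_def by (rule is_adj_complex_linear [OF is_adj_op_inverse]) (use BX x in auto)
      show ?thesis
        by (rule blinfun_eqI)
          (simp add: W_def blinfun_linear Ma Na Zs RA AaXi AR complex_linearD [OF Bsl] complex_linearD [OF Xil] complex_linearD [OF complex_linear_quotients(1) [OF x']]
            scaleC_diff_right scaleC_add_right scaleC_minus_right algebra_simps)
    qed
  qed
  then show ?thesis by (simp only: M_def)
qed

text \<open>The mapping property speaks about single solutions. Applied to a fundamental solution
  \<Phi>, column by column, it yields the desired equation multiplied by \<Phi>; finitely many basis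
  vectors leave one null set, and \<Phi> is cancelled by its inverse.\<close>

lemma class_ode:
  assumes S: "class_Ir \<sigma>1 \<sigma>2 \<gamma> \<gamma>s a b \<Omega> S" and l: "l \<in> \<Omega>"
  shows "has_ae_derivative_on (S l)
    (\<lambda>x. flow l x (p x) (S l x)) {a..b}"
proof -
  have aI: "a \<in> {a..b}" using a_less_b by simp
  have Slin: "complex_linear (S l x)" if "x \<in> {a..b}" for x using S l that by (simp add: class_Ir_def)
  obtain S' where S': "has_ae_derivative_on (S l) S' {a..b}" using S l unfolding class_Ir_def by blast
  have maps: "solves_lde \<sigma>1 \<sigma>2 \<gamma> l a b u \<Longrightarrow> solves_lde \<sigma>1 \<sigma>2 \<gamma>s l a b (\<lambda>x. S l x (u x))" for u
    using S l unfolding class_Ir_def by blast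
  define Q where "Q x = (scalar_op l o\<^sub>L s x) + q x" for x
  have QL1: "strong_L1 a b Q"
    unfolding Q_def [abs_def] by (intro strong_L1.add strong_L1_linear [OF bounded_linear_compose_left] strong_L1_quotients)
  obtain mQ where mQ: "mQ absolutely_integrable_on {a..b}" "\<forall>x. 0 \<le> mQ x" "\<forall>x\<in>{a..b}. norm (Q x) \<le> mQ x"
    using strong_L1_bound [OF QL1] by blast
  have "\<exists>\<Phi>. has_ae_derivative_on \<Phi> (\<lambda>x. Q x o\<^sub>L \<Phi> x) {a..b} \<and> \<Phi> a = (id_blinfun :: 'e \<Rightarrow>\<^sub>L 'e)"
  proof (rule linear_ode_solution [where m = mQ])
    show "strong_L1 a b (\<lambda>x. Q x o\<^sub>L Y x)" if "continuous_on {a..b} Y" for Y :: "real \<Rightarrow> 'e \<Rightarrow>\<^sub>L 'e"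
      by (rule strong_L1_bilinear [OF bounded_bilinear_blinfun_compose QL1 that])
    fix x and Y Z :: "'e \<Rightarrow>\<^sub>L 'e" assume x: "x \<in> {a..b}"
    have "(Q x o\<^sub>L Y) - (Q x o\<^sub>L Z) = Q x o\<^sub>L (Y - Z)" by (intro blinfun_eqI) (simp add: blinfun_linear)
    also have "norm \<dots> \<le> norm (Q x) * norm (Y - Z)" by (rule norm_blinfun_compose)
    also have "\<dots> \<le> mQ x * norm (Y - Z)" using mQ x by (intro mult_right_mono) auto
    finally show "norm ((Q x o\<^sub>L Y) - (Q x o\<^sub>L Z)) \<le> mQ x * norm (Y - Z)" .
  qed (use mQ a_less_b in auto)
  then obtain \<Phi> :: "real \<Rightarrow> 'e \<Rightarrow>\<^sub>L 'e" where \<Phi>: "has_ae_derivative_on \<Phi> (\<lambda>x. Q x o\<^sub>L \<Phi> x) {a..b}" and \<Phi>a: "\<Phi> a = id_blinfun" by blast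
  \<comment> \<open>The inverse of \<Phi>: the coefficient enters this equation from the other side
    and with the opposite sign, so \<Psi> \<Phi> has derivative 0.\<close>
  obtain \<Psi> :: "real \<Rightarrow> 'e \<Rightarrow>\<^sub>L 'e" where \<Psi>: "has_ae_derivative_on \<Psi> (\<lambda>x. - ((scalar_op l o\<^sub>L \<Psi> x o\<^sub>L s x) + (\<Psi> x o\<^sub>L q x))) {a..b}"
    and \<Psi>a: "\<Psi> a = id_blinfun"
    using input_ode_exists [of "scalar_op l :: 'e \<Rightarrow>\<^sub>L 'e" id_blinfun] by blast
  have \<Psi>lin: "complex_linear (\<Psi> x)" if "x \<in> {a..b}" for x
    by (rule input_ode_complex_linear [OF \<Psi> is_adj_complex_linear [OF is_adj_scalar_op] _ that])
       (simp add: \<Psi>a complex_linear_def)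
  have const: "has_ae_derivative_on (\<lambda>x. \<Psi> x o\<^sub>L \<Phi> x) (\<lambda>x. 0) {a..b}"
    by (rule has_ae_derivative_on_eq_rhs [OF op_has_ae_derivative_compose [OF \<Psi> \<Phi>]], rule blinfun_eqI)
       (simp add: Q_def blinfun_linear complex_linearD [OF \<Psi>lin])
  have "\<Psi> x o\<^sub>L \<Phi> x = id_blinfun" if "x \<in> {a..b}" for x
    using has_ae_derivative_on_zero_const [OF const that] by (simp add: \<Phi>a \<Psi>a)
  then have \<Phi>\<Psi>: "\<Phi> x (\<Psi> x v) = v" if "x \<in> {a..b}" for x v
    using finite_dim_op_inverse [of "\<Psi> x" "\<Phi> x", THEN arg_cong, of "\<lambda>F. blinfun_apply F v"] that by simp
  have key: "AE x in lebesgue. x \<in> {a..b} \<longrightarrow> S' x (\<Phi> x e) =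
      (flow l x (p x) (S l x)) (\<Phi> x e)" for e
  proof -
    have u: "has_ae_derivative_on (\<lambda>x. \<Phi> x e) (\<lambda>x. Q x (\<Phi> x e)) {a..b}"
      using has_ae_derivative_on_linear [OF blinfun.bounded_linear_left \<Phi>, of e] by simp
    have "solves_lde \<sigma>1 \<sigma>2 \<gamma> l a b (\<lambda>x. \<Phi> x e)"
      unfolding solves_lde_def
    proof (intro exI conjI)
      show "AE x in lebesgue. x \<in> {a..b} \<longrightarrow> - \<sigma>1 x (Q x (\<Phi> x e)) + (\<sigma>2 x (l *\<^sub>C \<Phi> x e) + \<gamma> x (\<Phi> x e)) = 0"
        by (intro AE_I2 impI) (simp add: Q_def s_def q_def blinfun_linear complex_linearD [OF complex_linear_params(1)] complex_linearD [OF complex_linear_params(2)])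
    qed (rule u)
    from maps [OF this] obtain y' where y': "has_ae_derivative_on (\<lambda>x. S l x (\<Phi> x e)) y' {a..b}"
      and eq: "AE x in lebesgue. x \<in> {a..b} \<longrightarrow> - \<sigma>1 x (y' x) + (\<sigma>2 x (l *\<^sub>C S l x (\<Phi> x e)) + \<gamma>s x (S l x (\<Phi> x e))) = 0"
      unfolding solves_lde_def by blast
    have Su: "has_ae_derivative_on (\<lambda>x. S l x (\<Phi> x e)) (\<lambda>x. S l x (Q x (\<Phi> x e)) + S' x (\<Phi> x e)) {a..b}"
      by (rule has_ae_derivative_on_bilinear [OF bounded_bilinear_blinfun_apply S' u])
    from Su [unfolded has_ae_derivative_on_def, THEN conjunct2] y' [unfolded has_ae_derivative_on_def, THEN conjunct2] eq
    show ?thesis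
    proof eventually_elim
      case (elim x)
      show ?case
      proof
      assume x: "x \<in> {a..b}"
      note d1 = elim(1) and d2 = elim(2) and e1 = elim(3)
      have "y' x = S l x (Q x (\<Phi> x e)) + S' x (\<Phi> x e)"
        using vector_derivative_unique_within [of x "{a..b}"] d1 d2 x a_less_b by (auto simp: trivial_limit_within islimpt_Icc)
      moreover have "si x (\<sigma>1 x (y' x)) = si x (\<sigma>2 x (l *\<^sub>C S l x (\<Phi> x e)) + \<gamma>s x (S l x (\<Phi> x e)))"
        using e1 x by (simp add: eq_neg_iff_add_eq_0 [symmetric] neg_eq_iff_add_eq_0)
      ultimately show "S' x (\<Phi> x e) =
        (flow l x (p x) (S l x)) (\<Phi> x e)"
        using x by (simp add: Q_def s_def p_def q_def blinfun_linear complex_linearD [OF complex_linear_params(2)] complex_linearD [OF si_lin] complex_linearD [OF Slin]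
            scaleC_diff_right algebra_simps)
      qed
    qed
  qed
  have "AE x in lebesgue. \<forall>e\<in>(Basis::'e set). x \<in> {a..b} \<longrightarrow> S' x (\<Phi> x e) =
      (flow l x (p x) (S l x)) (\<Phi> x e)"
    by (rule AE_finite_allI [OF finite_Basis]) (rule key)
  then have "AE x in lebesgue. x \<in> {a..b} \<longrightarrow> S' x =
      flow l x (p x) (S l x)"
  proof eventually_elim
    case (elim x)
    show ?case
    proof
      assume x: "x \<in> {a..b}"
      define E where "E = flow l x (p x) (S l x)"
      have eq: "S' x o\<^sub>L \<Phi> x = E o\<^sub>L \<Phi> x"
        by (rule blinfun_euclidean_eqI) (use elim x in \<open>simp add: E_def\<close>)
      have "S' x = E"
      proof (rule blinfun_eqI)
        fix v
        from arg_cong [OF eq, of "\<lambda>F. blinfun_apply F (\<Psi> x v)"] show "S' x v = E v"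
          using \<Phi>\<Psi> [OF x, of v] by simp
      qed
      then show "S' x = flow l x (p x) (S l x)"
        by (simp only: E_def)
    qed
  qed
  then show ?thesis by (rule has_ae_derivative_on_cong [OF S' refl])
qed

end

context vessel_coefficients
begin

lemma class_IrD:
  assumes "class_Ir \<sigma>1 \<sigma>2 \<gamma> \<gamma>s a b \<Omega> S"
  shows "x \<in> {a..b} \<Longrightarrow> (\<lambda>l. cinner (S l x u) v) holomorphic_on \<Omega>"
    and "x \<in> {a..b} \<Longrightarrow> ((\<lambda>l. S l x) \<longlongrightarrow> id_blinfun) at_infinity"
    and "l \<in> \<Omega> \<Longrightarrow> x \<in> {a..b} \<Longrightarrow> complex_linear (S l x)"
    and "l \<in> \<Omega> \<Longrightarrow> - cnj l \<in> \<Omega> \<Longrightarrow> x \<in> {a..b} \<Longrightarrow> adj (S (- cnj l) x) o\<^sub>L \<sigma>1 x o\<^sub>L S l x = \<sigma>1 x"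
  using assms unfolding class_Ir_def by blast+

text \<open>Comparison of leading terms at infinity. The derivatives in x are not known to converge
  as l tends to infinity, so the equation is integrated from a to x first: the increments of S tend
  to 0, dominated convergence applies to the right-hand sides, and an integrand whose integrals up
  to every x vanish is 0 almost everywhere.\<close>

lemma class_residue:
  assumes S: "class_Ir \<sigma>1 \<sigma>2 \<gamma> \<gamma>s a b \<Omega> S" and \<Omega>: "{l. r < cmod l} \<subseteq> \<Omega>" and r: "0 < r" "r < r1"
    and d: "a < d" "d \<le> b"
    and bound: "\<And>l x. cmod l = r1 \<Longrightarrow> x \<in> {a..d} \<Longrightarrow> norm (S l x - id_blinfun) \<le> G"
    and L: "\<And>x. x \<in> {a..d} \<Longrightarrow> ((\<lambda>l. scalar_op l o\<^sub>L (S l x - id_blinfun)) \<longlongrightarrow> L x) at_infinity"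
  shows "AE x in lebesgue. x \<in> {a..d} \<longrightarrow> (s x o\<^sub>L L x) - (L x o\<^sub>L s x) + p x - q x = 0"
proof -
  have sub: "{a..d} \<subseteq> {a..b}" using d by auto
  have "a \<in> {a..d}" using d by simp
  have hol: "(\<lambda>l. cinner ((S l x - id_blinfun) u) v) holomorphic_on {l. r < cmod l}" if "x \<in> {a..d}" for x u v
  proof -
    have "(\<lambda>l. cinner (S l x u) v - cinner u v) holomorphic_on {l. r < cmod l}"
      using sub that by (intro holomorphic_intros holomorphic_on_subset [OF class_IrD(1) [OF S] \<Omega>]) auto
    then show ?thesis by (simp add: blinfun.diff_left cinner_diff_left)
  qed
  have lim: "((\<lambda>l. S l x - id_blinfun) \<longlongrightarrow> 0) at_infinity" if "x \<in> {a..d}" for x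
    using sub that by (intro LIM_zero class_IrD(2) [OF S]) auto
  have le: "norm (scalar_op l o\<^sub>L (S l x - id_blinfun)) \<le> r1 * G" if "r1 \<le> cmod l" "x \<in> {a..d}" for l x
    using exterior_residue(2) [OF hol [OF that(2)] r lim [OF that(2)] bound [OF _ that(2)] that(1)] by simp
  obtain ms where ms: "ms absolutely_integrable_on {a..b}" "\<forall>x. 0 \<le> ms x" "\<forall>x\<in>{a..b}. norm (s x) \<le> ms x"
    using strong_L1_bound [OF strong_L1_quotients(1)] by blast
  obtain mq where mq: "mq absolutely_integrable_on {a..b}" "\<forall>x. 0 \<le> mq x" "\<forall>x\<in>{a..b}. norm (q x) \<le> mq x"
    using strong_L1_bound [OF strong_L1_quotients(2)] by blast
  obtain mp where mp: "mp absolutely_integrable_on {a..b}" "\<forall>x. 0 \<le> mp x" "\<forall>x\<in>{a..b}. norm (p x) \<le> mp x"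
    using strong_L1_bound [OF strong_L1_quotients(3)] by blast
  \<comment> \<open>A sequence is enough for dominated convergence. It starts on the circle of
    radius r1, from which outwards the maximum principle gives uniform bounds.\<close>
  define lk where "lk k = complex_of_real (r1 + real k)" for k
  have norm_lk: "cmod (lk k) = r1 + real k" for k
    using r unfolding lk_def norm_of_real by simp
  then have lk: "r1 \<le> cmod (lk k)" "lk k \<in> \<Omega>" for k
    using r \<Omega> by auto
  have lk_lim: "filterlim lk at_infinity sequentially"
    by (rule filterlim_norm_at_top_imp_at_infinity, unfold norm_lk)
       (rule filterlim_tendsto_add_at_top [OF tendsto_const filterlim_real_sequentially])
  \<comment> \<open>The identity commutes with s, so it may be subtracted inside the commutator: the
    unbounded factor l then meets S - I, and l (S - I) converges.\<close>
  define E where "E k x = (s x o\<^sub>L (scalar_op (lk k) o\<^sub>L (S (lk k) x - id_blinfun)))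
    - ((scalar_op (lk k) o\<^sub>L (S (lk k) x - id_blinfun)) o\<^sub>L s x) + (p x o\<^sub>L S (lk k) x) - (S (lk k) x o\<^sub>L q x)" for k x
  define E' where "E' x = (s x o\<^sub>L L x) - (L x o\<^sub>L s x) + p x - q x" for x
  have ode: "has_ae_derivative_on (S (lk k)) (E k) {a..b}" for k
  proof (rule has_ae_derivative_on_eq_rhs [OF class_ode [OF S lk(2)]])
    fix x assume x: "x \<in> {a..b}"
    show "(scalar_op (lk k) o\<^sub>L ((s x o\<^sub>L S (lk k) x) - (S (lk k) x o\<^sub>L s x))) + (p x o\<^sub>L S (lk k) x) - (S (lk k) x o\<^sub>L q x) = E k x"
      by (intro blinfun_eqI) (simp add: E_def blinfun_linear complex_linearD [OF complex_linear_quotients(1) [OF x]] scaleC_diff_right)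
  qed
  have Slim: "(\<lambda>k. S (lk k) x) \<longlonglongrightarrow> id_blinfun" if "x \<in> {a..d}" for x
    using sub that by (intro filterlim_compose [OF class_IrD(2) [OF S] lk_lim]) auto
  have Llim: "(\<lambda>k. scalar_op (lk k) o\<^sub>L (S (lk k) x - id_blinfun)) \<longlonglongrightarrow> L x" if "x \<in> {a..d}" for x
    by (rule filterlim_compose [OF L [OF that] lk_lim])
  have Elim: "(\<lambda>k. E k x) \<longlonglongrightarrow> E' x" if "x \<in> {a..d}" for x
  proof -
    have "(\<lambda>k. E k x) \<longlonglongrightarrow> (s x o\<^sub>L L x) - (L x o\<^sub>L s x) + (p x o\<^sub>L id_blinfun) - (id_blinfun o\<^sub>L q x)"
      unfolding E_def
      by (intro tendsto_intros bounded_bilinear.tendsto [OF bounded_bilinear_blinfun_compose] Slim Llim that)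
    then show ?thesis by (simp add: E'_def)
  qed
  have G0: "0 \<le> r1 * G" using order_trans [OF norm_ge_zero le [OF lk(1) \<open>a \<in> {a..d}\<close>]] .
  \<comment> \<open>From the bound r1 G on l (S - I) together with |l| \<ge> r1.\<close>
  have Snorm: "norm (S (lk k) x) \<le> 1 + G" if "x \<in> {a..d}" for k x
  proof -
    have "r1 * norm (S (lk k) x - id_blinfun) \<le> r1 * G"
    proof -
      have "cmod (lk k) *\<^sub>R norm (S (lk k) x - id_blinfun) \<le> norm (scalar_op (lk k) o\<^sub>L (S (lk k) x - id_blinfun))"
      proof -
        have "lk k \<noteq> 0" using lk(1) [of k] r by auto
        have "norm (S (lk k) x - id_blinfun) = norm (scalar_op (inverse (lk k)) o\<^sub>L (scalar_op (lk k) o\<^sub>L (S (lk k) x - id_blinfun)))"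
          using \<open>lk k \<noteq> 0\<close> by (intro arg_cong [of _ _ norm] blinfun_eqI) (simp add: scaleC_scaleC)
        also have "\<dots> \<le> cmod (inverse (lk k)) * norm (scalar_op (lk k) o\<^sub>L (S (lk k) x - id_blinfun))"
          by (intro order_trans [OF norm_blinfun_compose] mult_right_mono norm_scalar_op_le norm_ge_zero)
        finally have "norm (S (lk k) x - id_blinfun) \<le> inverse (cmod (lk k)) * norm (scalar_op (lk k) o\<^sub>L (S (lk k) x - id_blinfun))"
          by (simp only: norm_inverse)
        then show ?thesis using \<open>lk k \<noteq> 0\<close> by (simp add: field_simps)
      qed
      also have "\<dots> \<le> r1 * G" by (rule le [OF lk(1) that])
      finally show ?thesis
        using mult_right_mono [OF lk(1) [of k] norm_ge_zero [of "S (lk k) x - id_blinfun"]] by simp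
    qed
    then have 1: "norm (S (lk k) x - id_blinfun) \<le> G" using r by simp
    have "norm (S (lk k) x) \<le> norm (id_blinfun :: 'e \<Rightarrow>\<^sub>L 'e) + norm (S (lk k) x - id_blinfun)"
      using norm_triangle_ineq [of id_blinfun "S (lk k) x - id_blinfun"] by simp
    also have "\<dots> \<le> 1 + G" by (intro add_mono norm_blinfun_id_le 1)
    finally show ?thesis .
  qed
  define h where "h x = (2 * (r1 * G)) *\<^sub>R ms x + (1 + G) *\<^sub>R (mp x + mq x)" for x
  have G1: "0 \<le> 1 + G" using order_trans [OF norm_ge_zero Snorm [OF \<open>a \<in> {a..d}\<close>]] .
  have Ebound: "norm (E k x) \<le> h x" if x: "x \<in> {a..d}" for k x
  proof -
    have x': "x \<in> {a..b}" using sub x by auto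
    let ?F = "scalar_op (lk k) o\<^sub>L (S (lk k) x - id_blinfun)"
    have "norm (E k x) \<le> norm (s x) * norm ?F + norm ?F * norm (s x) + norm (p x) * norm (S (lk k) x) + norm (S (lk k) x) * norm (q x)"
      unfolding E_def
      by (intro order_trans [OF norm_triangle_ineq4] order_trans [OF norm_triangle_ineq] add_mono norm_blinfun_compose)
    also have "\<dots> \<le> ms x * (r1 * G) + (r1 * G) * ms x + mp x * (1 + G) + (1 + G) * mq x"
      using ms mp mq x' le [OF lk(1) x] Snorm [OF x] G0 G1 by (intro add_mono mult_mono) auto
    finally show ?thesis by (simp add: h_def algebra_simps)
  qed
  have h: "h integrable_on {a..x}" if "x \<in> {a..d}" for x
  proof -
    have "h absolutely_integrable_on {a..b}"
      unfolding h_def by (intro set_integral_add absolutely_integrable_scaleR_left ms mp mq)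
    then have "h integrable_on {a..b}" by (rule set_lebesgue_integral_eq_integral(1))
    then show ?thesis by (rule integrable_on_subinterval) (use that d in auto)
  qed
  have vec: "AE x in lebesgue. x \<in> {a..d} \<longrightarrow> E' x u = 0" for u
  proof (rule AE_zero_of_integral_zero)
    have dom: "(\<lambda>x. E' x u) integrable_on {a..x}" "(\<lambda>k. integral {a..x} (\<lambda>x. E k x u)) \<longlonglongrightarrow> integral {a..x} (\<lambda>x. E' x u)"
      and int: "integral {a..x} (\<lambda>x. E k x u) = S (lk k) x u - S (lk k) a u" if x: "x \<in> {a..d}" for x k
    proof -
      have x': "x \<in> {a..b}" using sub x by auto
      have "has_ae_derivative_on (\<lambda>x. S (lk k) x u) (\<lambda>x. E k x u) {a..b}" for k
        by (rule has_ae_derivative_on_linear [OF blinfun.bounded_linear_left ode])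
      note I = has_ae_derivative_on_eq_integral(1) [OF this x']
      show "integral {a..x} (\<lambda>x. E k x u) = S (lk k) x u - S (lk k) a u" by (rule integral_unique [OF I])
      have hu: "(\<lambda>x. h x * norm u) integrable_on {a..x}" by (intro integrable_on_mult_left h x)
      have bd: "norm (E k t u) \<le> h t * norm u" if "t \<in> {a..x}" for k t
        using that x by (intro order_trans [OF norm_blinfun] mult_right_mono Ebound) auto
      have lm: "(\<lambda>k. E k t u) \<longlonglongrightarrow> E' t u" if "t \<in> {a..x}" for t
        using that x by (intro blinfun.tendsto Elim tendsto_const) auto
      have ii: "(\<lambda>x. E k x u) integrable_on {a..x}" for k using I by blast
      show "(\<lambda>x. E' x u) integrable_on {a..x}" "(\<lambda>k. integral {a..x} (\<lambda>x. E k x u)) \<longlonglongrightarrow> integral {a..x} (\<lambda>x. E' x u)"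
        by (rule dominated_convergence [OF ii hu bd lm]; assumption)+
    qed
    show "(\<lambda>x. E' x u) integrable_on {a..d}" using d by (intro dom(1)) auto
    fix x assume x: "x \<in> {a..d}"
    have "(\<lambda>k. S (lk k) x u - S (lk k) a u) \<longlonglongrightarrow> id_blinfun u - id_blinfun u"
      using x d by (intro tendsto_intros blinfun.tendsto Slim) auto
    then have "(\<lambda>k. integral {a..x} (\<lambda>x. E k x u)) \<longlonglongrightarrow> 0" by (simp add: int [OF x])
    with dom(2) [OF x] show "integral {a..x} (\<lambda>x. E' x u) = 0" by (rule LIMSEQ_unique)
  qed
  have "AE x in lebesgue. \<forall>u\<in>(Basis::'e set). x \<in> {a..d} \<longrightarrow> E' x u = 0"
    by (rule AE_finite_allI [OF finite_Basis]) (rule vec)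
  then show ?thesis
  proof eventually_elim
    case (elim x)
    show ?case
    proof
      assume "x \<in> {a..d}"
      then have "E' x = 0" using elim by (intro blinfun_euclidean_eqI) simp
      then show "(s x o\<^sub>L L x) - (L x o\<^sub>L s x) + p x - q x = 0" by (simp add: E'_def)
    qed
  qed
qed

end

lemma norm_compose3_le: "norm (P o\<^sub>L Q o\<^sub>L R) \<le> norm P * norm Q * norm R"
  by (rule order_trans [OF norm_blinfun_compose]) (intro mult_right_mono norm_blinfun_compose norm_ge_zero)

section \<open>Identification of the transfer function with \<open>S\<close>\<close>

context vessel_coefficients
begin

text \<open>By \<open>class_residue\<close>, p = q - [s, L], while the vessel has the output
  coefficient q + [s, N]. The two differ by the commutator of s with L + N, which is the residue of
  D = S - T, so the equations for D form a homogeneous system over the circle. Once D = 0, the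
  vanishing residue gives the relation between \<gamma> and \<open>\<gamma>s\<close>.\<close>

lemma transfer_eq_class:
  fixes A Aa :: "'h::complex_hilbert \<Rightarrow>\<^sub>L 'h" and B :: "real \<Rightarrow> 'e \<Rightarrow>\<^sub>L 'h" and X :: "real \<Rightarrow> 'h \<Rightarrow>\<^sub>L 'h"
  assumes S: "class_Ir \<sigma>1 \<sigma>2 \<gamma> \<gamma>s a b \<Omega> S" and \<Omega>: "{l. r < cmod l} \<subseteq> \<Omega>" and r: "0 < r" "norm A \<le> r"
    and A: "is_adj A Aa" and d: "a < d" "d \<le> b"
    and ev: "evolves A Aa B X d"
    and init: "\<forall>l. r < cmod l \<longrightarrow> S l a = transfer A B X l a"
  shows "\<forall>x\<in>{a..d}. \<forall>l. r < cmod l \<longrightarrow>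
      S l x = transfer A B X l x"
    and "AE x in lebesgue. x \<in> {a..d} \<longrightarrow>
      \<gamma>s x = \<gamma> x + (\<sigma>2 x o\<^sub>L fadj (B x) o\<^sub>L op_inverse (X x) o\<^sub>L B x o\<^sub>L \<sigma>1 x)
                - (\<sigma>1 x o\<^sub>L fadj (B x) o\<^sub>L op_inverse (X x) o\<^sub>L B x o\<^sub>L \<sigma>2 x)"
proof -
  note BX = ev [unfolded evolves_def, THEN conjunct1]
    and Z = ev [unfolded evolves_def, THEN conjunct2, THEN conjunct1]
    and X = ev [unfolded evolves_def, THEN conjunct2, THEN conjunct2, THEN conjunct1]
    and Bs = ev [unfolded evolves_def, THEN conjunct2, THEN conjunct2, THEN conjunct2]
  have sub: "{a..d} \<subseteq> {a..b}" using d by auto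
  have ad: "a \<in> {a..d}" using d by simp
  have Alin: "complex_linear A" by (rule is_adj_complex_linear [OF A])
  have inv: "op_invertible (X x)" if "x \<in> {a..d}" for x using BX that by blast
  define P where "P x = fadj (B x) o\<^sub>L op_inverse (X x)" for x
  define R where "R l = op_inverse (scalar_op l - A)" for l
  define Y where "Y x = B x o\<^sub>L \<sigma>1 x" for x
  define M where "M l x = fadj (B x) o\<^sub>L op_inverse (X x) o\<^sub>L op_inverse (scalar_op l - A) o\<^sub>L B x o\<^sub>L \<sigma>1 x" for l x
  define N where "N x = fadj (B x) o\<^sub>L op_inverse (X x) o\<^sub>L B x o\<^sub>L \<sigma>1 x" for x
  have M: "M l x = P x o\<^sub>L R l o\<^sub>L Y x" for l x by (simp add: M_def P_def R_def Y_def blinfun_compose_assoc)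
  have N: "N x = P x o\<^sub>L Y x" for x by (simp add: N_def P_def Y_def blinfun_compose_assoc)
  have Plin: "complex_linear (P x)" if x: "x \<in> {a..d}" for x
    unfolding P_def
    by (intro complex_linear_compose is_adj_complex_linear [OF is_adj_sym [OF is_adj_fadj]] is_adj_complex_linear [OF is_adj_op_inverse])
       (use BX x in auto)
  define T where "T l x = id_blinfun - M l x" for l x
  define D where "D l x = S l x - T l x" for l x
  have Pcont: "continuous_on {a..d} P"
    unfolding P_def [abs_def]
    by (intro bounded_bilinear.continuous_on [OF bounded_bilinear_blinfun_compose] continuous_on_op_inverse inv
        has_ae_derivative_on_imp_continuous_on [OF X] has_ae_derivative_on_imp_continuous_on [OF Bs])
  obtain KP where KP: "KP \<ge> 0" "\<forall>x\<in>{a..d}. norm (P x) \<le> KP" using continuous_on_interval_bounded [OF Pcont] by blast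
  obtain KY where KY: "KY \<ge> 0" "\<forall>x\<in>{a..d}. norm (Y x) \<le> KY"
    using continuous_on_interval_bounded [OF has_ae_derivative_on_imp_continuous_on [OF Z]] by (auto simp: Y_def)
  \<comment> \<open>The circle lies strictly outside radius r, hence inside the domain of holomorphy
    and at a positive distance from the spectrum of A.\<close>
  define r1 where "r1 = r + 1"
  have r1: "r < r1" "norm A < r1" "0 < r1" using r by (auto simp: r1_def)
  define GM where "GM = KP * (1 / (r1 - norm A)) * KY"
  have Mbound: "norm (M l x) \<le> GM" if "cmod l = r1" "x \<in> {a..d}" for l x
  proof -
    have "norm (R l) \<le> 1 / (r1 - norm A)"
      using resolvent_series(3) [OF Alin, of l] that r1 by (simp add: R_def)
    then have "norm (P x) * norm (R l) * norm (Y x) \<le> KP * (1 / (r1 - norm A)) * KY"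
      using KP KY that r1 by (intro mult_mono) auto
    then show ?thesis unfolding M GM_def by (rule order_trans [OF norm_compose3_le])
  qed
  have GM0: "0 \<le> GM" using KP KY r1 by (simp add: GM_def)
  have Tbound: "norm (T l x) \<le> 1 + GM" if "cmod l = r1" "x \<in> {a..d}" for l x
    unfolding T_def using Mbound [OF that] norm_blinfun_id_le [where 'a='e]
    by (intro order_trans [OF norm_triangle_ineq4] add_mono)
  obtain ms where ms: "ms absolutely_integrable_on {a..b}" "\<forall>x. 0 \<le> ms x" "\<forall>x\<in>{a..b}. norm (s x) \<le> ms x"
    using strong_L1_bound [OF strong_L1_quotients(1)] by blast
  obtain mq where mq: "mq absolutely_integrable_on {a..b}" "\<forall>x. 0 \<le> mq x" "\<forall>x\<in>{a..b}. norm (q x) \<le> mq x"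
    using strong_L1_bound [OF strong_L1_quotients(2)] by blast
  obtain mp where mp: "mp absolutely_integrable_on {a..b}" "\<forall>x. 0 \<le> mp x" "\<forall>x\<in>{a..b}. norm (p x) \<le> mp x"
    using strong_L1_bound [OF strong_L1_quotients(3)] by blast
  have l\<Omega>: "l \<in> \<Omega>" if "r < cmod l" for l using \<Omega> that by auto
  have S_ode: "has_ae_derivative_on (S l)
    (\<lambda>x. flow l x (p x) (S l x)) {a..d}" if "r < cmod l" for l
    by (rule has_ae_derivative_on_subset [OF class_ode [OF S l\<Omega> [OF that]] sub])
  have commutator: "norm (flow l x (p x) F) \<le> (2 * r1 * ms x + mp x + mq x) * norm F"
    if "cmod l = r1" "x \<in> {a..b}" for l x F
  proof -
    have "norm (flow l x (p x) F)
      \<le> cmod l * (norm (s x) * norm F + norm F * norm (s x)) + norm (p x) * norm F + norm F * norm (q x)"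
      by (intro order_trans [OF norm_triangle_ineq4] order_trans [OF norm_triangle_ineq] add_mono norm_blinfun_compose
          order_trans [OF norm_blinfun_compose] mult_mono norm_scalar_op_le norm_ge_zero)
    also have "\<dots> \<le> r1 * (ms x * norm F + norm F * ms x) + mp x * norm F + norm F * mq x"
      using that ms mp mq r1 by (intro add_mono mult_mono mult_left_mono mult_right_mono) auto
    also have "\<dots> = (2 * r1 * ms x + mp x + mq x) * norm F" by (simp add: algebra_simps)
    finally show ?thesis .
  qed
  define m1 where "m1 x = (2 * r1) *\<^sub>R ms x + mp x + mq x" for x
  have m1: "m1 absolutely_integrable_on {a..d}" "\<And>x. 0 \<le> m1 x"
  proof -
    have "m1 absolutely_integrable_on {a..b}"
      unfolding m1_def by (intro set_integral_add absolutely_integrable_scaleR_left ms mp mq)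
    then show "m1 absolutely_integrable_on {a..d}" by (rule absolutely_integrable_on_subinterval) (rule sub)
  qed (use ms mp mq r1 in \<open>simp add: m1_def\<close>)
  define GS where "GS = (1 + GM) * exp (integral {a..d} m1)"
  \<comment> \<open>The class bounds S separately in x and in l, not at once on the interval and the
    circle. The joint bound is propagated by Gronwall from \<open>a\<close>, where S agrees with the
    transfer function.\<close>
  have Sbound: "norm (S l x) \<le> GS" if l: "cmod l = r1" and x: "x \<in> {a..d}" for l x
  proof -
    have "r < cmod l" using l r1 by simp
    have "norm (S l x) \<le> norm (S l a) * exp (integral {a..x} m1)"
      by (rule gronwall_ae [OF S_ode [OF \<open>r < cmod l\<close>] m1 _ x]) (use commutator [OF l] sub in \<open>auto simp: m1_def\<close>)
    also have "\<dots> \<le> (1 + GM) * exp (integral {a..d} m1)"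
    proof (intro mult_mono)
      show "norm (S l a) \<le> 1 + GM"
        using Tbound [OF l ad] init [rule_format, OF \<open>r < cmod l\<close>] by (simp add: T_def M_def)
      have i: "m1 integrable_on {a..d}" using m1(1) by (rule set_lebesgue_integral_eq_integral(1))
      have "integral {a..x} m1 \<le> integral {a..d} m1"
        using x m1(2) by (intro integral_subset_le integrable_on_subinterval [OF i] i) auto
      then show "exp (integral {a..x} m1) \<le> exp (integral {a..d} m1)" by simp
    qed (use GM0 in auto)
    finally show ?thesis by (simp add: GS_def)
  qed
  have Shol: "(\<lambda>l. cinner (S l x u) v) holomorphic_on {l. r < cmod l}" if "x \<in> {a..d}" for x u v
    using that sub by (intro holomorphic_on_subset [OF class_IrD(1) [OF S] \<Omega>]) auto
  have Mhol: "(\<lambda>l. cinner (M l x u) v) holomorphic_on {l. r < cmod l}" if "x \<in> {a..d}" for x u v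
    using holomorphic_resolvent [OF Alin r(2,1) Plin [OF that], of "Y x u" v] by (simp add: M R_def)
  have idhol: "(\<lambda>l. cinner ((S l x - id_blinfun) u) v) holomorphic_on {l. r < cmod l}" if "x \<in> {a..d}" for x u v
    using holomorphic_on_diff [OF Shol [OF that, of u v] holomorphic_on_const [of "cinner u v"]]
    by (simp add: blinfun.diff_left cinner_diff_left)
  have Dhol: "(\<lambda>l. cinner (D l x u) v) holomorphic_on {l. r < cmod l}" if "x \<in> {a..d}" for x u v
    using holomorphic_on_add [OF idhol [OF that, of u v] Mhol [OF that, of u v]]
    by (simp add: D_def T_def blinfun.diff_left blinfun.add_left cinner_diff_left cinner_add_left algebra_simps)
  have Slim: "((\<lambda>l. S l x - id_blinfun) \<longlongrightarrow> 0) at_infinity" if "x \<in> {a..d}" for x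
    using that sub by (intro LIM_zero class_IrD(2) [OF S]) auto
  have Mlim: "((\<lambda>l. M l x) \<longlongrightarrow> 0) at_infinity" for x
  proof -
    have "((\<lambda>l. M l x) \<longlongrightarrow> P x o\<^sub>L 0 o\<^sub>L Y x) at_infinity"
      unfolding M R_def
      by (intro bounded_bilinear.tendsto [OF bounded_bilinear_blinfun_compose] tendsto_const tendsto_resolvent_at_infinity Alin)
    moreover have "P x o\<^sub>L 0 o\<^sub>L Y x = 0" by (intro blinfun_eqI) simp
    ultimately show ?thesis by simp
  qed
  have Dlim: "((\<lambda>l. D l x) \<longlongrightarrow> 0) at_infinity" if "x \<in> {a..d}" for x
  proof -
    have "((\<lambda>l. (S l x - id_blinfun) + M l x) \<longlongrightarrow> 0 + 0) at_infinity"
      by (intro tendsto_add Slim Mlim that)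
    then show ?thesis by (simp add: D_def T_def algebra_simps)
  qed
  have idbound: "norm (S l x - id_blinfun) \<le> GS + 1" if "cmod l = r1" "x \<in> {a..d}" for l x
    using Sbound [OF that] norm_blinfun_id_le [where 'a='e] by (intro order_trans [OF norm_triangle_ineq4] add_mono)
  have "\<exists>L. ((\<lambda>l. scalar_op l o\<^sub>L (S l x - id_blinfun)) \<longlongrightarrow> L) at_infinity" if "x \<in> {a..d}" for x
    using exterior_residue(1) [OF idhol [OF that] r(1) r1(1) Slim [OF that] idbound [OF _ that]] by blast
  then obtain L where L: "\<And>x. x \<in> {a..d} \<Longrightarrow> ((\<lambda>l. scalar_op l o\<^sub>L (S l x - id_blinfun)) \<longlongrightarrow> L x) at_infinity"
    by metis
  have res: "AE x in lebesgue. x \<in> {a..d} \<longrightarrow> (s x o\<^sub>L L x) - (L x o\<^sub>L s x) + p x - q x = 0"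
    by (rule class_residue [OF S \<Omega> r(1) r1(1) d idbound L])
  have Nlim: "((\<lambda>l. scalar_op l o\<^sub>L M l x) \<longlongrightarrow> N x) at_infinity" if x: "x \<in> {a..d}" for x
  proof -
    have "((\<lambda>l. P x o\<^sub>L (scalar_op l o\<^sub>L R l) o\<^sub>L Y x) \<longlongrightarrow> P x o\<^sub>L id_blinfun o\<^sub>L Y x) at_infinity"
      unfolding R_def
      by (intro bounded_bilinear.tendsto [OF bounded_bilinear_blinfun_compose] tendsto_const tendsto_scaled_resolvent_at_infinity Alin)
    moreover have "P x o\<^sub>L (scalar_op l o\<^sub>L R l) o\<^sub>L Y x = scalar_op l o\<^sub>L M l x" for l
      by (intro blinfun_eqI) (simp add: M complex_linearD [OF Plin [OF x]])
    ultimately show ?thesis by (simp add: N)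
  qed
  have D0: "((\<lambda>l. scalar_op l o\<^sub>L D l x) \<longlongrightarrow> L x + N x) at_infinity" if "x \<in> {a..d}" for x
  proof -
    have "(scalar_op l o\<^sub>L (S l x - id_blinfun)) + (scalar_op l o\<^sub>L M l x) = scalar_op l o\<^sub>L D l x" for l
      by (intro blinfun_eqI) (simp add: D_def T_def blinfun.diff_left blinfun.add_left scaleC_diff_right)
    then show ?thesis using tendsto_add [OF L [OF that] Nlim [OF that]] by simp
  qed
  \<comment> \<open>The residue at x is bounded by the values of D on the whole circle at the same
    x. This nonlocal term is what couples the equations for different l.\<close>
  have D0_le: "norm (L x + N x) \<le> r1 * G" if x: "x \<in> {a..d}" and G: "\<And>l. cmod l = r1 \<Longrightarrow> norm (D l x) \<le> G" for x G
  proof -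
    obtain L' where L': "((\<lambda>l. scalar_op l o\<^sub>L D l x) \<longlongrightarrow> L') at_infinity" "norm L' \<le> r1 * G"
      using exterior_residue(1) [OF Dhol [OF x] r(1) r1(1) Dlim [OF x] G] by blast
    have "L' = L x + N x"
      by (rule tendsto_unique [OF _ L'(1) D0 [OF x]]) (use trivial_limit_at_infinity in auto)
    then show ?thesis using L'(2) by simp
  qed
  \<comment> \<open>The flow of S applied to D, plus the difference of the two output coefficients
    acting on T.\<close>
  define D' where "D' l x = (flow l x (p x) (D l x))
    - (((s x o\<^sub>L (L x + N x)) - ((L x + N x) o\<^sub>L s x)) o\<^sub>L T l x)" for l x
  have D_ode: "has_ae_derivative_on (D l) (D' l) {a..d}" if l: "r < cmod l" for l
  proof -
    have "norm A < cmod l" using l r by simp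
    note T_ode = transfer_ode [OF A d(2) this ev]
    show ?thesis
    proof (rule has_ae_derivative_on_cong [OF has_ae_derivative_on_diff [OF S_ode [OF l] T_ode]])
      show "S l x - transfer A B X l x = D l x" for x
        by (simp add: D_def T_def M_def)
      show "AE x in lebesgue. x \<in> {a..d} \<longrightarrow> flow l x (p x) (S l x)
          - flow l x (q x + ((s x o\<^sub>L (fadj (B x) o\<^sub>L op_inverse (X x) o\<^sub>L B x o\<^sub>L \<sigma>1 x))
              - ((fadj (B x) o\<^sub>L op_inverse (X x) o\<^sub>L B x o\<^sub>L \<sigma>1 x) o\<^sub>L s x))) (transfer A B X l x) = D' l x"
        unfolding M_def [symmetric] N_def [symmetric] T_def [symmetric]
        using res
      proof eventually_elim
        case (elim x)
        show ?case
        proof (intro impI blinfun_eqI)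
          fix u
          assume x: "x \<in> {a..d}"
          have T: "S l x y = D l x y + T l x y" for y by (simp add: D_def blinfun.diff_left)
          have "(s x o\<^sub>L L x) - (L x o\<^sub>L s x) + p x - q x = 0" using elim x by blast
          from arg_cong [OF this, of "\<lambda>F. blinfun_apply F (T l x u)"]
          have qT: "q x (T l x u) = s x (L x (T l x u)) - L x (s x (T l x u)) + p x (T l x u)"
            by (simp add: blinfun_linear)
          show "blinfun_apply (flow l x (p x) (S l x) - flow l x (q x + ((s x o\<^sub>L N x) - (N x o\<^sub>L s x))) (T l x)) u
            = blinfun_apply (D' l x) u"
            by (simp add: D'_def blinfun_linear T qT scaleC_diff_right scaleC_add_right algebra_simps)
        qed
      qed
    qed
  qed
  \<comment> \<open>2 r1 (1 + GM) pays for the commutator of s with the residue, which is at most r1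
    \<phi>, times the bound 1 + GM on T; the remaining terms come from
    \<open>commutator\<close>.\<close>
  define m where "m x = (2 * r1 + 2 * r1 * (1 + GM)) *\<^sub>R ms x + mp x + mq x" for x
  have m: "m absolutely_integrable_on {a..d}"
  proof -
    have "m absolutely_integrable_on {a..b}"
      unfolding m_def by (intro set_integral_add absolutely_integrable_scaleR_left ms mp mq)
    then show ?thesis by (rule absolutely_integrable_on_subinterval) (rule sub)
  qed
  have circle: "D l x = 0" if l: "cmod l = r1" and x: "x \<in> {a..d}" for l x
  proof (rule iterated_integral_bound_imp_zero [where G = D and I = "{l. cmod l = r1}" and M = "GS + (1 + GM)", OF m])
    show "norm (D l t) \<le> GS + (1 + GM)" if "l \<in> {l. cmod l = r1}" "t \<in> {a..d}" for l t
      unfolding D_def using Sbound [of l t] Tbound [of l t] that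
      by (intro order_trans [OF norm_triangle_ineq4] add_mono) auto
    fix l x \<phi> c
    assume l: "l \<in> {l. cmod l = r1}" and x: "x \<in> {a..d}"
      and \<phi>: "\<And>j t. j \<in> {l. cmod l = r1} \<Longrightarrow> t \<in> {a..x} \<Longrightarrow> norm (D j t) \<le> \<phi> t"
      and c: "((\<lambda>t. m t * \<phi> t) has_integral c) {a..x}"
    have lr: "r < cmod l" using l r1 by simp
    have "D l a = 0" using init [rule_format, OF lr] by (simp add: D_def T_def M_def)
    note I = has_ae_derivative_on_eq_integral [OF D_ode [OF lr] x]
    have "norm (integral {a..x} (D' l)) \<le> integral {a..x} (\<lambda>t. m t * \<phi> t)"
    proof (rule Henstock_Kurzweil_Integration.integral_norm_bound_integral)
      show "D' l integrable_on {a..x}" using I(1) by blast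
      show "(\<lambda>t. m t * \<phi> t) integrable_on {a..x}" using c by blast
      fix t assume t: "t \<in> {a..x}"
      then have td: "t \<in> {a..d}" and tb: "t \<in> {a..b}" using x d by auto
      have \<phi>0: "0 \<le> \<phi> t" using \<phi> [OF l t] norm_ge_zero order_trans by blast
      have LN: "norm (L t + N t) \<le> r1 * \<phi> t" by (rule D0_le [OF td]) (use \<phi> t in auto)
      have "norm (D' l t) \<le> (2 * r1 * ms t + mp t + mq t) * norm (D l t)
        + (norm (s t) * norm (L t + N t) + norm (L t + N t) * norm (s t)) * norm (T l t)"
        unfolding D'_def using l tb
        by (intro order_trans [OF norm_triangle_ineq4] add_mono commutator order_trans [OF norm_blinfun_compose] mult_right_mono norm_blinfun_compose norm_ge_zero) auto
      also have "\<dots> \<le> (2 * r1 * ms t + mp t + mq t) * \<phi> t + (ms t * (r1 * \<phi> t) + (r1 * \<phi> t) * ms t) * (1 + GM)"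
        using \<phi> [OF l t] \<phi>0 ms mp mq tb LN Tbound [OF _ td, of l] l r1
        by (intro add_mono mult_mono) (auto intro!: add_nonneg_nonneg mult_nonneg_nonneg)
      also have "\<dots> = m t * \<phi> t" by (simp add: m_def algebra_simps)
      finally show "norm (D' l t) \<le> m t * \<phi> t" .
    qed
    also have "\<dots> = c" using c by (rule integral_unique)
    finally show "norm (D l x) \<le> c" using I(2) \<open>D l a = 0\<close> by simp
  qed (use l x in auto)
  show "\<forall>x\<in>{a..d}. \<forall>l. r < cmod l \<longrightarrow>
      S l x = transfer A B X l x"
  proof (intro ballI allI impI)
    fix x l assume x: "x \<in> {a..d}" and l: "r < cmod l"
    have "D l x = 0" by (rule exterior_disc_eqI [OF Dhol [OF x] r(1) r1(1) circle [OF _ x] l])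
    then show "S l x = transfer A B X l x"
      by (simp add: D_def T_def M_def)
  qed
  \<comment> \<open>D vanishes on the circle, so the residue bound holds with the constant
    0.\<close>
  have LN0: "L x + N x = 0" if x: "x \<in> {a..d}" for x
    using D0_le [OF x, of 0] circle [OF _ x] by simp
  show "AE x in lebesgue. x \<in> {a..d} \<longrightarrow>
      \<gamma>s x = \<gamma> x + (\<sigma>2 x o\<^sub>L fadj (B x) o\<^sub>L op_inverse (X x) o\<^sub>L B x o\<^sub>L \<sigma>1 x)
                - (\<sigma>1 x o\<^sub>L fadj (B x) o\<^sub>L op_inverse (X x) o\<^sub>L B x o\<^sub>L \<sigma>2 x)"
    using res
  proof eventually_elim
    case (elim x)
    show ?case
    proof
      assume x: "x \<in> {a..d}"
      then have xb: "x \<in> {a..b}" using sub by auto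
      have "L x = - N x" using LN0 [OF x] by (simp add: eq_neg_iff_add_eq_0)
      then have E: "p x = q x + ((s x o\<^sub>L N x) - (N x o\<^sub>L s x))"
        using elim x by (simp add: bounded_bilinear.minus_left [OF bounded_bilinear_blinfun_compose]
            bounded_bilinear.minus_right [OF bounded_bilinear_blinfun_compose] algebra_simps)
      show "\<gamma>s x = \<gamma> x + (\<sigma>2 x o\<^sub>L fadj (B x) o\<^sub>L op_inverse (X x) o\<^sub>L B x o\<^sub>L \<sigma>1 x)
                - (\<sigma>1 x o\<^sub>L fadj (B x) o\<^sub>L op_inverse (X x) o\<^sub>L B x o\<^sub>L \<sigma>2 x)"
      proof (rule blinfun_eqI)
        fix u
        from arg_cong [OF E, of "\<lambda>F. \<sigma>1 x (blinfun_apply F u)"]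
        show "\<gamma>s x u = blinfun_apply (\<gamma> x + (\<sigma>2 x o\<^sub>L fadj (B x) o\<^sub>L op_inverse (X x) o\<^sub>L B x o\<^sub>L \<sigma>1 x)
                - (\<sigma>1 x o\<^sub>L fadj (B x) o\<^sub>L op_inverse (X x) o\<^sub>L B x o\<^sub>L \<sigma>2 x)) u"
          using xb by (simp add: p_def q_def s_def N_def blinfun_linear)
      qed
    qed
  qed
qed

end

theorem theorem1p1:
  fixes \<sigma>1 \<sigma>2 \<gamma> \<gamma>s :: "real \<Rightarrow> ('e::{complex_hilbert, euclidean_space}) \<Rightarrow>\<^sub>L 'e"
    and a b :: real
    and \<Omega> :: "complex set"
    and S :: "complex \<Rightarrow> real \<Rightarrow> 'e \<Rightarrow>\<^sub>L 'e"
  assumes "vessel_parameters \<sigma>1 \<sigma>2 \<gamma> \<gamma>s a b"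
    and "class_Ir \<sigma>1 \<sigma>2 \<gamma> \<gamma>s a b \<Omega> S"
  shows "\<exists>c d. a \<le> c \<and> c < d \<and> d \<le> b \<and>
    (\<exists>(A :: ell2 \<Rightarrow>\<^sub>L ell2) B X. regular_vessel A B X \<sigma>1 \<sigma>2 \<gamma> \<gamma>s c d \<and>
      (\<forall>x\<in>{c..d}. \<forall>l\<in>\<Omega> \<inter> resolvent_set A. transfer_function A B X \<sigma>1 l x = S l x))"
proof -
  interpret vessel_coefficients \<sigma>1 \<sigma>2 \<gamma> \<gamma>s a b
    by (simp add: vessel_coefficients_def assms(1))
  note S = assms(2)
  have aI: "a \<in> {a..b}" using a_less_b by simp
  obtain R where R: "{l. R < norm l} \<subseteq> \<Omega>" using S unfolding class_Ir_def by blast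
  \<comment> \<open>R may be negative, while a positive radius is needed for the inversion of the
    exterior.\<close>
  define \<rho> where "\<rho> = max R 1"
  have \<rho>: "0 < \<rho>" and \<Omega>: "{l. \<rho> < cmod l} \<subseteq> \<Omega>" using R by (auto simp: \<rho>_def)
  have hol: "(\<lambda>l. cinner (S l a u) v) holomorphic_on {l. \<rho> < cmod l}" for u v
    by (rule holomorphic_on_subset [OF class_IrD(1) [OF S aI] \<Omega>])
  have linS: "complex_linear (S l a)" if "\<rho> < cmod l" for l
    using \<Omega> that by (intro class_IrD(3) [OF S _ aI]) auto
  \<comment> \<open>l and - cnj l have the same modulus, so both lie in the domain of
    analyticity.\<close>
  have sym: "fadj (S (- cnj l) a) o\<^sub>L \<sigma>1 a o\<^sub>L S l a = \<sigma>1 a" if "\<rho> < cmod l" for l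
    using class_IrD(4) [OF S _ _ aI, of l] adj_eq_fadj [OF linS, of "- cnj l"] that \<Omega> by (auto simp: subset_iff)
  obtain A :: "ell2 \<Rightarrow>\<^sub>L ell2" and Aa B0 X0 r where A: "is_adj A Aa" and B0: "complex_linear B0"
    and X0: "is_adj X0 X0" "op_invertible X0"
    and lyap: "(A o\<^sub>L X0) + (X0 o\<^sub>L Aa) + (B0 o\<^sub>L \<sigma>1 a o\<^sub>L fadj B0) = 0"
    and r: "\<rho> \<le> r" "norm A \<le> r" and res: "resolvent_set A \<subseteq> {l. r < cmod l}"
    and init: "\<forall>l. r < cmod l \<longrightarrow> S l a = id_blinfun - (fadj B0 o\<^sub>L op_inverse X0 o\<^sub>L op_inverse (scalar_op l - A) o\<^sub>L B0 o\<^sub>L \<sigma>1 a)"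
    using exterior_realization [OF hol \<rho> class_IrD(2) [OF S aI] linS op_invertible_sigma1 [OF aI] selfadj(1) [OF aI] sym] by blast
  obtain B X d where d: "a < d" "d \<le> b" and Ba: "B a = B0" "X a = X0" and ev: "evolves A Aa B X d"
    using vessel_evolution [OF A B0 X0 lyap] by blast
  note BX = ev [unfolded evolves_def, THEN conjunct1]
    and Z = ev [unfolded evolves_def, THEN conjunct2, THEN conjunct1]
    and X = ev [unfolded evolves_def, THEN conjunct2, THEN conjunct2, THEN conjunct1]
  have r': "0 < r" "{l. r < cmod l} \<subseteq> \<Omega>" using r \<rho> \<Omega> by auto
  have init': "\<forall>l. r < cmod l \<longrightarrow> S l a = transfer A B X l a"
    using init by (simp add: Ba)
  note main = transfer_eq_class [OF S r'(2,1) r(2) A d ev init']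
  have adjB: "adj (B x) = fadj (B x)" if "x \<in> {a..d}" for x
    using BX that by (intro adj_eq_fadj) blast
  have adjA: "adj A = Aa" by (rule is_adj_imp_adj [OF A])
  have sub: "{a..d} \<subseteq> {a..b}" using d by auto
  have vp: "vessel_parameters \<sigma>1 \<sigma>2 \<gamma> \<gamma>s a d"
  proof -
    have "locally_integrable_on F a d" if "locally_integrable_on F a b" for F :: "real \<Rightarrow> 'e \<Rightarrow>\<^sub>L 'e"
      using that sub unfolding locally_integrable_on_def by (blast intro: absolutely_integrable_on_subinterval)
    moreover have "(\<sigma>1 has_vector_derivative - (\<gamma> x + adj (\<gamma> x))) (at x within {a..d})" if "x \<in> {a..d}" for x
    proof (rule has_vector_derivative_within_subset [OF _ sub])
      show "(\<sigma>1 has_vector_derivative - (\<gamma> x + adj (\<gamma> x))) (at x within {a..b})"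
        using assms(1) that sub unfolding vessel_parameters_def by blast
    qed
    ultimately show ?thesis
      using assms(1) d(1) sub unfolding vessel_parameters_def by blast
  qed
  have growth: "\<exists>x0\<in>{a..d}. \<exists>C>0. \<forall>n\<ge>1. norm (((\<lambda>T. A o\<^sub>L T) ^^ n) (B x0)) \<le> (C * sqrt (real n)) ^ n"
  \<comment> \<open>A bounded A gives geometric growth. The factor |B0| is absorbed into an n-th
    power because |B0| + 1 is at least 1, and the factor sqrt n is at least 1 for n \<ge> 1.\<close>
  proof (intro bexI [of _ a] exI [of _ "(norm A + 1) * (norm B0 + 1)"] conjI allI impI)
    fix n :: nat assume n: "1 \<le> n"
    have "norm (((\<lambda>T. A o\<^sub>L T) ^^ n) T) \<le> norm A ^ n * norm T" for T :: "'e \<Rightarrow>\<^sub>L ell2" and n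
    proof (induction n)
      case (Suc n)
      have "norm (((\<lambda>T. A o\<^sub>L T) ^^ Suc n) T) \<le> norm A * norm (((\<lambda>T. A o\<^sub>L T) ^^ n) T)"
        by (simp add: norm_blinfun_compose)
      also have "\<dots> \<le> norm A * (norm A ^ n * norm T)" by (intro mult_left_mono Suc) simp
      finally show ?case by (simp add: mult_ac)
    qed simp
    then have "norm (((\<lambda>T. A o\<^sub>L T) ^^ n) (B a)) \<le> norm A ^ n * norm B0" by (simp add: Ba)
    also have "\<dots> \<le> (norm A + 1) ^ n * (norm B0 + 1) ^ n"
    proof (intro mult_mono power_mono)
      have "norm B0 \<le> (norm B0 + 1) ^ 1" by simp
      also have "\<dots> \<le> (norm B0 + 1) ^ n" using n by (intro power_increasing) auto
      finally show "norm B0 \<le> (norm B0 + 1) ^ n" .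
    qed auto
    also have "\<dots> \<le> ((norm A + 1) ^ n * (norm B0 + 1) ^ n) * sqrt (real n) ^ n"
    proof -
      have "1 \<le> sqrt (real n) ^ n" using n by (intro one_le_power) simp
      then have "((norm A + 1) ^ n * (norm B0 + 1) ^ n) * 1 \<le> ((norm A + 1) ^ n * (norm B0 + 1) ^ n) * sqrt (real n) ^ n"
        by (intro mult_left_mono) auto
      then show ?thesis by simp
    qed
    finally show "norm (((\<lambda>T. A o\<^sub>L T) ^^ n) (B a)) \<le> ((norm A + 1) * (norm B0 + 1) * sqrt (real n)) ^ n"
      by (simp add: power_mult_distrib)
  qed (use d in \<open>auto intro!: mult_pos_pos add_nonneg_pos\<close>)
  have "regular_vessel A B X \<sigma>1 \<sigma>2 \<gamma> \<gamma>s a d"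
    unfolding regular_vessel_def
  proof (intro conjI vp growth is_adj_complex_linear [OF A] Z)
    show "\<forall>x\<in>{a..d}. complex_linear (B x) \<and> complex_linear (X x)"
      using BX is_adj_complex_linear by blast
    show "\<forall>x\<in>{a..d}. self_adjoint (X x) \<and> op_invertible (X x)"
      using BX is_adj_imp_adj unfolding self_adjoint_def by blast
    show "\<forall>x\<in>{a..d}. (A o\<^sub>L X x) + (X x o\<^sub>L adj A) + (B x o\<^sub>L \<sigma>1 x o\<^sub>L adj (B x)) = 0"
      using BX adjB adjA by simp
    show "has_ae_derivative_on X (\<lambda>x. B x o\<^sub>L \<sigma>2 x o\<^sub>L adj (B x)) {a..d}"
      by (rule has_ae_derivative_on_eq_rhs [OF X]) (simp add: adjB)
    show "AE x in lebesgue. x \<in> {a..d} \<longrightarrow>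
      \<gamma>s x = \<gamma> x + (\<sigma>2 x o\<^sub>L adj (B x) o\<^sub>L op_inverse (X x) o\<^sub>L B x o\<^sub>L \<sigma>1 x)
                - (\<sigma>1 x o\<^sub>L adj (B x) o\<^sub>L op_inverse (X x) o\<^sub>L B x o\<^sub>L \<sigma>2 x)"
      using main(2) by eventually_elim (simp add: adjB)
  qed
  moreover have "transfer_function A B X \<sigma>1 l x = S l x" if "x \<in> {a..d}" "l \<in> \<Omega> \<inter> resolvent_set A" for x l
  proof -
    \<comment> \<open>The disc of radius r consists of spectrum, so every admissible l lies in the
      region where the identification has been proved.\<close>
    have "r < cmod l" using that res by auto
    then show ?thesis
      using main(1) that by (simp add: transfer_function_def adjB)
  qed
  ultimately show ?thesis using d by (intro exI [of _ a] exI [of _ d]) blast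
qed

end
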